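(* Fix $t_+\in\mathbb{C}\setminus(-\infty,-1]$ and $t_-\in\mathbb{C}\setminus[1,\infty)$, and let $r\ge1$. For all non-negative integers $k_1,\dots,k_r$, the value $\zeta_{\widehat{\mathcal{U}}}(-k_1,\dots,-k_r;t_+,t_-)$ is given by a polynomial in $t_+,t_-$ with rational coefficients (independent of $t_\pm$). Moreover, the generating function \[G_r(z_1,\dots,z_r;t_\pm)=\sum_{k_1,\dots,k_r\ge0}\zeta_{\widehat{\mathcal{U}}}(-k_1,\dots,-k_r;t_+,t_-)\frac{z_1^{k_1}}{k_1!}\cdots\frac{z_r^{k_r}}{k_r!}\] satisfies \[G_r(z_1,\dots,z_r;t_\pm)=\sum_{i=0}^r(-1)^{r-i}e^{t_+(z_1+\cdots+z_i)+t_-(z_{i+1}+\cdots+z_r)}\prod_{l=1}^{i}\frac{e^{z_l+\cdots+z_i}}{1-e^{z_l+\cdots+z_i}}\prod_{l=i+1}^{r}\frac{1}{1-e^{z_{i+1}+\cdots+z_l}}.\]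
   Context: Empty products equal $1$. For $t\in\mathbb{C}\setminus[1,\infty)$, $\zeta(s_1,\dots,s_r;t)=\sum_{0<n_1<\cdots<n_r}\prod_j(n_j-t)^{-s_j}$ (principal branch of $\log(n-t)$), absolutely convergent when $\Re(s_j)+\cdots+\Re(s_r)>r+1-j$ for all $j$, meromorphically continued to $\mathbb{C}^r$; $\zeta(\varnothing;t)=1$. For $t_+\in\mathbb{C}\setminus(-\infty,-1]$, $t_-\in\mathbb{C}\setminus[1,\infty)$, $\zeta_{\widehat{\mathcal{U}}}(s_1,\dots,s_r;t_+,t_-)=\sum_{i=0}^r e^{\pi i(s_{i+1}+\cdots+s_r)}\zeta(s_1,\dots,s_i;-t_+)\zeta(s_r,\dots,s_{i+1};t_-)$, which is known (Komori) to extend to an entire function of $(s_1,\dots,s_r)$ for fixed $t_\pm$; the values at non-positive integers refer to this continuation. *)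

theory Defs
  imports "HOL-Analysis.Analysis"
begin

text \<open>Multiple Hurwitz-type zeta series
  zeta(s_1,...,s_r;t) = sum over 0<n_1<...<n_r of prod_j (n_j - t) powr (-s_j),
  with the principal branch (powr on complex uses the principal Ln).
  Indices of lists are 0-based: s!0 = s_1.\<close>
definition mzeta :: "complex list \<Rightarrow> complex \<Rightarrow> complex" where
  "mzeta s t = (\<Sum>\<^sub>\<infinity> ns \<in> {ns. length ns = length s \<and> sorted_wrt (<) ns \<and> (\<forall>x\<in>set ns. 0 < x)}.
      \<Prod>j<length s. (of_nat (ns ! j) - t) powr (- (s ! j)))"

definition zetaU_series :: "complex \<Rightarrow> complex \<Rightarrow> complex list \<Rightarrow> complex" where
  "zetaU_series tp tm s = (\<Sum>i=0..length s.
      exp (pi * \<i> * sum_list (drop i s)) * mzeta (take i s) (- tp) * mzeta (rev (drop i s)) tm)"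

text \<open>F is the entire continuation (in r variables) of zetaU_series: separately holomorphic
  in each variable on all of C^r (equivalently, by Hartogs, holomorphic), and equal to the
  absolutely convergent series on the region where all Re(s_j) > 1.  Such an F is unique.\<close>
definition is_zetaU_entire :: "complex \<Rightarrow> complex \<Rightarrow> nat \<Rightarrow> (complex list \<Rightarrow> complex) \<Rightarrow> bool" where
  "is_zetaU_entire tp tm r F \<longleftrightarrow>
     (\<forall>s. length s = r \<longrightarrow> (\<forall>j<r. (\<lambda>w. F (s[j := w])) holomorphic_on UNIV)) \<and>
     (\<forall>s. length s = r \<and> (\<forall>x\<in>set s. 1 < Re x) \<longrightarrow> F s = zetaU_series tp tm s)"

definition zsum :: "complex list \<Rightarrow> nat \<Rightarrow> nat \<Rightarrow> complex" where
  "zsum z a b = (\<Sum>m=a..<b. z ! m)"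

definition G_rhs :: "complex \<Rightarrow> complex \<Rightarrow> complex list \<Rightarrow> complex" where
  "G_rhs tp tm z = (let r = length z in
     \<Sum>i=0..r. (-1) ^ (r - i) * exp (tp * zsum z 0 i + tm * zsum z i r)
        * (\<Prod>l<i. exp (zsum z l i) / (1 - exp (zsum z l i)))
        * (\<Prod>l=i..<r. 1 / (1 - exp (zsum z i (Suc l)))))"

end

theory Submission
  imports Defs "HOL-Complex_Analysis.Conformal_Mappings"
begin

text \<open>
  Since \<open>F\<close> is entire in each variable separately, its value at \<open>(-k\<^sub>1, \<dots>, -k\<^sub>r)\<close> can be computed by
  continuing one variable at a time, starting with \<open>s\<^sub>r\<close> and keeping the remaining variables in the region of
  convergence. Euler-Maclaurin summation continues the terms in \<open>s\<^sub>r\<close>, and at \<open>s\<^sub>r = -k\<close> the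
  remainders vanish. If \<open>A(x) - A(x + 1) = x ^ k\<close>, the symmetry of the Bernoulli polynomials makes the
  contributions of both ends fit together: summing out the last variable replaces the weight
  \<open>y ^ k\<close> of the last entry by the weight \<open>A(x + 1) - A(t\<^sub>-)\<close> of the entry before it, where \<open>x\<close> is \<open>n + t\<^sub>+\<close> for an
  entry \<open>n\<close> of the first factor and \<open>t\<^sub>- - n\<close> for one of the second. After \<open>r\<close> steps the value is the
  polynomial interpolating the finite sums \<open>\<Sum> \<Prod>\<^sub>j (t\<^sub>+ + a\<^sub>j) ^ k\<^sub>j\<close> over
  \<open>0 < a\<^sub>1 < \<dots> < a\<^sub>r < N\<close> at \<open>N = t\<^sub>- - t\<^sub>+\<close>. On exponentials one step sends \<open>e ^ (\<lambda> y)\<close> to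
  \<open>(e ^ (\<lambda> (x + 1)) - e ^ (\<lambda> t\<^sub>-)) / (1 - e ^ \<lambda>)\<close>, which gives a recursion for the generating function that
  its closed form satisfies as well.
\<close>

section \<open>Bernoulli numbers\<close>

text \<open>The several-variable continuation of \<open>mzeta\<close> is never built. When s_r
  moves, only two products in \<open>zetaU_series\<close> need continuing: the one with the full
  \<open>mzeta s (- tp)\<close>, where s_r belongs to the largest index, and the one with the
  depth-one factor \<open>mzeta [s_r] tm\<close>. In every other product s_r belongs to the smallest
  index of a second factor of depth at least two, and the decay in the next index pays for the
  growth in it. The continued pieces may have a pole at s_r = 1; its cancellation need not be
  checked, because a ball minus finitely many points is connected and the identity theorem applies
  there.

  A step turns a weight of degree c into one of degree k + c + 1, so the remaining variables must
  lie further to the right than before. Hence the induction carries an arbitrary finite combination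
  of moments and an arbitrary threshold for the real parts.

  In the generating function an extra variable mu marks the degree c. Up to the factor 1 / (k! c!)
  the step depends on k and c only through k + c, so the binomial theorem merges z and mu into z +
  mu; this is how sums of consecutive z_j arise.\<close>

definition expm1_quot :: "complex fps" where
  "expm1_quot = Abs_fps (\<lambda>n. 1 / fact (Suc n))"

definition bern_fps :: "complex fps" where
  "bern_fps = inverse expm1_quot"

text \<open>The normalised Bernoulli number B_n / n!, with B_1 = -1/2, since \<open>bern_fps\<close>
  is the series of x / (e^x - 1).\<close>

definition bern :: "nat \<Rightarrow> complex" where
  "bern n = fps_nth bern_fps n"

lemma expm1_quot_nth: "fps_nth expm1_quot n = 1 / fact (Suc n)"
  by (simp add: expm1_quot_def)

lemma bern_fps_mult_expm1_quot: "bern_fps * expm1_quot = 1"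
  unfolding bern_fps_def by (rule inverse_mult_eq_1) (simp add: expm1_quot_nth)

lemma fps_X_mult_expm1_quot: "fps_X * expm1_quot = fps_exp 1 - 1"
proof (rule fps_ext)
  fix n show "fps_nth (fps_X * expm1_quot) n = fps_nth (fps_exp 1 - 1) n"
    by (cases n) (simp_all add: expm1_quot_nth del: fact_Suc)
qed

lemma bern_fps_mult_expm1: "bern_fps * (fps_exp 1 - 1) = fps_X"
  by (metis fps_X_mult_expm1_quot bern_fps_mult_expm1_quot mult.left_commute mult.right_neutral)

lemma bern_0: "bern 0 = 1"
  by (simp add: bern_def bern_fps_def expm1_quot_nth)

text \<open>This is the coefficient of x^(p-1) in \<open>bern_fps * expm1_quot = 1\<close>. It makes
  the Taylor terms collapse in \<open>sum_bern_powr_deriv\<close>.\<close>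

lemma bern_convolution: "(\<Sum>j<p. bern j / fact (p - j)) = (if p = 1 then 1 else 0)"
proof (cases p)
  case (Suc n)
  have "(\<Sum>j<p. bern j / fact (p - j)) = fps_nth (bern_fps * expm1_quot) n"
    unfolding fps_mult_nth Suc lessThan_Suc_atMost atLeast0AtMost
    by (intro sum.cong) (auto simp: bern_def expm1_quot_nth Suc_diff_le)
  thus ?thesis by (simp add: bern_fps_mult_expm1_quot Suc)
qed auto

lemma bern_recursion:
  assumes "n > 0"
  shows "bern n = - (\<Sum>j<n. bern j / fact (Suc n - j))"
  using bern_convolution[of "Suc n"] assms by (simp add: eq_neg_iff_add_eq_0 add.commute)

lemma fact_Rats: "(fact n :: complex) \<in> \<rat>"
  by (metis Rats_of_nat of_nat_fact)

lemma bern_Rats: "bern n \<in> \<rat>"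
proof (induction n rule: less_induct)
  case (less n)
  show ?case
  proof (cases "n = 0")
    case False
    have "(\<Sum>j<n. bern j / fact (Suc n - j)) \<in> \<rat>"
      using less by (intro Rats_sum Rats_divide fact_Rats) auto
    thus ?thesis using bern_recursion[of n] False by simp
  qed (simp add: bern_0)
qed

lemma fact_ge_power2: "(2::real) ^ n \<le> fact (Suc n)"
proof (induction n)
  case (Suc n)
  have "(2::real) ^ Suc n \<le> 2 * fact (Suc n)" using Suc by simp
  also have "\<dots> \<le> of_nat (Suc (Suc n)) * fact (Suc n)" by (intro mult_right_mono) auto
  finally show ?case by simp
qed auto

text \<open>By strong induction the recursion is majorised by the geometric sum of 2^-(n-j) over j <
  n, which is below 1. The bound is crude, but it gives radius of convergence at least 1 and all
  later series live in the unit disc.\<close>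

lemma norm_bern_le: "norm (bern n) \<le> 1"
proof (induction n rule: less_induct)
  case (less n)
  show ?case
  proof (cases "n = 0")
    case False
    have "norm (bern n) \<le> (\<Sum>j<n. norm (bern j / fact (Suc n - j)))"
      using bern_recursion[of n] False by (simp add: norm_sum)
    also have "\<dots> \<le> (\<Sum>j<n. (1/2) ^ (n - j))"
    proof (intro sum_mono)
      fix j assume "j \<in> {..<n}"
      hence j: "j < n" by simp
      have "norm (bern j / fact (Suc n - j)) = norm (bern j) / fact (Suc (n - j))"
        using j by (simp add: norm_divide Suc_diff_le norm_fact del: fact_Suc)
      also have "\<dots> \<le> 1 / 2 ^ (n - j)"
        using less[OF j] fact_ge_power2[of "n - j"] by (intro frac_le) auto
      finally show "norm (bern j / fact (Suc n - j)) \<le> (1/2) ^ (n - j)" by (simp add: power_divide)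
    qed
    also have "\<dots> = (\<Sum>j<n. (1/2) ^ Suc j)"
      by (rule sum.reindex_bij_witness[of _ "\<lambda>j. n - Suc j" "\<lambda>j. n - Suc j"]) (auto simp: Suc_diff_Suc)
    also have "\<dots> \<le> 1"
    proof -
      have "(\<Sum>j<n. (1/2::real) ^ Suc j) = 1 - (1/2) ^ n"
        by (induction n) (auto simp: field_simps)
      thus ?thesis by simp
    qed
    finally show ?thesis .
  qed (simp add: bern_0)
qed

lemma fps_conv_radius_bern: "fps_conv_radius bern_fps \<ge> 1"
proof -
  have "conv_radius (fps_nth bern_fps) \<ge> 1"
  proof (rule conv_radius_geI_ex)
    fix r :: real assume r: "0 < r" "ereal r < 1"
    have "summable (\<lambda>n. norm (fps_nth bern_fps n * of_real r ^ n))"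
    proof (rule summable_comparison_test')
      show "summable (\<lambda>n. r ^ n)" using r by (intro summable_geometric) auto
      show "norm (norm (fps_nth bern_fps n * of_real r ^ n)) \<le> r ^ n" if "n \<ge> 0" for n
        using norm_bern_le[of n] r by (simp add: bern_def norm_mult norm_power mult_le_cancel_right1)
    qed
    hence "summable (\<lambda>n. fps_nth bern_fps n * of_real r ^ n)" by (rule summable_norm_cancel)
    thus "\<exists>z. norm z = r \<and> summable (\<lambda>n. fps_nth bern_fps n * z ^ n)"
      using r by (intro exI[of _ "of_real r"]) auto
  qed
  thus ?thesis by (simp add: fps_conv_radius_def)
qed

text \<open>The condition \<open>exp z \<noteq> 1\<close> excludes z = 0, where the quotient is 0 /
  0 = 0 while the series has value 1.\<close>

lemma bern_sums:
  assumes "norm z < 1" "exp z \<noteq> 1"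
  shows "(\<lambda>n. bern n * z ^ n) sums (z / (exp z - 1))"
proof -
  have rad: "ereal (norm z) < fps_conv_radius bern_fps"
    using fps_conv_radius_bern assms(1) by (metis ereal_less(3) less_le_trans)
  have "eval_fps (bern_fps * (fps_exp 1 - 1)) z = eval_fps bern_fps z * eval_fps (fps_exp 1 - 1) z"
    by (rule eval_fps_mult) (use rad fps_conv_radius_diff[of "fps_exp 1" "1::complex fps"] in auto)
  also have "eval_fps (fps_exp (1::complex) - 1) z = exp z - 1"
    by (subst eval_fps_diff) auto
  finally have "eval_fps bern_fps z = z / (exp z - 1)"
    using assms(2) by (simp add: bern_fps_mult_expm1 field_simps)
  thus ?thesis using sums_eval_fps[OF rad] by (simp add: bern_def)
qed

text \<open>\<open>bpoly a x\<close> is \<open>- B\<^sub>a\<^sub>+\<^sub>1(x) / (a + 1)\<close>, the regularised value of \<open>\<Sum>n\<ge>0. (x + n) ^ a\<close>.\<close>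
definition bpoly :: "nat \<Rightarrow> complex \<Rightarrow> complex" where
  "bpoly a x = - fact a * (\<Sum>j\<le>Suc a. bern j * x ^ (Suc a - j) / fact (Suc a - j))"

lemma bpoly_conv_fps: "bpoly a x = - fact a * fps_nth (bern_fps * fps_exp x) (Suc a)"
  unfolding bpoly_def fps_mult_nth atLeast0AtMost
  by (intro arg_cong2[where f="(*)"] sum.cong refl) (auto simp: bern_def)

text \<open>Provides the function A of the overview: the difference brings in the factor e^x - 1,
  which cancels the denominator of \<open>bern_fps\<close>.\<close>

lemma bpoly_diff: "bpoly a x - bpoly a (x + 1) = x ^ a"
proof -
  have "bpoly a x - bpoly a (x + 1) = fact a * fps_nth (bern_fps * fps_exp (x + 1) - bern_fps * fps_exp x) (Suc a)"
    by (simp add: bpoly_conv_fps algebra_simps)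
  also have "bern_fps * fps_exp (x + 1) - bern_fps * fps_exp x = bern_fps * (fps_exp 1 - 1) * fps_exp x"
    by (simp add: fps_exp_add_mult algebra_simps)
  also have "fps_nth \<dots> (Suc a) = x ^ a / fact a"
    by (simp add: bern_fps_mult_expm1)
  finally show ?thesis by simp
qed

text \<open>The formal version of -x / (e^-x - 1) = x e^x / (e^x - 1), obtained by multiplying both
  sides by e^x - 1 and cancelling.\<close>

lemma bern_fps_reflect: "bern_fps oo (- fps_X) = bern_fps * fps_exp 1"
proof -
  let ?N = "- fps_X :: complex fps"
  have *: "(f * g) oo ?N = (f oo ?N) * (g oo ?N)" for f g :: "complex fps"
    by (rule fps_compose_mult_distrib) auto
  have e: "fps_exp 1 oo ?N = fps_exp (-1 :: complex)"
    using fps_exp_compose_linear[of 1 "-1::complex"] by (simp flip: fps_const_neg)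
  have "(bern_fps oo ?N) * (fps_exp (-1) - 1) = ?N"
    using *[of bern_fps "fps_exp 1 - 1"]
    by (simp add: bern_fps_mult_expm1 fps_compose_sub_distrib e)
  hence "(bern_fps oo ?N) * (fps_exp (-1) - 1) * fps_exp 1 = ?N * fps_exp 1" by simp
  moreover have "(fps_exp (-1) - 1) * fps_exp (1::complex) = - (fps_exp 1 - 1)"
    using fps_exp_add_mult[of "-1" "1::complex"] by (simp add: algebra_simps)
  ultimately have "(bern_fps oo ?N) * (fps_exp 1 - 1) = fps_X * fps_exp 1"
    by (metis (no_types, lifting) minus_mult_left minus_mult_right mult.assoc neg_equal_iff_equal)
  also have "\<dots> = (bern_fps * fps_exp 1) * (fps_exp 1 - 1)"
    by (metis bern_fps_mult_expm1 mult.commute mult.left_commute)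
  finally show ?thesis
    by (metis bern_fps_mult_expm1 fps_X_neq_zero mult_cancel_right mult_zero_right)
qed

text \<open>The symmetry B_m(1 - x) = (-1)^m B_m(x) for m = a + 1. It translates between powers of n
  - t and of t - n, where the sign (-1)^a comes from the exponential factor in
  \<open>zetaU_series\<close>.\<close>

lemma bpoly_reflect: "(-1) ^ a * bpoly a (1 - x) = - bpoly a x"
proof -
  let ?N = "- fps_X :: complex fps"
  have "(bern_fps * fps_exp (1 - x)) oo ?N = (bern_fps oo ?N) * (fps_exp (1 - x) oo ?N)"
    by (rule fps_compose_mult_distrib) auto
  also have "fps_exp (1 - x) oo ?N = fps_exp (x - 1)"
    using fps_exp_compose_linear[of "1 - x" "-1"] by (simp flip: fps_const_neg)
  also have "(bern_fps oo ?N) * fps_exp (x - 1) = bern_fps * fps_exp x"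
    unfolding bern_fps_reflect mult.assoc fps_exp_add_mult[symmetric] by simp
  finally have "fps_nth ((bern_fps * fps_exp (1 - x)) oo ?N) (Suc a) = fps_nth (bern_fps * fps_exp x) (Suc a)"
    by simp
  moreover have "fps_nth ((bern_fps * fps_exp (1 - x)) oo ?N) (Suc a) = (-1) ^ Suc a * fps_nth (bern_fps * fps_exp (1 - x)) (Suc a)"
    by (simp add: fps_compose_uminus')
  ultimately have "fps_nth (bern_fps * fps_exp x) (Suc a) = (-1) ^ Suc a * fps_nth (bern_fps * fps_exp (1 - x)) (Suc a)"
    by simp
  thus ?thesis unfolding bpoly_conv_fps by (simp only: power_Suc) (simp add: algebra_simps)
qed

section \<open>Nested sums over increasing lists\<close>

definition increasing_lists :: "nat \<Rightarrow> nat list set" where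
  "increasing_lists m = {ns. length ns = m \<and> sorted_wrt (<) ns \<and> (\<forall>x\<in>set ns. 0 < x)}"

definition zterm :: "complex list \<Rightarrow> complex \<Rightarrow> nat list \<Rightarrow> complex" where
  "zterm s t ns = (\<Prod>j<length s. (of_nat (ns ! j) - t) powr (- (s ! j)))"

text \<open>The common majorant for all convergence proofs. It ignores the ordering of the entries,
  so its sum over all lists of a given length factorises.\<close>

definition inv_squares :: "nat list \<Rightarrow> real" where
  "inv_squares ns = (\<Prod>n\<leftarrow>ns. 1 / real n ^ 2)"

lemma zterm_Nil [simp]: "zterm [] t ns = 1"
  by (simp add: zterm_def)

lemma zterm_Cons: "zterm (w # s) t (n # ns) = (of_nat n - t) powr (-w) * zterm s t ns"
  by (simp add: zterm_def prod.lessThan_Suc_shift del: prod.lessThan_Suc)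

lemma zterm_snoc:
  assumes "length ns = length s"
  shows "zterm (s @ [w]) t (ns @ [n]) = zterm s t ns * (of_nat n - t) powr (-w)"
proof -
  have "zterm (s @ [w]) t (ns @ [n]) =
    (\<Prod>j<length s. (of_nat ((ns @ [n]) ! j) - t) powr (- ((s @ [w]) ! j))) * (of_nat n - t) powr (-w)"
    using assms by (simp add: zterm_def nth_append)
  also have "(\<Prod>j<length s. (of_nat ((ns @ [n]) ! j) - t) powr (- ((s @ [w]) ! j))) = zterm s t ns"
    unfolding zterm_def using assms by (intro prod.cong) (auto simp: nth_append)
  finally show ?thesis .
qed

lemma inv_squares_simps [simp]:
  "inv_squares [] = 1" "inv_squares (n # ns) = 1 / real n ^ 2 * inv_squares ns"
  "inv_squares (ns @ [n]) = inv_squares ns * (1 / real n ^ 2)"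
  by (simp_all add: inv_squares_def)

lemma inv_squares_nonneg: "inv_squares ns \<ge> 0"
  by (induction ns) auto

lemma increasing_lists_0 [simp]: "increasing_lists 0 = {[]}"
  by (auto simp: increasing_lists_def)

lemma summable_inverse_squares: "(\<lambda>n. 1 / real n ^ 2) summable_on A"
proof -
  have "(\<lambda>n. 1 / real n ^ 2) summable_on UNIV"
    by (rule summable_nonneg_imp_summable_on)
       (use inverse_power_summable[of 2, where 'a = real] in \<open>auto simp: inverse_eq_divide\<close>)
  thus ?thesis by (rule summable_on_subset) auto
qed

lemma summable_inv_squares: "inv_squares summable_on {ns. length ns = m}"
proof (induction m)
  case (Suc m)
  have "(\<lambda>(n, ns). 1 / real n ^ 2 * inv_squares ns) summable_on (UNIV \<times> {ns. length ns = m})"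
  proof (rule summable_on_SigmaI)
    show "((\<lambda>ns. case (n, ns) of (n, ns) \<Rightarrow> 1 / real n ^ 2 * inv_squares ns) has_sum
        1 / real n ^ 2 * infsum inv_squares {ns. length ns = m}) {ns. length ns = m}" for n
      using has_sum_cmult_right[OF has_sum_infsum[OF Suc], of "1 / real n ^ 2"] by simp
    show "(\<lambda>n. 1 / real n ^ 2 * infsum inv_squares {ns. length ns = m}) summable_on UNIV"
      by (rule summable_on_cmult_left[OF summable_inverse_squares])
  qed (auto simp: inv_squares_nonneg)
  also have "?this \<longleftrightarrow> inv_squares summable_on {ns. length ns = Suc m}"
    by (rule summable_on_reindex_bij_witness[of _ "\<lambda>ns. (hd ns, tl ns)" "\<lambda>(n, ns). n # ns"])
       (auto simp: length_Suc_conv)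
  finally show ?case .
qed auto

lemma summable_inv_squares_increasing: "inv_squares summable_on increasing_lists m"
  by (rule summable_on_subset[OF summable_inv_squares[of m]]) (auto simp: increasing_lists_def)

lemma summable_on_by_inv_squares:
  assumes "\<And>ns. ns \<in> increasing_lists m \<Longrightarrow> norm (f ns :: complex) \<le> C * inv_squares ns"
  shows "f summable_on increasing_lists m"
proof (rule abs_summable_summable)
  have "(\<lambda>ns. C * inv_squares ns) summable_on increasing_lists m"
    by (rule summable_on_cmult_right[OF summable_inv_squares_increasing])
  thus "(\<lambda>ns. norm (f ns)) summable_on increasing_lists m"
    by (rule Infinite_Sum.abs_summable_on_comparison_test') (rule assms)
qed

text \<open>Weierstrass M-test over an arbitrary index set. The limit theorem for holomorphic
  functions works on closed discs, so holomorphy is proved locally and then collected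
  pointwise.\<close>

lemma holomorphic_on_infsum:
  fixes f :: "'a \<Rightarrow> complex \<Rightarrow> complex"
  assumes "open S" "\<And>i. i \<in> A \<Longrightarrow> f i holomorphic_on S"
    and bound: "\<And>i w. i \<in> A \<Longrightarrow> w \<in> S \<Longrightarrow> norm (f i w) \<le> M i" and "M summable_on A"
  shows "(\<lambda>w. \<Sum>\<^sub>\<infinity>i\<in>A. f i w) holomorphic_on S"
proof -
  have lim: "uniform_limit S (\<lambda>X w. \<Sum>i\<in>X. f i w) (\<lambda>w. \<Sum>\<^sub>\<infinity>i\<in>A. f i w) (finite_subsets_at_top A)"
    using bound assms(4) by (rule Weierstrass_m_test_general)
  have "\<exists>r>0. (\<lambda>w. \<Sum>\<^sub>\<infinity>i\<in>A. f i w) holomorphic_on ball z r" if "z \<in> S" for z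
  proof -
    obtain r where r: "r > 0" "cball z r \<subseteq> S"
      using \<open>open S\<close> \<open>z \<in> S\<close> open_contains_cball by blast
    have cont: "\<forall>\<^sub>F X in finite_subsets_at_top A. continuous_on (cball z r) (\<lambda>w. \<Sum>i\<in>X. f i w) \<and>
            (\<lambda>w. \<Sum>i\<in>X. f i w) holomorphic_on ball z r"
    proof (rule eventually_finite_subsets_at_top_weakI)
      fix X assume X: "finite X" "X \<subseteq> A"
      have "(\<lambda>w. \<Sum>i\<in>X. f i w) holomorphic_on cball z r"
        using assms(2) X r(2) by (intro holomorphic_intros) (meson holomorphic_on_subset subset_iff)
      thus "continuous_on (cball z r) (\<lambda>w. \<Sum>i\<in>X. f i w) \<and> (\<lambda>w. \<Sum>i\<in>X. f i w) holomorphic_on ball z r"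
        using ball_subset_cball holomorphic_on_imp_continuous_on holomorphic_on_subset by blast
    qed
    have ulim: "uniform_limit (cball z r) (\<lambda>X w. \<Sum>i\<in>X. f i w) (\<lambda>w. \<Sum>\<^sub>\<infinity>i\<in>A. f i w) (finite_subsets_at_top A)"
      using lim r(2) by (rule uniform_limit_on_subset)
    have "(\<lambda>w. \<Sum>\<^sub>\<infinity>i\<in>A. f i w) holomorphic_on ball z r"
      by (rule holomorphic_uniform_limit[OF cont ulim finite_subsets_at_top_neq_bot])
    thus ?thesis using r(1) by blast
  qed
  then obtain r where "\<And>z. z \<in> S \<Longrightarrow> r z > 0 \<and> (\<lambda>w. \<Sum>\<^sub>\<infinity>i\<in>A. f i w) holomorphic_on ball z (r z)" by metis
  hence "(\<lambda>w. \<Sum>\<^sub>\<infinity>i\<in>A. f i w) field_differentiable (at z)" if "z \<in> S" for z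
    using that by (meson centre_in_ball holomorphic_on_imp_differentiable_at open_ball)
  thus ?thesis by (simp add: holomorphic_on_def field_differentiable_at_within)
qed

section \<open>Size of the summands away from the cut\<close>

lemma norm_of_real_minus_bounds:
  assumes "t \<notin> complex_of_real ` {1..}"
  obtains c where "c \<ge> 1" "\<And>y. y \<ge> 1 \<Longrightarrow> y / c \<le> norm (of_real y - t)"
    "\<And>y. y \<ge> 1 \<Longrightarrow> norm (of_real y - t) \<le> c * y"
proof -
  have "closed (complex_of_real ` {1..})"
    by (intro closed_injective_linear_image) (auto simp: inj_def linear_iff scaleR_conv_of_real)
  hence "open (- (complex_of_real ` {1..}))" by (rule open_Compl)
  then obtain d where d: "d > 0" "ball t d \<subseteq> - (complex_of_real ` {1..})"
    using assms by (meson ComplI open_contains_ball)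
  have lower: "d \<le> norm (of_real y - t)" if "y \<ge> 1" for y
    using d(2) that by (force simp: dist_norm norm_minus_commute not_less[symmetric] subset_iff)
  \<comment> \<open>The entry 2 covers y \<ge> 2|t| + 1, where |y - t| \<ge> y / 2; the second entry
    covers smaller y through the distance d to the ray; the third gives the upper bound.\<close>
  define c where "c = Max {2, (2 * norm t + 1) / d, 1 + norm t}"
  have c: "c \<ge> 2" "c \<ge> (2 * norm t + 1) / d" "c \<ge> 1 + norm t" by (auto simp: c_def)
  show thesis
  proof (rule that[of c])
    fix y :: real assume y: "y \<ge> 1"
    show "norm (of_real y - t) \<le> c * y"
    proof -
      have "norm (of_real y - t) \<le> y + norm t" using norm_triangle_ineq4[of "of_real y" t] y by simp
      also have "\<dots> \<le> y + norm t * y" using y by (simp add: mult_le_cancel_left1)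
      also have "\<dots> = (1 + norm t) * y" by (simp add: algebra_simps)
      also have "\<dots> \<le> c * y" using c y by (intro mult_right_mono) auto
      finally show ?thesis .
    qed
    show "y / c \<le> norm (of_real y - t)"
    proof (cases "y \<ge> 2 * norm t + 1")
      case True
      have "y / c \<le> y / 2" using c y by (intro divide_left_mono) auto
      also have "\<dots> \<le> y - norm t" using True by simp
      also have "\<dots> \<le> norm (of_real y - t)" using norm_triangle_ineq2[of "of_real y" t] y by simp
      finally show ?thesis .
    next
      case False
      hence "y / d \<le> (2 * norm t + 1) / d" using d by (intro divide_right_mono) auto
      hence "y / d \<le> c" using c by linarith
      hence "y / c \<le> d" using d c by (simp add: field_simps)
      thus ?thesis using lower[OF y] by linarith
    qed
  qed (use c in auto)
qed

text \<open>From |x^s| = |x|^(Re s) e^(-Im s Arg x) with |Arg x| \<le> pi. The constant is uniform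
  in |s| \<le> R, as required for majorants that do not depend on the moving variable.\<close>

lemma norm_powr_of_real_minus_bound:
  assumes "t \<notin> complex_of_real ` {1..}"
  obtains C where "C > 0"
    "\<And>y s. y \<ge> 1 \<Longrightarrow> norm s \<le> R \<Longrightarrow> norm ((of_real y - t) powr s) \<le> C * y powr Re s"
proof -
  obtain c where c: "c \<ge> 1" "\<And>y. y \<ge> 1 \<Longrightarrow> y / c \<le> norm (of_real y - t)"
    "\<And>y. y \<ge> 1 \<Longrightarrow> norm (of_real y - t) \<le> c * y"
    using norm_of_real_minus_bounds[OF assms] by blast
  show thesis
  proof (rule that[of "c powr R * exp (R * pi)"])
    show "c powr R * exp (R * pi) > 0" using c by simp
  next
    fix y :: real and s :: complex assume y: "y \<ge> 1" and s: "norm s \<le> R"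
    let ?x = "of_real y - t"
    have Re: "\<bar>Re s\<bar> \<le> R" and Im: "\<bar>Im s\<bar> \<le> R"
      using s abs_Re_le_cmod abs_Im_le_cmod order_trans by blast+
    have R: "R \<ge> 0" using s norm_ge_zero order_trans by blast
    have "norm ?x powr Re s \<le> c powr R * y powr Re s"
    proof (cases "Re s \<ge> 0")
      case True
      have "norm ?x powr Re s \<le> (c * y) powr Re s" using c(3)[OF y] True by (intro powr_mono2) auto
      also have "\<dots> = c powr Re s * y powr Re s" using c y by (simp add: powr_mult)
      also have "\<dots> \<le> c powr R * y powr Re s" using Re c by (intro mult_right_mono powr_mono) auto
      finally show ?thesis .
    next
      case False
      have "norm ?x powr Re s \<le> (y / c) powr Re s" using c(1) c(2)[OF y] False y by (intro powr_mono2') auto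
      also have "\<dots> = c powr (-Re s) * y powr Re s" using c y by (simp add: powr_divide powr_minus field_simps)
      also have "\<dots> \<le> c powr R * y powr Re s" using Re c by (intro mult_right_mono powr_mono) auto
      finally show ?thesis .
    qed
    moreover have "exp (- Im s * Arg ?x) \<le> exp (R * pi)"
    proof -
      have "- Im s * Arg ?x \<le> \<bar>Im s\<bar> * \<bar>Arg ?x\<bar>" by (metis abs_ge_self abs_minus_cancel abs_mult)
      also have "\<dots> \<le> R * pi" using Im R Arg_bounded[of ?x] by (intro mult_mono) auto
      finally show ?thesis by simp
    qed
    ultimately have "norm ?x powr Re s * exp (- Im s * Arg ?x) \<le> (c powr R * y powr Re s) * exp (R * pi)"
      by (intro mult_mono) auto
    thus "norm (?x powr s) \<le> c powr R * exp (R * pi) * y powr Re s"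
      by (simp add: norm_powr_complex mult_ac)
  qed
qed

text \<open>Of the M + 2 powers of decay in each entry, two produce \<open>inv_squares\<close> and
  the other M are kept in reserve for polynomial weights.\<close>

lemma norm_zterm_bound:
  assumes t: "t \<notin> complex_of_real ` {1..}" and s: "\<And>x. x \<in> set s \<Longrightarrow> Re x \<ge> real M + 2"
  obtains C where "C > 0" "\<And>ns. ns \<in> increasing_lists (length s) \<Longrightarrow>
      norm (zterm s t ns) * (\<Prod>n\<leftarrow>ns. real n) ^ M \<le> C * inv_squares ns"
proof -
  have "\<exists>C>0. \<forall>ns. length ns = length s \<and> (\<forall>n\<in>set ns. n > 0) \<longrightarrow>
      norm (zterm s t ns) * (\<Prod>n\<leftarrow>ns. real n) ^ M \<le> C * inv_squares ns"
    using s
  proof (induction s)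
    case (Cons w s)
    then obtain C where C: "C > 0" "\<And>ns. length ns = length s \<Longrightarrow> (\<forall>n\<in>set ns. n > 0) \<Longrightarrow>
      norm (zterm s t ns) * (\<Prod>n\<leftarrow>ns. real n) ^ M \<le> C * inv_squares ns" by auto
    obtain D where D: "D > 0"
      "\<And>y s. y \<ge> 1 \<Longrightarrow> norm s \<le> norm w \<Longrightarrow> norm ((of_real y - t) powr s) \<le> D * y powr Re s"
      using norm_powr_of_real_minus_bound[OF t, of "norm w"] by metis
    have one: "norm ((of_nat n - t) powr (-w)) * real n ^ M \<le> D * (1 / real n ^ 2)" if "n > 0" for n
    proof -
      have "norm ((of_nat n - t) powr (-w)) \<le> D * real n powr (- Re w)"
        using D(2)[of "real n" "-w"] that by simp
      also have "\<dots> \<le> D * real n powr (- (real (M + 2)))"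
        using Cons.prems[of w] D(1) that by (intro mult_left_mono powr_mono) auto
      also have "real n powr (- (real (M + 2))) = 1 / real n ^ (M + 2)"
        using that powr_realpow[of "real n" "M + 2"] by (simp only: powr_minus inverse_eq_divide)
      finally have "norm ((of_nat n - t) powr (-w)) * real n ^ M \<le> D * (1 / real n ^ (M + 2)) * real n ^ M"
        by (intro mult_right_mono) auto
      also have "\<dots> = D * (1 / real n ^ 2)" using that by (simp add: power_add power2_eq_square field_simps)
      finally show ?thesis .
    qed
    show ?case
    proof (intro exI[of _ "D * C"] conjI allI impI)
      fix ns :: "nat list" assume ns: "length ns = length (w # s) \<and> (\<forall>n\<in>set ns. n > 0)"
      then obtain n ns' where [simp]: "ns = n # ns'" by (cases ns) auto
      have "(norm ((of_nat n - t) powr (-w)) * real n ^ M) * (norm (zterm s t ns') * (\<Prod>n\<leftarrow>ns'. real n) ^ M)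
          \<le> (D * (1 / real n ^ 2)) * (C * inv_squares ns')"
        using ns D(1) by (intro mult_mono[OF one C(2)] mult_nonneg_nonneg zero_le_power prod_list_nonneg) auto
      thus "norm (zterm (w # s) t ns) * (\<Prod>n\<leftarrow>ns. real n) ^ M \<le> D * C * inv_squares ns"
        by (simp add: zterm_Cons norm_mult power_mult_distrib mult_ac)
    qed (use C(1) D(1) in auto)
  qed (auto intro!: exI[of _ 1])
  thus thesis using that by (auto simp: increasing_lists_def)
qed

lemma Suc_le_prod_list:
  assumes "\<And>n. n \<in> set ns \<Longrightarrow> n > 0" "n = 0 \<or> n \<in> set ns"
  shows "1 + real n \<le> 2 * (\<Prod>n\<leftarrow>ns. real n)"
proof -
  have ge1: "(\<Prod>n\<leftarrow>ns. real n) \<ge> 1" if "\<And>n. n \<in> set ns \<Longrightarrow> n > 0" for ns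
    using that by (induction ns) (auto intro!: mult_ge1_I simp: Suc_le_eq)
  have "real n \<le> (\<Prod>n\<leftarrow>ns. real n)" if "n \<in> set ns"
    using that assms(1)
  proof (induction ns)
    case (Cons k ks)
    show ?case
    proof (cases "n = k")
      case True
      thus ?thesis using ge1[of ks] Cons.prems by (simp add: mult_le_cancel_left1)
    next
      case False
      hence "1 * real n \<le> real k * (\<Prod>n\<leftarrow>ks. real n)"
        using Cons by (intro mult_mono) (auto simp: Suc_le_eq)
      thus ?thesis by simp
    qed
  qed auto
  thus ?thesis using assms ge1[of ns] by (cases "n = 0") auto
qed

text \<open>The form used later: the weight depends on one entry only, which is dominated by the
  product of all entries. The case n = 0 serves the empty list and unweighted bounds.\<close>

lemma norm_zterm_weighted_bound:
  assumes t: "t \<notin> complex_of_real ` {1..}" and s: "\<And>x. x \<in> set s \<Longrightarrow> Re x \<ge> real M + 2"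
  obtains C where "C > 0" "\<And>ns n. ns \<in> increasing_lists (length s) \<Longrightarrow> n = 0 \<or> n \<in> set ns \<Longrightarrow>
      norm (zterm s t ns) * (1 + real n) ^ M \<le> C * inv_squares ns"
proof -
  obtain C where C: "C > 0" "\<And>ns. ns \<in> increasing_lists (length s) \<Longrightarrow>
      norm (zterm s t ns) * (\<Prod>n\<leftarrow>ns. real n) ^ M \<le> C * inv_squares ns"
    using norm_zterm_bound[OF assms] by metis
  show thesis
  proof (rule that[of "2 ^ M * C"])
    fix ns n assume ns: "ns \<in> increasing_lists (length s)" "n = 0 \<or> n \<in> set ns"
    have "norm (zterm s t ns) * (1 + real n) ^ M \<le> norm (zterm s t ns) * (2 * (\<Prod>n\<leftarrow>ns. real n)) ^ M"
      using ns by (intro mult_left_mono power_mono Suc_le_prod_list) (auto simp: increasing_lists_def)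
    also have "\<dots> = 2 ^ M * (norm (zterm s t ns) * (\<Prod>n\<leftarrow>ns. real n) ^ M)"
      by (simp add: power_mult_distrib)
    also have "\<dots> \<le> 2 ^ M * (C * inv_squares ns)" using C(2)[OF ns(1)] by (intro mult_left_mono) auto
    finally show "norm (zterm s t ns) * (1 + real n) ^ M \<le> 2 ^ M * C * inv_squares ns" by simp
  qed (use C in auto)
qed

section \<open>Euler-Maclaurin remainders\<close>

text \<open>\<open>powr_deriv j w\<close> is the \<open>j\<close>-th derivative of \<open>x powr (1 - w)\<close>, so \<open>em_sum L w x\<close> is the truncated
  Euler-Maclaurin expansion of \<open>(w - 1) * (\<Sum>n\<ge>0. (x + n) powr (- w))\<close>; the factor \<open>w - 1\<close> keeps it entire in \<open>w\<close>.\<close>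
definition powr_deriv :: "nat \<Rightarrow> complex \<Rightarrow> complex \<Rightarrow> complex" where
  "powr_deriv j w x = (-1) ^ j * pochhammer (w - 1) j * x powr (1 - w - of_nat j)"

definition em_sum :: "nat \<Rightarrow> complex \<Rightarrow> complex \<Rightarrow> complex" where
  "em_sum L w x = (\<Sum>j\<le>L. bern j * powr_deriv j w x)"

text \<open>The sum approximated by \<open>em_sum\<close>, as a function S of x, satisfies S(x) -
  S(x + 1) = (w - 1) x^(-w). This is the defect of \<open>em_sum\<close> in that difference
  equation.\<close>

definition em_rem :: "nat \<Rightarrow> complex \<Rightarrow> complex \<Rightarrow> complex" where
  "em_rem L w x = em_sum L w x - em_sum L w (x + 1) - (w - 1) * x powr (- w)"

lemma has_field_derivative_powr_deriv:
  assumes "x \<notin> \<real>\<^sub>\<le>\<^sub>0"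
  shows "(powr_deriv j w has_field_derivative powr_deriv (Suc j) w x) (at x within S)"
proof -
  have "(powr_deriv j w has_field_derivative
      (-1) ^ j * pochhammer (w - 1) j * ((1 - w - of_nat j) * x powr (1 - w - of_nat j - 1))) (at x)"
    unfolding powr_deriv_def
    by (rule DERIV_cmult, rule has_field_derivative_powr) (use assms in auto)
  also have "(-1) ^ j * pochhammer (w - 1) j * ((1 - w - of_nat j) * x powr (1 - w - of_nat j - 1))
      = powr_deriv (Suc j) w x"
    by (simp add: powr_deriv_def pochhammer_Suc algebra_simps)
  finally show ?thesis by (rule has_field_derivative_at_within)
qed

lemma of_real_minus_notin_nonpos_Reals:
  assumes "t \<notin> complex_of_real ` {1..}" "y \<ge> 1"
  shows "of_real y - t \<notin> \<real>\<^sub>\<le>\<^sub>0"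
proof
  assume "of_real y - t \<in> \<real>\<^sub>\<le>\<^sub>0"
  then obtain u where "u \<le> 0" "of_real y - t = of_real u" by (auto elim!: nonpos_Reals_cases)
  hence "t = of_real (y - u)" "y - u \<ge> 1" using assms(2) by (auto simp: algebra_simps)
  thus False using assms(1) by blast
qed

lemma of_nat_minus_nonzero:
  assumes "t \<notin> complex_of_real ` {1..}" "n > 0"
  shows "of_nat n - t \<noteq> 0"
  using of_real_minus_notin_nonpos_Reals[OF assms(1), of "real n"] assms(2) by auto

lemma norm_pochhammer_le: "norm (pochhammer (w :: complex) j) \<le> pochhammer (norm w) j"
  unfolding pochhammer_prod prod_norm [symmetric]
  by (intro prod_mono) (auto intro: order_trans[OF norm_triangle_ineq])

lemma pochhammer_norm_mono:
  assumes "norm (w :: complex) \<le> R"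
  shows "pochhammer (norm (w - 1)) j \<le> pochhammer (R + 1) j"
  unfolding pochhammer_prod
  using assms norm_triangle_ineq4[of w 1] by (intro prod_mono) auto

text \<open>Formally D / (e^D - 1) applied to (e^D - 1) f gives f'. Grouping by the total order p =
  j + i, the cut-off i \<le> L + 1 - j retains every pair with p \<le> L + 1 and j < p, so by
  \<open>bern_convolution\<close> only p = 1 survives; the terms with i = 0 form
  \<open>em_sum\<close>.\<close>

lemma sum_bern_powr_deriv:
  "(\<Sum>j\<le>L. bern j * (\<Sum>i\<le>Suc L - j. powr_deriv (j + i) w x / fact i))
    = em_sum L w x - (w - 1) * x powr (- w)"
proof -
  have split: "(\<Sum>i\<le>Suc L - j. powr_deriv (j + i) w x / fact i)
      = powr_deriv j w x + (\<Sum>i\<in>{1..Suc L - j}. powr_deriv (j + i) w x / fact i)" for j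
  proof -
    have "{..Suc L - j} = insert 0 {1..Suc L - j}" by auto
    thus ?thesis by simp
  qed
  have "(\<Sum>j\<le>L. bern j * (\<Sum>i\<in>{1..Suc L - j}. powr_deriv (j + i) w x / fact i))
      = (\<Sum>(j, i)\<in>(SIGMA j:{..L}. {1..Suc L - j}). bern j * powr_deriv (j + i) w x / fact i)"
    by (subst sum.Sigma [symmetric]) (auto simp: sum_distrib_left)
  also have "\<dots> = (\<Sum>(p, j)\<in>(SIGMA p:{1..Suc L}. {..<p}). bern j / fact (p - j) * powr_deriv p w x)"
    by (rule sum.reindex_bij_witness[of _ "\<lambda>(p, j). (j, p - j)" "\<lambda>(j, i). (j + i, j)"]) auto
  also have "\<dots> = (\<Sum>p\<in>{1..Suc L}. (\<Sum>j<p. bern j / fact (p - j)) * powr_deriv p w x)"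
    by (subst sum.Sigma [symmetric]) (auto simp: sum_distrib_right)
  also have "\<dots> = powr_deriv 1 w x"
    by (simp only: bern_convolution) (simp add: if_distrib[of "\<lambda>c. c * _"] sum.delta cong: if_cong)
  also have "\<dots> = - ((w - 1) * x powr (- w))"
    by (simp add: powr_deriv_def algebra_simps)
  finally show ?thesis
    by (simp add: split distrib_left sum.distrib em_sum_def)
qed

lemma em_rem_eq:
  "em_rem L w x = - (\<Sum>j\<le>L. bern j *
     (powr_deriv j w (x + 1) - (\<Sum>i\<le>Suc L - j. powr_deriv (j + i) w x / fact i)))"
  using sum_bern_powr_deriv[where L = L and w = w and x = x]
  by (simp add: em_rem_def right_diff_distrib sum_subtractf em_sum_def)

lemma norm_powr_deriv_bound:
  assumes t: "t \<notin> complex_of_real ` {1..}"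
  obtains C where "C > 0" "\<And>y w. y \<ge> 1 \<Longrightarrow> norm w \<le> R \<Longrightarrow>
    norm (powr_deriv j w (of_real y - t)) \<le> C * y powr (1 - Re w - real j)"
proof -
  obtain C where C: "C > 0" "\<And>y s. y \<ge> 1 \<Longrightarrow> norm s \<le> 1 + R + real j \<Longrightarrow>
      norm ((of_real y - t) powr s) \<le> C * y powr Re s"
    using norm_powr_of_real_minus_bound[OF t, of "1 + R + real j"] by metis
  show thesis
  proof (rule that[of "(pochhammer (\<bar>R\<bar> + 1) j) * C"])
    show "(pochhammer (\<bar>R\<bar> + 1) j) * C > 0" using C by (intro mult_pos_pos pochhammer_pos) auto
    fix y w assume y: "(y :: real) \<ge> 1" and w: "norm (w :: complex) \<le> R"
    have "norm (1 - w - of_nat j) \<le> 1 + norm w + real j"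
      using norm_triangle_ineq4[of "1 - w" "of_nat j"] norm_triangle_ineq4[of 1 w] by simp
    hence "norm ((of_real y - t) powr (1 - w - of_nat j)) \<le> C * y powr Re (1 - w - of_nat j)"
      using w by (intro C(2) y) auto
    moreover have "norm (pochhammer (w - 1) j) \<le> pochhammer (\<bar>R\<bar> + 1) j"
      using norm_pochhammer_le[of "w - 1" j] pochhammer_norm_mono[of w "\<bar>R\<bar>" j] w by linarith
    ultimately have "norm (pochhammer (w - 1) j) * norm ((of_real y - t) powr (1 - w - of_nat j))
        \<le> pochhammer (\<bar>R\<bar> + 1) j * (C * y powr Re (1 - w - of_nat j))"
      by (intro mult_mono) (auto simp: pochhammer_nonneg)
    thus "norm (powr_deriv j w (of_real y - t)) \<le> pochhammer (\<bar>R\<bar> + 1) j * C * y powr (1 - Re w - real j)"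
      by (simp add: powr_deriv_def norm_mult norm_power)
  qed
qed

lemma norm_em_sum_bound:
  assumes t: "t \<notin> complex_of_real ` {1..}"
  obtains C where "C > 0" "\<And>n w. n \<ge> 1 \<Longrightarrow> norm w \<le> R \<Longrightarrow>
    norm (em_sum L w (of_nat n - t)) \<le> C * real n powr (1 - Re w)"
proof -
  have "\<exists>C. C > 0 \<and> (\<forall>y w. y \<ge> 1 \<longrightarrow> norm w \<le> R \<longrightarrow>
      norm (powr_deriv j w (of_real y - t)) \<le> C * y powr (1 - Re w - real j))" for j
    using norm_powr_deriv_bound[OF t, of R j] by metis
  then obtain C where C: "\<And>j. C j > 0" "\<And>j y w. y \<ge> 1 \<Longrightarrow> norm w \<le> R \<Longrightarrow>
      norm (powr_deriv j w (of_real y - t)) \<le> C j * y powr (1 - Re w - real j)" by metis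
  show thesis
  proof (rule that[of "\<Sum>j\<le>L. C j"])
    show "(\<Sum>j\<le>L. C j) > 0" using C(1) by (intro sum_pos) auto
    fix n :: nat and w :: complex assume n: "n \<ge> 1" and w: "norm w \<le> R"
    have "norm (em_sum L w (of_nat n - t)) \<le> (\<Sum>j\<le>L. norm (bern j) * norm (powr_deriv j w (of_nat n - t)))"
      unfolding em_sum_def norm_mult [symmetric] by (rule norm_sum)
    also have "\<dots> \<le> (\<Sum>j\<le>L. 1 * (C j * real n powr (1 - Re w)))"
    proof (intro sum_mono mult_mono norm_bern_le)
      fix j
      have "norm (powr_deriv j w (of_nat n - t)) \<le> C j * real n powr (1 - Re w - real j)"
        using C(2)[of "real n" w j] n w by simp
      also have "\<dots> \<le> C j * real n powr (1 - Re w)"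
        using n C(1)[of j] by (intro mult_left_mono powr_mono) auto
      finally show "norm (powr_deriv j w (of_nat n - t)) \<le> C j * real n powr (1 - Re w)" .
    qed auto
    finally show "norm (em_sum L w (of_nat n - t)) \<le> (\<Sum>j\<le>L. C j) * real n powr (1 - Re w)"
      by (simp add: sum_distrib_right)
  qed
qed

text \<open>By \<open>em_rem_eq\<close> the defect is a combination of Taylor remainders over a step
  of length 1. Expanding the j-th derivative to order L + 1 - j always leaves the derivative of
  order L + 2, whence the common exponent.\<close>

lemma norm_em_rem_bound:
  assumes t: "t \<notin> complex_of_real ` {1..}" and L: "R \<le> real L"
  obtains C where "C > 0" "\<And>n w. n \<ge> 1 \<Longrightarrow> norm w \<le> R \<Longrightarrow>
    norm (em_rem L w (of_nat n - t)) \<le> C * real n powr (- Re w - 1 - real L)"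
proof -
  obtain C where C: "C > 0" "\<And>y w. y \<ge> 1 \<Longrightarrow> norm w \<le> R \<Longrightarrow>
      norm (powr_deriv (L + 2) w (of_real y - t)) \<le> C * y powr (1 - Re w - real (L + 2))"
    using norm_powr_deriv_bound[OF t, of R "L + 2"] by metis
  show thesis
  proof (rule that[of "real (Suc L) * C"])
    show "real (Suc L) * C > 0" using C by simp
    fix n :: nat and w :: complex assume n: "n \<ge> 1" and w: "norm w \<le> R"
    let ?x = "of_nat n - t"
    let ?B = "C * real n powr (- Re w - 1 - real L)"
    define S where "S = closed_segment ?x (?x + 1)"
    have S: "\<exists>y\<ge>real n. x = of_real y - t" if "x \<in> S" for x
    proof -
      from that have "\<exists>u. 0 \<le> u \<and> u \<le> 1 \<and> x = (1 - u) *\<^sub>R ?x + u *\<^sub>R (?x + 1)"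
        by (simp only: S_def in_segment)
      then obtain u where u: "0 \<le> u" "x = (1 - u) *\<^sub>R ?x + u *\<^sub>R (?x + 1)"
        by (elim exE conjE)
      show ?thesis
        by (rule exI[of _ "real n + u"]) (use u in \<open>auto simp: scaleR_conv_of_real algebra_simps\<close>)
    qed
    \<comment> \<open>With a nonpositive exponent the bound is largest at the left end of the
      segment, that is, at n.\<close>
    have exp_le: "- Re w - 1 - real L \<le> 0"
      using w L abs_Re_le_cmod[of w] by linarith
    have step: "norm (powr_deriv j w (?x + 1) - (\<Sum>i\<le>Suc L - j. powr_deriv (j + i) w ?x / fact i)) \<le> ?B"
      if j: "j \<le> L" for j
    proof -
      have "norm (powr_deriv (j + 0) w (?x + 1) -
          (\<Sum>i\<le>Suc L - j. powr_deriv (j + i) w ?x * (?x + 1 - ?x) ^ i / fact i))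
          \<le> ?B * norm (?x + 1 - ?x) ^ Suc (Suc L - j) / fact (Suc L - j)"
      proof (rule complex_Taylor[of S])
        fix i x assume x: "x \<in> S"
        then obtain y where y: "y \<ge> real n" "x = of_real y - t" using S by blast
        show "(powr_deriv (j + i) w has_field_derivative powr_deriv (j + Suc i) w x) (at x within S)"
          using has_field_derivative_powr_deriv[of x "j + i" w S] y n
            of_real_minus_notin_nonpos_Reals[OF t, of y] by simp
      next
        fix x assume x: "x \<in> S"
        then obtain y where y: "y \<ge> real n" "x = of_real y - t" using S by blast
        have "norm (powr_deriv (L + 2) w x) \<le> C * y powr (1 - Re w - real (L + 2))"
          unfolding y(2) using y n w by (intro C(2)) auto
        also have "1 - Re w - real (L + 2) = - Re w - 1 - real L" by simp
        also have "C * y powr (- Re w - 1 - real L) \<le> ?B"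
          using y n exp_le C(1) by (intro mult_left_mono powr_mono2') auto
        finally show "norm (powr_deriv (j + Suc (Suc L - j)) w x) \<le> ?B" using j by simp
      qed (auto simp: S_def)
      also have "\<dots> \<le> ?B"
      proof -
        have "?B \<ge> 0" using C(1) by simp
        hence "?B / fact (Suc L - j) \<le> ?B / 1" by (intro divide_left_mono) auto
        thus ?thesis by simp
      qed
      finally show ?thesis by simp
    qed
    have "norm (em_rem L w ?x) \<le> (\<Sum>j\<le>L. norm (bern j) *
        norm (powr_deriv j w (?x + 1) - (\<Sum>i\<le>Suc L - j. powr_deriv (j + i) w ?x / fact i)))"
      unfolding em_rem_eq norm_minus_cancel norm_mult [symmetric] by (rule norm_sum)
    also have "\<dots> \<le> (\<Sum>j\<le>L. 1 * ?B)"
      by (intro sum_mono mult_mono norm_bern_le step) auto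
    finally show "norm (em_rem L w ?x) \<le> real (Suc L) * C * real n powr (- Re w - 1 - real L)"
      by simp
  qed
qed

text \<open>At w = -a the Pochhammer factor vanishes for j > a + 1, so the expansion terminates and
  equals the Bernoulli polynomial B_(a+1)(x). The case x = 0 is excluded because
  \<open>0 powr 0 = 0\<close>, unlike \<open>0 ^ 0\<close>.\<close>

lemma em_sum_neg_of_nat:
  assumes "x \<noteq> 0" "Suc a \<le> L"
  shows "em_sum L (- of_nat a) x = - of_nat (Suc a) * bpoly a x"
proof -
  have "em_sum L (- of_nat a) x = (\<Sum>j\<le>L. if j \<le> Suc a then bern j * (fact (Suc a) / fact (Suc a - j) * x ^ (Suc a - j)) else 0)"
    unfolding em_sum_def
  proof (intro sum.cong refl)
    fix j
    have minus: "- of_nat a - 1 = - (of_nat (Suc a) :: complex)" by simp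
    show "bern j * powr_deriv j (- of_nat a) x =
        (if j \<le> Suc a then bern j * (fact (Suc a) / fact (Suc a - j) * x ^ (Suc a - j)) else 0)"
    proof (cases "j \<le> Suc a")
      case True
      have "1 - - of_nat a - of_nat j = (of_nat (Suc a - j) :: complex)" using True by (simp add: of_nat_diff)
      hence "x powr (1 - - of_nat a - of_nat j) = x ^ (Suc a - j)" by (metis powr_complexpow assms(1))
      moreover have "(-1) ^ j * pochhammer (- of_nat (Suc a) :: complex) j = fact (Suc a) / fact (Suc a - j)"
      proof -
        have "(-1) ^ j * pochhammer (- of_nat (Suc a) :: complex) j = fact j * of_nat (Suc a choose j)"
          by (simp add: gbinomial_pochhammer binomial_gbinomial flip: of_nat_Suc)
        also have "of_nat (Suc a choose j) = (fact (Suc a) / (fact j * fact (Suc a - j)) :: complex)"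
          using True by (rule binomial_fact)
        finally show ?thesis by (simp del: fact_Suc)
      qed
      ultimately show ?thesis using True by (simp only: powr_deriv_def minus if_True)
    next
      case False
      thus ?thesis by (simp only: powr_deriv_def minus pochhammer_of_nat_eq_0_lemma) auto
    qed
  qed
  also have "\<dots> = (\<Sum>j\<le>Suc a. bern j * (fact (Suc a) / fact (Suc a - j) * x ^ (Suc a - j)))"
    using assms by (intro sum.mono_neutral_cong_right) auto
  also have "\<dots> = - of_nat (Suc a) * bpoly a x"
  proof -
    have "- of_nat (Suc a) * bpoly a x
        = fact (Suc a) * (\<Sum>j\<le>Suc a. bern j * x ^ (Suc a - j) / fact (Suc a - j))"
      by (simp add: bpoly_def algebra_simps del: sum.atMost_Suc)
    thus ?thesis unfolding sum_distrib_left by (simp add: mult_ac del: sum.atMost_Suc fact_Suc)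
  qed
  finally show ?thesis .
qed

text \<open>The terminated expansion solves the difference equation exactly, by
  \<open>bpoly_diff\<close>.\<close>

lemma em_rem_neg_of_nat:
  assumes "x \<noteq> 0" "x + 1 \<noteq> 0" "Suc a \<le> L"
  shows "em_rem L (- of_nat a) x = 0"
proof -
  have "em_rem L (- of_nat a) x = - of_nat (Suc a) * (bpoly a x - bpoly a (x + 1)) + of_nat (Suc a) * x ^ a"
    using assms by (simp add: em_rem_def em_sum_neg_of_nat powr_complexpow algebra_simps)
  thus ?thesis unfolding bpoly_diff by (simp add: algebra_simps)
qed

lemma holomorphic_on_em_sum [holomorphic_intros]:
  assumes "x \<noteq> 0" shows "(\<lambda>w. em_sum L w x) holomorphic_on S"
  unfolding em_sum_def powr_deriv_def pochhammer_prod using assms by (intro holomorphic_intros)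

lemma holomorphic_on_em_rem [holomorphic_intros]:
  assumes "x \<noteq> 0" "x + 1 \<noteq> 0" shows "(\<lambda>w. em_rem L w x) holomorphic_on S"
  unfolding em_rem_def using assms by (intro holomorphic_intros) auto

section \<open>Continuation in the largest summation index\<close>

text \<open>The default 0 makes the indices above an empty list start at 1, so the first entry needs
  no separate treatment.\<close>

definition last0 :: "nat list \<Rightarrow> nat" where
  "last0 ns = (if ns = [] then 0 else last ns)"

lemma last0_cases: "last0 ns = 0 \<or> last0 ns \<in> set ns"
  by (simp add: last0_def)

lemma mzeta_eq: "mzeta s t = (\<Sum>\<^sub>\<infinity>ns\<in>increasing_lists (length s). zterm s t ns)"
  by (simp add: mzeta_def increasing_lists_def zterm_def)

lemma mzeta_Nil [simp]: "mzeta [] t = 1"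
  by (simp add: mzeta_eq)

lemma butlast_last_increasing:
  assumes "ns \<in> increasing_lists (Suc m)"
  shows "butlast ns \<in> increasing_lists m" "last0 (butlast ns) < last ns" "ns = butlast ns @ [last ns]"
proof -
  from assms obtain ns' n where ns: "ns = ns' @ [n]" by (auto simp: increasing_lists_def length_Suc_conv_rev)
  with assms show "butlast ns \<in> increasing_lists m" "last0 (butlast ns) < last ns" "ns = butlast ns @ [last ns]"
    by (auto simp: increasing_lists_def sorted_wrt_append last0_def)
qed

lemma snoc_increasing:
  assumes "ns \<in> increasing_lists m" "last0 ns < n"
  shows "ns @ [n] \<in> increasing_lists (Suc m)"
proof -
  have "x \<le> last0 ns" if "x \<in> set ns" for x
    using assms(1) that by (cases ns rule: rev_cases)
      (auto simp: increasing_lists_def sorted_wrt_append last0_def less_imp_le)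
  thus ?thesis using assms
    by (fastforce simp: increasing_lists_def sorted_wrt_append)
qed

lemma tl_increasing:
  assumes "ns \<in> increasing_lists (Suc m)"
  shows "tl ns \<in> increasing_lists m" "0 < hd ns" "ns = hd ns # tl ns" "tl ns \<noteq> [] \<Longrightarrow> hd ns < hd (tl ns)"
  using assms by (cases ns; cases "tl ns"; auto simp: increasing_lists_def)+

lemma Cons_increasing:
  assumes "ns \<in> increasing_lists m" "0 < n" "n < hd ns" 
  shows "n # ns \<in> increasing_lists (Suc m)"
  using assms by (cases ns) (fastforce simp: increasing_lists_def)+

lemma infsum_increasing_lists_snoc:
  fixes f :: "nat list \<Rightarrow> nat \<Rightarrow> complex"
  assumes "(\<lambda>ns. f (butlast ns) (last ns)) summable_on increasing_lists (Suc m)"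
  shows "(\<Sum>\<^sub>\<infinity>ns\<in>increasing_lists (Suc m). f (butlast ns) (last ns))
    = (\<Sum>\<^sub>\<infinity>ns\<in>increasing_lists m. \<Sum>\<^sub>\<infinity>n\<in>{last0 ns<..}. f ns n)"
    "(\<lambda>ns. \<Sum>\<^sub>\<infinity>n\<in>{last0 ns<..}. f ns n) summable_on increasing_lists m"
proof -
  let ?S = "SIGMA ns:increasing_lists m. {last0 ns<..}"
  have bij: "bij_betw (\<lambda>ns. (butlast ns, last ns)) (increasing_lists (Suc m)) ?S"
    by (rule bij_betwI[of _ _ _ "\<lambda>(ns, n). ns @ [n]"])
       (use butlast_last_increasing in \<open>fastforce simp: snoc_increasing\<close>)+
  have sum: "(\<lambda>(ns, n). f ns n) summable_on ?S"
    using summable_on_reindex_bij_betw[OF bij, of "\<lambda>(ns, n). f ns n"] assms by simp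
  show "(\<Sum>\<^sub>\<infinity>ns\<in>increasing_lists (Suc m). f (butlast ns) (last ns))
      = (\<Sum>\<^sub>\<infinity>ns\<in>increasing_lists m. \<Sum>\<^sub>\<infinity>n\<in>{last0 ns<..}. f ns n)"
    using infsum_reindex_bij_betw[OF bij, of "\<lambda>(ns, n). f ns n"] infsum_Sigma'_banach[OF sum] by simp
  show "(\<lambda>ns. \<Sum>\<^sub>\<infinity>n\<in>{last0 ns<..}. f ns n) summable_on increasing_lists m"
    using summable_on_Sigma_banach[OF sum] by simp
qed

text \<open>Removing the smallest entry leaves a finite inner sum, bounded by the next entry; depth
  at least two ensures that the next entry exists.\<close>

lemma infsum_increasing_lists_Cons:
  fixes f :: "nat \<Rightarrow> nat list \<Rightarrow> complex"
  assumes "(\<lambda>ns. f (hd ns) (tl ns)) summable_on increasing_lists (Suc (Suc m))"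
  shows "(\<Sum>\<^sub>\<infinity>ns\<in>increasing_lists (Suc (Suc m)). f (hd ns) (tl ns))
    = (\<Sum>\<^sub>\<infinity>ns\<in>increasing_lists (Suc m). \<Sum>n\<in>{0<..<hd ns}. f n ns)"
proof -
  let ?S = "SIGMA ns:increasing_lists (Suc m). {0<..<hd ns}"
  have bij: "bij_betw (\<lambda>ns. (tl ns, hd ns)) (increasing_lists (Suc (Suc m))) ?S"
  proof (rule bij_betwI[of _ _ _ "\<lambda>(ns, n). n # ns"])
    show "(\<lambda>ns. (tl ns, hd ns)) \<in> increasing_lists (Suc (Suc m)) \<rightarrow> ?S"
    proof
      fix ns assume ns: "ns \<in> increasing_lists (Suc (Suc m))"
      hence "tl ns \<noteq> []" by (auto simp: increasing_lists_def length_Suc_conv)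
      thus "(tl ns, hd ns) \<in> ?S" using tl_increasing[OF ns] by auto
    qed
  qed (use tl_increasing in \<open>fastforce simp: Cons_increasing\<close>)+
  have sum: "(\<lambda>(ns, n). f n ns) summable_on ?S"
    using summable_on_reindex_bij_betw[OF bij, of "\<lambda>(ns, n). f n ns"] assms by simp
  show ?thesis
    using infsum_reindex_bij_betw[OF bij, of "\<lambda>(ns, n). f n ns"] infsum_Sigma'_banach[OF sum] by simp
qed

lemma summable_on_powr: "p > 1 \<Longrightarrow> (\<lambda>n. real n powr (- p)) summable_on A"
  by (rule summable_on_subset[of _ UNIV], rule summable_nonneg_imp_summable_on)
     (auto simp: summable_real_powr_iff)

text \<open>The values of \<open>em_sum\<close> along n - t telescope, with limit 0 because Re w >
  1. The right-hand side keeps its meaning further to the left.\<close>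

lemma hurwitz_tail_euler_maclaurin:
  assumes t: "t \<notin> complex_of_real ` {1..}" and w: "norm w \<le> real L" "Re w > 1"
  shows "(\<lambda>n. (of_nat n - t) powr (-w)) summable_on {N<..}"
    and "(w - 1) * (\<Sum>\<^sub>\<infinity>n\<in>{N<..}. (of_nat n - t) powr (-w))
      = em_sum L w (of_nat (Suc N) - t) - (\<Sum>\<^sub>\<infinity>n\<in>{N<..}. em_rem L w (of_nat n - t))"
proof -
  obtain C1 where C1: "C1 > 0" "\<And>y s. y \<ge> 1 \<Longrightarrow> norm s \<le> norm w \<Longrightarrow>
      norm ((of_real y - t) powr s) \<le> C1 * y powr Re s"
    using norm_powr_of_real_minus_bound[OF t, of "norm w"] by metis
  obtain C2 where C2: "C2 > 0" "\<And>n v. n \<ge> 1 \<Longrightarrow> norm v \<le> norm w \<Longrightarrow>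
      norm (em_rem L v (of_nat n - t)) \<le> C2 * real n powr (- Re v - 1 - real L)"
    using norm_em_rem_bound[OF t w(1)] by metis
  obtain C3 where C3: "C3 > 0" "\<And>n v. n \<ge> 1 \<Longrightarrow> norm v \<le> norm w \<Longrightarrow>
      norm (em_sum L v (of_nat n - t)) \<le> C3 * real n powr (1 - Re v)"
    using norm_em_sum_bound[OF t] by metis
  have sum: "(\<lambda>n. C * real n powr (- Re w)) summable_on {N<..}" for C
    using summable_on_powr[OF w(2)] by (rule summable_on_cmult_right)
  show sum1: "(\<lambda>n. (of_nat n - t) powr (-w)) summable_on {N<..}"
  proof (rule abs_summable_summable, rule Infinite_Sum.abs_summable_on_comparison_test'[OF sum[of C1]])
    fix n assume "n \<in> {N<..}"
    thus "norm ((of_nat n - t) powr (-w)) \<le> C1 * real n powr (- Re w)"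
      using C1(2)[of "real n" "-w"] by simp
  qed
  have sum2: "(\<lambda>n. em_rem L w (of_nat n - t)) summable_on {N<..}"
  proof (rule abs_summable_summable, rule Infinite_Sum.abs_summable_on_comparison_test'[OF sum[of C2]])
    fix n assume "n \<in> {N<..}"
    hence "n \<ge> 1" by auto
    hence "norm (em_rem L w (of_nat n - t)) \<le> C2 * real n powr (- Re w - 1 - real L)"
      using C2(2)[of n w] by simp
    also have "\<dots> \<le> C2 * real n powr (- Re w)"
      using C2(1) \<open>n \<ge> 1\<close> by (intro mult_left_mono powr_mono) auto
    finally show "norm (em_rem L w (of_nat n - t)) \<le> C2 * real n powr (- Re w)" .
  qed
  define f where "f n = em_sum L w (of_nat (n + Suc N) - t)" for n
  let ?g = "\<lambda>n. (w - 1) * (of_nat n - t) powr (-w) + em_rem L w (of_nat n - t)"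
  have "f \<longlonglongrightarrow> 0"
  proof (rule Lim_null_comparison)
    show "\<forall>\<^sub>F n in sequentially. norm (f n) \<le> C3 * real (n + Suc N) powr (1 - Re w)"
      using C3(2)[of "_ + Suc N" w] by (auto simp: f_def)
    have "(\<lambda>n. real n powr (1 - Re w)) \<longlonglongrightarrow> 0"
      by (rule tendsto_neg_powr) (use w in \<open>auto intro: filterlim_real_sequentially\<close>)
    hence "(\<lambda>n. C3 * real (n + Suc N) powr (1 - Re w)) \<longlonglongrightarrow> C3 * 0"
      by (intro tendsto_mult tendsto_const LIMSEQ_ignore_initial_segment)
    thus "(\<lambda>n. C3 * real (n + Suc N) powr (1 - Re w)) \<longlonglongrightarrow> 0" by simp
  qed
  hence "(\<lambda>n. f n - f (Suc n)) sums (f 0 - 0)" by (rule telescope_sums')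
  also have "(\<lambda>n. f n - f (Suc n)) = (\<lambda>n. ?g (n + Suc N))"
    by (simp add: f_def em_rem_def algebra_simps)
  finally have sums: "(\<lambda>n. ?g (n + Suc N)) sums f 0" by simp
  have "(?g has_sum ((w - 1) * (\<Sum>\<^sub>\<infinity>n\<in>{N<..}. (of_nat n - t) powr (-w))
      + (\<Sum>\<^sub>\<infinity>n\<in>{N<..}. em_rem L w (of_nat n - t)))) {N<..}"
    by (intro has_sum_add has_sum_cmult_right has_sum_infsum sum1 sum2)
  moreover have bij: "bij_betw (\<lambda>n. n + Suc N) UNIV {N<..}"
    by (rule bij_betwI[of _ _ _ "\<lambda>n. n - Suc N"]) auto
  ultimately have "((\<lambda>n. ?g (n + Suc N)) has_sum ((w - 1) * (\<Sum>\<^sub>\<infinity>n\<in>{N<..}. (of_nat n - t) powr (-w))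
      + (\<Sum>\<^sub>\<infinity>n\<in>{N<..}. em_rem L w (of_nat n - t)))) UNIV"
    by (subst has_sum_reindex_bij_betw[OF bij])
  from sums_unique2[OF has_sum_imp_sums[OF this] sums]
  show "(w - 1) * (\<Sum>\<^sub>\<infinity>n\<in>{N<..}. (of_nat n - t) powr (-w))
      = em_sum L w (of_nat (Suc N) - t) - (\<Sum>\<^sub>\<infinity>n\<in>{N<..}. em_rem L w (of_nat n - t))"
    by (simp add: f_def algebra_simps)
qed

text \<open>The Euler-Maclaurin formula for the largest index, summed against the other entries;
  \<open>w\<close> is the exponent of that index. The remainders are put into one sum over lists of
  length one more, so that one majorant handles them.\<close>

definition mzeta_cont :: "nat \<Rightarrow> complex list \<Rightarrow> complex \<Rightarrow> complex \<Rightarrow> complex" where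
  "mzeta_cont L s t w = 1 / (w - 1) *
     ((\<Sum>\<^sub>\<infinity>ns\<in>increasing_lists (length s). zterm s t ns * em_sum L w (of_nat (Suc (last0 ns)) - t))
      - (\<Sum>\<^sub>\<infinity>ns\<in>increasing_lists (Suc (length s)). zterm s t (butlast ns) * em_rem L w (of_nat (last ns) - t)))"

text \<open>The growth n^(1 - Re w) is at most n^(R + 2) for |w| \<le> R, and two more powers are
  needed for \<open>inv_squares\<close>; this is the origin of R + 4.\<close>

lemma zterm_em_sum_bound:
  assumes t: "t \<notin> complex_of_real ` {1..}" and s: "\<And>x. x \<in> set s \<Longrightarrow> Re x \<ge> real R + 4"
  obtains C where "C > 0" "\<And>ns w. ns \<in> increasing_lists (length s) \<Longrightarrow> norm w \<le> real R \<Longrightarrow>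
     norm (zterm s t ns * em_sum L w (of_nat (Suc (last0 ns)) - t)) \<le> C * inv_squares ns"
proof -
  obtain C1 where C1: "C1 > 0" "\<And>n w. n \<ge> 1 \<Longrightarrow> norm w \<le> real R \<Longrightarrow>
    norm (em_sum L w (of_nat n - t)) \<le> C1 * real n powr (1 - Re w)"
    using norm_em_sum_bound[OF t] by metis
  obtain C2 where C2: "C2 > 0" "\<And>ns n. ns \<in> increasing_lists (length s) \<Longrightarrow> n = 0 \<or> n \<in> set ns \<Longrightarrow>
      norm (zterm s t ns) * (1 + real n) ^ (R + 2) \<le> C2 * inv_squares ns"
    using norm_zterm_weighted_bound[OF t, of s "R + 2"] s by (auto simp: algebra_simps)
  show thesis
  proof (rule that[of "C1 * C2"])
    fix ns and w :: complex assume ns: "ns \<in> increasing_lists (length s)" and w: "norm w \<le> real R"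
    let ?n = "Suc (last0 ns)"
    have "norm (em_sum L w (of_nat ?n - t)) \<le> C1 * real ?n powr (1 - Re w)"
      by (rule C1(2)) (use w in auto)
    also have "\<dots> \<le> C1 * real ?n powr real (R + 2)"
      using C1(1) w abs_Re_le_cmod[of w] by (intro mult_left_mono powr_mono) auto
    also have "real ?n powr real (R + 2) = (1 + real (last0 ns)) ^ (R + 2)"
      by (subst powr_realpow) auto
    finally have "norm (zterm s t ns) * norm (em_sum L w (of_nat ?n - t))
        \<le> norm (zterm s t ns) * (C1 * (1 + real (last0 ns)) ^ (R + 2))"
      by (intro mult_left_mono) auto
    also have "\<dots> = C1 * (norm (zterm s t ns) * (1 + real (last0 ns)) ^ (R + 2))" by simp
    also have "\<dots> \<le> C1 * (C2 * inv_squares ns)"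
      using C1(1) by (intro mult_left_mono C2(2) ns last0_cases) auto
    finally show "norm (zterm s t ns * em_sum L w (of_nat ?n - t)) \<le> C1 * C2 * inv_squares ns"
      by (simp add: norm_mult)
  qed (use C1 C2 in auto)
qed

text \<open>With L \<ge> R + 1 the exponent -Re w - 1 - L is at most -2, which supplies the inverse
  square for the last entry.\<close>

lemma zterm_em_rem_bound:
  assumes t: "t \<notin> complex_of_real ` {1..}" and s: "\<And>x. x \<in> set s \<Longrightarrow> Re x \<ge> real R + 4"
    and L: "real L \<ge> real R + 1"
  obtains C where "C > 0" "\<And>ns w. ns \<in> increasing_lists (Suc (length s)) \<Longrightarrow> norm w \<le> real R \<Longrightarrow>
     norm (zterm s t (butlast ns) * em_rem L w (of_nat (last ns) - t)) \<le> C * inv_squares ns"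
proof -
  have "real R \<le> real L" using L by simp
  then obtain C1 where C1: "C1 > 0" "\<And>n w. n \<ge> 1 \<Longrightarrow> norm w \<le> real R \<Longrightarrow>
    norm (em_rem L w (of_nat n - t)) \<le> C1 * real n powr (- Re w - 1 - real L)"
    using norm_em_rem_bound[OF t] by metis
  obtain C2 where C2: "C2 > 0" "\<And>ns n. ns \<in> increasing_lists (length s) \<Longrightarrow> n = 0 \<or> n \<in> set ns \<Longrightarrow>
      norm (zterm s t ns) * (1 + real n) ^ (R + 2) \<le> C2 * inv_squares ns"
    using norm_zterm_weighted_bound[OF t, of s "R + 2"] s by (auto simp: algebra_simps)
  show thesis
  proof (rule that[of "C2 * C1"])
    fix ns and w :: complex assume ns: "ns \<in> increasing_lists (Suc (length s))" and w: "norm w \<le> real R"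
    note ns' = butlast_last_increasing[OF ns]
    have "last ns \<ge> 1" using ns'(2) by simp
    hence "norm (em_rem L w (of_nat (last ns) - t)) \<le> C1 * real (last ns) powr (- Re w - 1 - real L)"
      by (rule C1(2)) (use w in auto)
    also have "\<dots> \<le> C1 * real (last ns) powr (- 2)"
      using C1(1) w L abs_Re_le_cmod[of w] \<open>last ns \<ge> 1\<close> by (intro mult_left_mono powr_mono) auto
    also have "real (last ns) powr (- 2) = 1 / real (last ns) ^ 2"
      using \<open>last ns \<ge> 1\<close> by (simp add: powr_minus_divide)
    finally have "norm (em_rem L w (of_nat (last ns) - t)) \<le> C1 * (1 / real (last ns) ^ 2)" .
    moreover have "norm (zterm s t (butlast ns)) \<le> C2 * inv_squares (butlast ns)"
      using C2(2)[OF ns'(1), of 0] by simp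
    ultimately have "norm (zterm s t (butlast ns)) * norm (em_rem L w (of_nat (last ns) - t))
        \<le> (C2 * inv_squares (butlast ns)) * (C1 * (1 / real (last ns) ^ 2))"
      using C1(1) C2(1) by (intro mult_mono) (auto simp: inv_squares_nonneg)
    also have "\<dots> = C2 * C1 * inv_squares (butlast ns @ [last ns])" by simp
    finally show "norm (zterm s t (butlast ns) * em_rem L w (of_nat (last ns) - t)) \<le> C2 * C1 * inv_squares ns"
      using ns'(3) by (simp add: norm_mult)
  qed (use C1 C2 in auto)
qed

lemma zterm_powr_summable:
  assumes t: "t \<notin> complex_of_real ` {1..}" and s: "\<And>x. x \<in> set s \<Longrightarrow> Re x \<ge> 2" and w: "Re w \<ge> 2"
  shows "(\<lambda>ns. zterm s t (butlast ns) * (of_nat (last ns) - t) powr (-w)) summable_on increasing_lists (Suc (length s))"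
proof -
  obtain C where C: "C > 0" "\<And>ns n. ns \<in> increasing_lists (length (s @ [w])) \<Longrightarrow> n = 0 \<or> n \<in> set ns \<Longrightarrow>
      norm (zterm (s @ [w]) t ns) * (1 + real n) ^ 0 \<le> C * inv_squares ns"
    using norm_zterm_weighted_bound[OF t, of "s @ [w]" 0] s w by (metis (no_types, lifting) UnE add_0 empty_iff empty_set list.simps(15) of_nat_0 set_ConsD set_append)
  show ?thesis
  proof (rule summable_on_by_inv_squares)
    fix ns assume ns: "ns \<in> increasing_lists (Suc (length s))"
    have "length (butlast ns) = length s" using ns by (simp add: increasing_lists_def)
    hence "zterm (s @ [w]) t ns = zterm s t (butlast ns) * (of_nat (last ns) - t) powr (-w)"
      using zterm_snoc[of "butlast ns" s w t "last ns"] butlast_last_increasing(3)[OF ns] by simp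
    thus "norm (zterm s t (butlast ns) * (of_nat (last ns) - t) powr (-w)) \<le> C * inv_squares ns"
      using C(2)[of ns 0] ns by simp
  qed
qed

lemma mzeta_snoc:
  "mzeta (s @ [w]) t = (\<Sum>\<^sub>\<infinity>ns\<in>increasing_lists (Suc (length s)). zterm s t (butlast ns) * (of_nat (last ns) - t) powr (-w))"
  unfolding mzeta_eq
proof (simp, rule infsum_cong)
  fix ns assume ns: "ns \<in> increasing_lists (Suc (length s))"
  have "length (butlast ns) = length s" using ns by (simp add: increasing_lists_def)
  thus "zterm (s @ [w]) t ns = zterm s t (butlast ns) * (of_nat (last ns) - t) powr (-w)"
    using zterm_snoc[of "butlast ns" s w t "last ns"] butlast_last_increasing(3)[OF ns] by simp
qed

text \<open>In the region of convergence the last index may be summed first; the inner sum is then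
  replaced by \<open>hurwitz_tail_euler_maclaurin\<close>.\<close>

lemma mzeta_cont_eq_mzeta:
  assumes t: "t \<notin> complex_of_real ` {1..}" and s: "\<And>x. x \<in> set s \<Longrightarrow> Re x \<ge> real R + 4"
    and L: "real L \<ge> real R + 1" and w: "norm w \<le> real R" "Re w \<ge> 2"
  shows "mzeta_cont L s t w = mzeta (s @ [w]) t"
proof -
  obtain C1 where C1: "C1 > 0" "\<And>ns w. ns \<in> increasing_lists (length s) \<Longrightarrow> norm w \<le> real R \<Longrightarrow>
     norm (zterm s t ns * em_sum L w (of_nat (Suc (last0 ns)) - t)) \<le> C1 * inv_squares ns"
    using zterm_em_sum_bound[OF t, of s R L] s by auto
  obtain C2 where C2: "C2 > 0" "\<And>ns w. ns \<in> increasing_lists (Suc (length s)) \<Longrightarrow> norm w \<le> real R \<Longrightarrow>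
     norm (zterm s t (butlast ns) * em_rem L w (of_nat (last ns) - t)) \<le> C2 * inv_squares ns"
    using zterm_em_rem_bound[OF t, of s R L] s L by auto
  have sum1: "(\<lambda>ns. zterm s t ns * em_sum L w (of_nat (Suc (last0 ns)) - t)) summable_on increasing_lists (length s)"
    by (rule summable_on_by_inv_squares[of _ _ C1]) (use C1(2) w in auto)
  have sum2: "(\<lambda>ns. zterm s t (butlast ns) * em_rem L w (of_nat (last ns) - t)) summable_on increasing_lists (Suc (length s))"
    by (rule summable_on_by_inv_squares[of _ _ C2]) (use C2(2) w in auto)
  have sum3: "(\<lambda>ns. zterm s t (butlast ns) * (of_nat (last ns) - t) powr (-w)) summable_on increasing_lists (Suc (length s))"
    by (rule zterm_powr_summable[OF t _ w(2)]) (use s in force)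
  note snoc2 = infsum_increasing_lists_snoc[of "\<lambda>ns n. zterm s t ns * em_rem L w (of_nat n - t)", OF sum2]
  note snoc3 = infsum_increasing_lists_snoc[of "\<lambda>ns n. zterm s t ns * (of_nat n - t) powr (-w)", OF sum3]
  have "(w - 1) * mzeta (s @ [w]) t = (\<Sum>\<^sub>\<infinity>ns\<in>increasing_lists (length s).
      zterm s t ns * ((w - 1) * (\<Sum>\<^sub>\<infinity>n\<in>{last0 ns<..}. (of_nat n - t) powr (-w))))"
    unfolding mzeta_snoc snoc3(1) infsum_cmult_right' [symmetric]
    by (simp add: infsum_cmult_right' mult_ac)
  also have "\<dots> = (\<Sum>\<^sub>\<infinity>ns\<in>increasing_lists (length s). zterm s t ns * em_sum L w (of_nat (Suc (last0 ns)) - t)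
      - (\<Sum>\<^sub>\<infinity>n\<in>{last0 ns<..}. zterm s t ns * em_rem L w (of_nat n - t)))"
    by (subst hurwitz_tail_euler_maclaurin(2)[OF t, of w L])
       (use w L in \<open>auto simp: infsum_cmult_right' right_diff_distrib\<close>)
  also have "\<dots> = (\<Sum>\<^sub>\<infinity>ns\<in>increasing_lists (length s). zterm s t ns * em_sum L w (of_nat (Suc (last0 ns)) - t))
      - (\<Sum>\<^sub>\<infinity>ns\<in>increasing_lists (length s). \<Sum>\<^sub>\<infinity>n\<in>{last0 ns<..}. zterm s t ns * em_rem L w (of_nat n - t))"
    using infsum_add[OF sum1 summable_on_uminus[THEN iffD2, OF snoc2(2)]]
    by (simp add: infsum_uminus)
  finally have eq: "\<dots> = (w - 1) * mzeta (s @ [w]) t" ..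
  have "w - 1 \<noteq> 0" using w(2) by auto
  thus ?thesis unfolding mzeta_cont_def snoc2(1) eq by simp
qed

lemma mzeta_cont_holomorphic:
  assumes t: "t \<notin> complex_of_real ` {1..}" and s: "\<And>x. x \<in> set s \<Longrightarrow> Re x \<ge> real R + 4"
    and L: "real L \<ge> real R + 1"
  shows "mzeta_cont L s t holomorphic_on ball 0 (real R) - {1}"
proof -
  obtain C1 where C1: "C1 > 0" "\<And>ns w. ns \<in> increasing_lists (length s) \<Longrightarrow> norm w \<le> real R \<Longrightarrow>
     norm (zterm s t ns * em_sum L w (of_nat (Suc (last0 ns)) - t)) \<le> C1 * inv_squares ns"
    using zterm_em_sum_bound[OF t, of s R L] s by auto
  obtain C2 where C2: "C2 > 0" "\<And>ns w. ns \<in> increasing_lists (Suc (length s)) \<Longrightarrow> norm w \<le> real R \<Longrightarrow>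
     norm (zterm s t (butlast ns) * em_rem L w (of_nat (last ns) - t)) \<le> C2 * inv_squares ns"
    using zterm_em_rem_bound[OF t, of s R L] s L by auto
  have nz: "of_nat n - t \<noteq> 0" "of_nat n - t + 1 \<noteq> 0" if "n > 0" for n
    using of_nat_minus_nonzero[OF t that] of_nat_minus_nonzero[OF t, of "Suc n"] by (auto simp: algebra_simps)
  have pos: "last ns > 0" if "ns \<in> increasing_lists (Suc m)" for ns m
    using butlast_last_increasing(2)[OF that] by simp
  show ?thesis
    unfolding mzeta_cont_def
  proof (intro holomorphic_on_mult holomorphic_on_diff)
    show "(\<lambda>w. \<Sum>\<^sub>\<infinity>ns\<in>increasing_lists (length s). zterm s t ns * em_sum L w (of_nat (Suc (last0 ns)) - t))
        holomorphic_on ball 0 (real R) - {1}"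
      by (rule holomorphic_on_infsum[where M = "\<lambda>ns. C1 * inv_squares ns"])
         (use C1(2) nz[of "Suc _"] in \<open>auto intro!: holomorphic_intros summable_on_cmult_right summable_inv_squares_increasing\<close>)
    show "(\<lambda>w. \<Sum>\<^sub>\<infinity>ns\<in>increasing_lists (Suc (length s)). zterm s t (butlast ns) * em_rem L w (of_nat (last ns) - t))
        holomorphic_on ball 0 (real R) - {1}"
      by (rule holomorphic_on_infsum[where M = "\<lambda>ns. C2 * inv_squares ns"])
         (use C2(2) nz pos in \<open>auto intro!: holomorphic_intros summable_on_cmult_right summable_inv_squares_increasing\<close>)
  qed (auto intro!: holomorphic_intros)
qed

lemma mzeta_cont_neg_of_nat:
  assumes t: "t \<notin> complex_of_real ` {1..}" and a: "Suc a \<le> L"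
  shows "mzeta_cont L s t (- of_nat a) =
    (\<Sum>\<^sub>\<infinity>ns\<in>increasing_lists (length s). zterm s t ns * bpoly a (of_nat (last0 ns) - t + 1))"
proof -
  have nz: "of_nat n - t \<noteq> 0" "of_nat n - t + 1 \<noteq> 0" if "n > 0" for n
    using of_nat_minus_nonzero[OF t that] of_nat_minus_nonzero[OF t, of "Suc n"] by (auto simp: algebra_simps)
  have "(\<Sum>\<^sub>\<infinity>ns\<in>increasing_lists (Suc (length s)). zterm s t (butlast ns) * em_rem L (- of_nat a) (of_nat (last ns) - t)) = 0"
  proof (rule infsum_0)
    fix ns assume "ns \<in> increasing_lists (Suc (length s))"
    hence "last ns > 0" using butlast_last_increasing(2) by force
    thus "zterm s t (butlast ns) * em_rem L (- of_nat a) (of_nat (last ns) - t) = 0"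
      using em_rem_neg_of_nat[OF nz a] by simp
  qed
  moreover have "zterm s t ns * em_sum L (- of_nat a) (of_nat (Suc (last0 ns)) - t)
      = - of_nat (Suc a) * (zterm s t ns * bpoly a (of_nat (last0 ns) - t + 1))" for ns
  proof -
    have "of_nat (Suc (last0 ns)) - t = of_nat (last0 ns) - t + 1" by simp
    thus ?thesis
      using em_sum_neg_of_nat[OF nz(1) a, of "Suc (last0 ns)"] by (simp only: zero_less_Suc mult_ac)
  qed
  moreover have "- of_nat a - 1 = - (of_nat (Suc a) :: complex)" by simp
  ultimately show ?thesis
    unfolding mzeta_cont_def by (simp only: infsum_cmult_right') (simp del: of_nat_Suc)
qed

section \<open>One step of the recursion in the depth\<close>

definition mzeta_last :: "complex list \<Rightarrow> complex \<Rightarrow> (complex \<Rightarrow> complex) \<Rightarrow> complex" where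
  "mzeta_last s t p = (\<Sum>\<^sub>\<infinity>ns\<in>increasing_lists (length s). zterm s t ns * p (of_nat (last0 ns) - t))"

text \<open>Intended for nonempty lists; \<open>zetaU_moment\<close> applies it to
  \<open>rev (drop i s)\<close> with i < \<open>length s\<close>.\<close>

definition mzeta_first :: "complex list \<Rightarrow> complex \<Rightarrow> (complex \<Rightarrow> complex) \<Rightarrow> complex" where
  "mzeta_first s t p = (\<Sum>\<^sub>\<infinity>ns\<in>increasing_lists (length s). zterm s t ns * p (t - of_nat (hd ns)))"

text \<open>\<open>zetaU_series\<close> with an additional weight \<open>y ^ d / d!\<close> on the last variable, where \<open>y = n + t\<^sub>+\<close> in the
  first factor and \<open>y = t\<^sub>- - n\<close> in the second; the empty list behaves as if it ended in \<open>n = 0\<close>.\<close>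
definition zetaU_moment :: "complex \<Rightarrow> complex \<Rightarrow> nat \<Rightarrow> complex list \<Rightarrow> complex" where
  "zetaU_moment tp tm d s = mzeta_last s (- tp) (\<lambda>y. y ^ d / fact d)
     + (\<Sum>i<length s. exp (pi * \<i> * sum_list (drop i s)) * mzeta (take i s) (- tp)
          * mzeta_first (rev (drop i s)) tm (\<lambda>y. y ^ d / fact d))"

text \<open>The coefficient of x^d / d! in \<open>bpoly a (x + 1) - bpoly a u\<close>. The extra 1
  at d = a comes from rewriting \<open>bpoly a (x + 1)\<close> as
  \<open>bpoly a x - x ^ a\<close>.\<close>

definition shift_coeff :: "complex \<Rightarrow> nat \<Rightarrow> nat \<Rightarrow> complex" where
  "shift_coeff u a d = (if d \<le> Suc a then
     - fact a * (bern (Suc a - d) + (if d = a then 1 else 0)) - (if d = 0 then bpoly a u else 0) else 0)"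

text \<open>The upper limit D is free because the coefficients vanish beyond a + 1; weights of
  different degrees can thus share one range.\<close>

lemma bpoly_shift_diff:
  assumes "Suc a \<le> D"
  shows "bpoly a (x + 1) - bpoly a u = (\<Sum>d\<le>D. shift_coeff u a d * (x ^ d / fact d))"
proof -
  have "(\<Sum>d\<le>D. shift_coeff u a d * (x ^ d / fact d)) = (\<Sum>d\<le>Suc a. shift_coeff u a d * (x ^ d / fact d))"
    using assms by (intro sum.mono_neutral_right) (auto simp: shift_coeff_def)
  also have "\<dots> = (\<Sum>d\<le>Suc a. - fact a * (bern (Suc a - d) * x ^ d / fact d)
      - fact a * (if d = a then x ^ d / fact d else 0) - (if d = 0 then bpoly a u else 0))"
    by (intro sum.cong refl) (auto simp: shift_coeff_def algebra_simps)
  also have "\<dots> = - fact a * (\<Sum>d\<le>Suc a. bern (Suc a - d) * x ^ d / fact d)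
      - fact a * (\<Sum>d\<le>Suc a. if d = a then x ^ d / fact d else 0) - (\<Sum>d\<le>Suc a. if d = 0 then bpoly a u else 0)"
    unfolding sum_subtractf sum_distrib_left ..
  also have "(\<Sum>d\<le>Suc a. bern (Suc a - d) * x ^ d / fact d)
      = (\<Sum>j\<le>Suc a. bern j * x ^ (Suc a - j) / fact (Suc a - j))"
    by (rule sum.reindex_bij_witness[of _ "\<lambda>j. Suc a - j" "\<lambda>j. Suc a - j"]) auto
  also have "(\<Sum>d\<le>Suc a. if d = a then x ^ d / fact d else 0) = x ^ a / fact a"
    by (subst sum.delta) auto
  also have "(\<Sum>d\<le>Suc a. if d = 0 then bpoly a u else 0) = bpoly a u"
    by (subst sum.delta) auto
  also have "- fact a * (\<Sum>j\<le>Suc a. bern j * x ^ (Suc a - j) / fact (Suc a - j)) = bpoly a x"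
    by (simp only: bpoly_def)
  finally show ?thesis using bpoly_diff[of a x] by (simp add: algebra_simps)
qed

lemma zterm_weight_summable:
  assumes t: "t \<notin> complex_of_real ` {1..}" and s: "\<And>x. x \<in> set s \<Longrightarrow> Re x \<ge> real R + 4"
    and h: "\<And>ns. ns \<in> increasing_lists (length s) \<Longrightarrow> h ns = 0 \<or> h ns \<in> set ns" and d: "d \<le> R + 2"
  shows "(\<lambda>ns. zterm s t ns * (of_nat (h ns) - t) ^ d) summable_on increasing_lists (length s)"
proof -
  obtain C where C: "C > 0" "\<And>ns n. ns \<in> increasing_lists (length s) \<Longrightarrow> n = 0 \<or> n \<in> set ns \<Longrightarrow>
      norm (zterm s t ns) * (1 + real n) ^ (R + 2) \<le> C * inv_squares ns"
    using norm_zterm_weighted_bound[OF t, of s "R + 2"] s by (auto simp: algebra_simps)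
  show ?thesis
  proof (rule summable_on_by_inv_squares)
    fix ns assume ns: "ns \<in> increasing_lists (length s)"
    have "norm (of_nat (h ns) - t) \<le> real (h ns) + norm t"
      using norm_triangle_ineq4[of "of_nat (h ns)" t] by simp
    also have "\<dots> \<le> (1 + norm t) * (1 + real (h ns))" by (simp add: algebra_simps)
    finally have "norm (of_nat (h ns) - t) ^ d \<le> ((1 + norm t) * (1 + real (h ns))) ^ d"
      by (rule power_mono) auto
    also have "\<dots> \<le> (1 + norm t) ^ d * (1 + real (h ns)) ^ (R + 2)"
      unfolding power_mult_distrib using d by (intro mult_left_mono power_increasing) auto
    finally have "norm (zterm s t ns) * norm (of_nat (h ns) - t) ^ d
        \<le> norm (zterm s t ns) * ((1 + norm t) ^ d * (1 + real (h ns)) ^ (R + 2))"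
      by (rule mult_left_mono) auto
    also have "\<dots> = (1 + norm t) ^ d * (norm (zterm s t ns) * (1 + real (h ns)) ^ (R + 2))" by simp
    also have "\<dots> \<le> (1 + norm t) ^ d * (C * inv_squares ns)"
      by (intro mult_left_mono C(2) ns h) auto
    finally show "norm (zterm s t ns * (of_nat (h ns) - t) ^ d) \<le> (1 + norm t) ^ d * C * inv_squares ns"
      by (simp add: norm_mult norm_power)
  qed
qed

lemma infsum_linear_combination:
  fixes f :: "nat \<Rightarrow> 'a \<Rightarrow> complex"
  assumes "\<And>d. d \<le> D \<Longrightarrow> f d summable_on A"
  shows "(\<Sum>\<^sub>\<infinity>x\<in>A. \<Sum>d\<le>D. c d * f d x) = (\<Sum>d\<le>D. c d * (\<Sum>\<^sub>\<infinity>x\<in>A. f d x))"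
proof -
  have "((\<lambda>x. \<Sum>d\<le>D. c d * f d x) has_sum (\<Sum>d\<le>D. c d * (\<Sum>\<^sub>\<infinity>x\<in>A. f d x))) A"
    using assms by (induction D) (auto intro!: has_sum_add has_sum_cmult_right has_sum_infsum)
  thus ?thesis by (rule infsumI)
qed

lemma mzeta_last_linear:
  assumes "t \<notin> complex_of_real ` {1..}" "\<And>x. x \<in> set s \<Longrightarrow> Re x \<ge> real R + 4" "D \<le> R + 2"
  shows "mzeta_last s t (\<lambda>y. \<Sum>d\<le>D. c d * (y ^ d / fact d)) = (\<Sum>d\<le>D. c d * mzeta_last s t (\<lambda>y. y ^ d / fact d))"
proof -
  have "mzeta_last s t (\<lambda>y. \<Sum>d\<le>D. c d * (y ^ d / fact d)) = (\<Sum>\<^sub>\<infinity>ns\<in>increasing_lists (length s).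
      \<Sum>d\<le>D. c d * (zterm s t ns * ((of_nat (last0 ns) - t) ^ d / fact d)))"
    unfolding mzeta_last_def sum_distrib_left by (simp add: mult_ac)
  also have "\<dots> = (\<Sum>d\<le>D. c d * mzeta_last s t (\<lambda>y. y ^ d / fact d))"
    unfolding mzeta_last_def
  proof (rule infsum_linear_combination)
    fix d assume "d \<le> D"
    hence "(\<lambda>ns. zterm s t ns * (of_nat (last0 ns) - t) ^ d) summable_on increasing_lists (length s)"
      using assms by (intro zterm_weight_summable last0_cases) auto
    from summable_on_cmult_left[OF this, of "1 / fact d"]
    show "(\<lambda>ns. zterm s t ns * ((of_nat (last0 ns) - t) ^ d / fact d)) summable_on increasing_lists (length s)"
      by simp
  qed
  finally show ?thesis .
qed

lemma mzeta_first_linear: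
  assumes "t \<notin> complex_of_real ` {1..}" "\<And>x. x \<in> set s \<Longrightarrow> Re x \<ge> real R + 4" "D \<le> R + 2" "s \<noteq> []"
  shows "mzeta_first s t (\<lambda>y. \<Sum>d\<le>D. c d * (y ^ d / fact d)) = (\<Sum>d\<le>D. c d * mzeta_first s t (\<lambda>y. y ^ d / fact d))"
proof -
  have "mzeta_first s t (\<lambda>y. \<Sum>d\<le>D. c d * (y ^ d / fact d)) = (\<Sum>\<^sub>\<infinity>ns\<in>increasing_lists (length s).
      \<Sum>d\<le>D. c d * (zterm s t ns * ((t - of_nat (hd ns)) ^ d / fact d)))"
    unfolding mzeta_first_def sum_distrib_left by (simp add: mult_ac)
  also have "\<dots> = (\<Sum>d\<le>D. c d * mzeta_first s t (\<lambda>y. y ^ d / fact d))"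
    unfolding mzeta_first_def
  proof (rule infsum_linear_combination)
    fix d assume "d \<le> D"
    have "hd ns \<in> set ns" if "ns \<in> increasing_lists (length s)" for ns
      using that assms(4) by (cases ns) (auto simp: increasing_lists_def)
    hence "(\<lambda>ns. zterm s t ns * (of_nat (hd ns) - t) ^ d) summable_on increasing_lists (length s)"
      using assms \<open>d \<le> D\<close> by (intro zterm_weight_summable) auto
    from summable_on_cmult_left[OF this, of "(-1) ^ d / fact d"]
    have "(\<lambda>ns. zterm s t ns * (of_nat (hd ns) - t) ^ d * ((-1) ^ d / fact d)) summable_on increasing_lists (length s)" .
    moreover have "(of_nat (hd ns) - t) ^ d * (-1) ^ d = (t - of_nat (hd ns)) ^ d" for ns
      by (simp flip: power_mult_distrib)
    ultimately show "(\<lambda>ns. zterm s t ns * ((t - of_nat (hd ns)) ^ d / fact d)) summable_on increasing_lists (length s)"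
      by (simp add: mult.assoc flip: times_divide_eq_right) (simp add: mult.assoc)
  qed
  finally show ?thesis .
qed

text \<open>Nothing but |w| \<le> R is asked of the exponent of the smallest index n: since n is
  below the next entry k, n^R \<le> n^(-2) (1 + k)^(R + 2), and the reserve of decay in u absorbs
  the power of k.\<close>

lemma zterm_Cons_bound:
  assumes t: "t \<notin> complex_of_real ` {1..}" and u: "\<And>x. x \<in> set u \<Longrightarrow> Re x \<ge> real R + 4" "u \<noteq> []"
  obtains C where "C > 0" "\<And>ns w. ns \<in> increasing_lists (Suc (length u)) \<Longrightarrow> norm w \<le> real R \<Longrightarrow>
     norm (zterm (w # u) t ns) \<le> C * inv_squares ns"
proof -
  obtain C1 where C1: "C1 > 0" "\<And>y s. y \<ge> 1 \<Longrightarrow> norm s \<le> real R \<Longrightarrow>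
      norm ((of_real y - t) powr s) \<le> C1 * y powr Re s"
    using norm_powr_of_real_minus_bound[OF t, of "real R"] by metis
  obtain C2 where C2: "C2 > 0" "\<And>ns n. ns \<in> increasing_lists (length u) \<Longrightarrow> n = 0 \<or> n \<in> set ns \<Longrightarrow>
      norm (zterm u t ns) * (1 + real n) ^ (R + 2) \<le> C2 * inv_squares ns"
    using norm_zterm_weighted_bound[OF t, of u "R + 2"] u by (auto simp: algebra_simps)
  show thesis
  proof (rule that[of "C1 * C2"])
    fix ns and w :: complex assume ns: "ns \<in> increasing_lists (Suc (length u))" and w: "norm w \<le> real R"
    let ?n = "hd ns" and ?k = "hd (tl ns)"
    have "length (tl ns) = length u" using tl_increasing(1)[OF ns] unfolding increasing_lists_def by blast
    hence tl: "tl ns \<noteq> []" using u(2) by (metis length_0_conv)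
    note ns' = tl_increasing(1-3)[OF ns] tl_increasing(4)[OF ns tl]
    have n: "?n \<ge> 1" using ns'(2) by simp
    have "norm ((of_nat ?n - t) powr (-w)) \<le> C1 * real ?n powr Re (-w)"
      using C1(2)[of "real ?n" "-w"] n w by simp
    also have "\<dots> \<le> C1 * real ?n powr real R"
      using C1(1) w abs_Re_le_cmod[of w] n by (intro mult_left_mono powr_mono) auto
    also have "real ?n powr real R = 1 / real ?n ^ 2 * real ?n ^ (R + 2)"
      using n by (simp add: powr_realpow power_add power2_eq_square)
    also have "C1 * (1 / real ?n ^ 2 * real ?n ^ (R + 2)) \<le> C1 * (1 / real ?n ^ 2 * (1 + real ?k) ^ (R + 2))"
      using C1(1) ns'(4) by (intro mult_left_mono power_mono) auto
    finally have "norm ((of_nat ?n - t) powr (-w)) * norm (zterm u t (tl ns))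
        \<le> C1 * (1 / real ?n ^ 2 * (1 + real ?k) ^ (R + 2)) * norm (zterm u t (tl ns))"
      by (rule mult_right_mono) auto
    also have "\<dots> = C1 * (1 / real ?n ^ 2) * (norm (zterm u t (tl ns)) * (1 + real ?k) ^ (R + 2))" by simp
    also have "\<dots> \<le> C1 * (1 / real ?n ^ 2) * (C2 * inv_squares (tl ns))"
      using C1(1) tl by (intro mult_left_mono C2(2) ns') auto
    also have "\<dots> = C1 * C2 * inv_squares (?n # tl ns)" by simp
    finally have "norm (zterm (w # u) t (?n # tl ns)) \<le> C1 * C2 * inv_squares (?n # tl ns)"
      by (simp only: zterm_Cons norm_mult)
    thus "norm (zterm (w # u) t ns) \<le> C1 * C2 * inv_squares ns" using ns'(3) by simp
  qed (use C1 C2 in auto)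
qed

lemma mzeta_Cons_holomorphic:
  assumes t: "t \<notin> complex_of_real ` {1..}" and u: "\<And>x. x \<in> set u \<Longrightarrow> Re x \<ge> real R + 4" "u \<noteq> []"
  shows "(\<lambda>w. mzeta (w # u) t) holomorphic_on ball 0 (real R)"
proof -
  obtain C where C: "C > 0" "\<And>ns w. ns \<in> increasing_lists (Suc (length u)) \<Longrightarrow> norm w \<le> real R \<Longrightarrow>
     norm (zterm (w # u) t ns) \<le> C * inv_squares ns"
    using zterm_Cons_bound[OF t, of u R] u by auto
  have "(\<lambda>w. zterm (w # u) t ns) holomorphic_on ball 0 (real R)" if ns: "ns \<in> increasing_lists (Suc (length u))" for ns
  proof -
    have "(\<lambda>w. zterm (w # u) t (hd ns # tl ns)) holomorphic_on ball 0 (real R)"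
      unfolding zterm_Cons using of_nat_minus_nonzero[OF t tl_increasing(2)[OF ns]]
      by (intro holomorphic_intros)
    thus ?thesis using tl_increasing(3)[OF ns] by simp
  qed
  thus ?thesis
    unfolding mzeta_eq length_Cons using C(2)
    by (intro holomorphic_on_infsum[where f = "\<lambda>ns w. zterm (w # u) t ns" and M = "\<lambda>ns. C * inv_squares ns"])
       (auto intro!: summable_on_cmult_right summable_inv_squares_increasing)
qed

lemma sum_powers_bpoly:
  assumes "n > 0"
  shows "(\<Sum>j\<in>{0<..<n}. (of_nat j - t) ^ a) = bpoly a (1 - t) - bpoly a (of_nat n - t)"
proof -
  have "(\<Sum>j\<in>{0<..<n}. (of_nat j - t) ^ a) = (\<Sum>j\<in>{1..<n}. bpoly a (of_nat j - t) - bpoly a (of_nat (Suc j) - t))"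
  proof (rule sum.cong)
    show "(of_nat j - t) ^ a = bpoly a (of_nat j - t) - bpoly a (of_nat (Suc j) - t)" for j
      using bpoly_diff[of a "of_nat j - t"] by (simp add: algebra_simps)
  qed auto
  also have "\<dots> = bpoly a (of_nat 1 - t) - bpoly a (of_nat n - t)"
    using sum_Suc_diff'[of 1 n "\<lambda>j. - bpoly a (of_nat j - t)"] assms by simp
  finally show ?thesis by simp
qed

text \<open>The inner sum over the smallest index is a finite sum of a-th powers, evaluated by
  telescoping; \<open>bpoly_reflect\<close> then rewrites both ends in terms of t - n.\<close>

lemma mzeta_Cons_neg_of_nat:
  assumes t: "t \<notin> complex_of_real ` {1..}" and u: "\<And>x. x \<in> set u \<Longrightarrow> Re x \<ge> real R + 4" "u \<noteq> []"
    and a: "a \<le> R"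
  shows "(-1) ^ a * mzeta (- of_nat a # u) t = mzeta_first u t (\<lambda>y. bpoly a (y + 1) - bpoly a t)"
proof -
  let ?f = "\<lambda>n ns. (of_nat n - t) ^ a * zterm u t ns"
  obtain C where C: "C > 0" "\<And>ns w. ns \<in> increasing_lists (Suc (length u)) \<Longrightarrow> norm w \<le> real R \<Longrightarrow>
     norm (zterm (w # u) t ns) \<le> C * inv_squares ns"
    using zterm_Cons_bound[OF t, of u R] u by auto
  obtain m where m: "length u = Suc m" using u(2) by (cases u) auto
  have term_eq: "zterm (- of_nat a # u) t ns = ?f (hd ns) (tl ns)" if ns: "ns \<in> increasing_lists (Suc (length u))" for ns
  proof -
    have "zterm (- of_nat a # u) t (hd ns # tl ns) = ?f (hd ns) (tl ns)"
      using of_nat_minus_nonzero[OF t tl_increasing(2)[OF ns]] by (simp add: zterm_Cons)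
    thus ?thesis using tl_increasing(3)[OF ns] by simp
  qed
  have "(\<lambda>ns. ?f (hd ns) (tl ns)) summable_on increasing_lists (Suc (length u))"
    by (rule summable_on_by_inv_squares[of _ _ C]) (use C(2)[of _ "- of_nat a"] a term_eq in auto)
  moreover have "mzeta (- of_nat a # u) t = (\<Sum>\<^sub>\<infinity>ns\<in>increasing_lists (Suc (length u)). ?f (hd ns) (tl ns))"
    by (auto intro!: infsum_cong term_eq simp: mzeta_eq)
  ultimately have "mzeta (- of_nat a # u) t = (\<Sum>\<^sub>\<infinity>ns\<in>increasing_lists (length u). \<Sum>n\<in>{0<..<hd ns}. ?f n ns)"
    unfolding m using infsum_increasing_lists_Cons[of ?f m] by simp
  also have "\<dots> = (\<Sum>\<^sub>\<infinity>ns\<in>increasing_lists (length u). zterm u t ns * (bpoly a (1 - t) - bpoly a (of_nat (hd ns) - t)))"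
  proof (rule infsum_cong)
    fix ns assume "ns \<in> increasing_lists (length u)"
    hence "hd ns > 0" using m tl_increasing(2) by auto
    from sum_powers_bpoly[OF this, where a = a and t = t]
    show "(\<Sum>n\<in>{0<..<hd ns}. ?f n ns) = zterm u t ns * (bpoly a (1 - t) - bpoly a (of_nat (hd ns) - t))"
      by (simp add: mult.commute flip: sum_distrib_left)
  qed
  also have "(-1) ^ a * \<dots> = mzeta_first u t (\<lambda>y. bpoly a (y + 1) - bpoly a t)"
  proof -
    have "(-1) ^ a * (bpoly a (1 - t) - bpoly a (of_nat n - t)) = bpoly a (t - of_nat n + 1) - bpoly a t" for n
      using bpoly_reflect[of a t] bpoly_reflect[of a "t - of_nat n + 1"] by (simp add: algebra_simps)
    thus ?thesis
      unfolding mzeta_first_def infsum_cmult_right' [symmetric]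
      by (simp only: mult.left_commute[of "(-1) ^ a"])
  qed
  finally show ?thesis .
qed

lemma exp_pi_i_neg_of_nat: "exp (pi * \<i> * - of_nat a) = (-1) ^ a"
proof -
  have "exp (pi * \<i> * - of_nat a) = inverse (exp (of_nat a * (pi * \<i>)))"
    by (simp add: exp_minus mult_ac)
  also have "\<dots> = (-1) ^ a" by (simp only: exp_of_nat_mult exp_pi_i') (simp flip: power_inverse)
  finally show ?thesis .
qed

lemma zetaU_series_snoc:
  "zetaU_series tp tm (s @ [w]) = mzeta (s @ [w]) (- tp)
    + exp (pi * \<i> * w) * mzeta s (- tp) * mzeta [w] tm
    + (\<Sum>i<length s. exp (pi * \<i> * (sum_list (drop i s) + w)) * mzeta (take i s) (- tp) * mzeta (w # rev (drop i s)) tm)"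
proof -
  have "{0..length (s @ [w])} = insert (Suc (length s)) (insert (length s) {..<length s})" by auto
  thus ?thesis unfolding zetaU_series_def by (simp add: algebra_simps)
qed

text \<open>At w = -a the continued \<open>mzeta [w] tm\<close> contributes -
  \<open>bpoly a tm\<close>, exactly the constant that the first piece lacks. All cuts then carry
  the same weight \<open>bpoly a (y + 1) - bpoly a tm\<close>.\<close>

lemma zetaU_series_continuation:
  assumes tp: "- tp \<notin> complex_of_real ` {1..}" and tm: "tm \<notin> complex_of_real ` {1..}"
    and s: "\<And>x. x \<in> set s \<Longrightarrow> Re x \<ge> real R + 4"
  obtains V where "V holomorphic_on ball 0 (real R) - {1}"
    "\<And>w. norm w < real R \<Longrightarrow> Re w \<ge> 2 \<Longrightarrow> V w = zetaU_series tp tm (s @ [w])"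
    "\<And>a D. a < R \<Longrightarrow> Suc a \<le> D \<Longrightarrow> D \<le> R + 2 \<Longrightarrow>
       V (- of_nat a) = (\<Sum>d\<le>D. shift_coeff tm a d * zetaU_moment tp tm d s)"
proof -
  define V where "V w = mzeta_cont (Suc R) s (- tp) w
    + exp (pi * \<i> * w) * mzeta s (- tp) * mzeta_cont (Suc R) [] tm w
    + (\<Sum>i<length s. exp (pi * \<i> * (sum_list (drop i s) + w)) * mzeta (take i s) (- tp) * mzeta (w # rev (drop i s)) tm)" for w
  have drop: "Re x \<ge> real R + 4" if "x \<in> set (rev (drop i s))" for x i
    using that s set_drop_subset[of i s] by auto
  show thesis
  proof (rule that[of V])
    have "mzeta_cont (Suc R) s (- tp) holomorphic_on ball 0 (real R) - {1}"
      "mzeta_cont (Suc R) [] tm holomorphic_on ball 0 (real R) - {1}"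
      using s by (auto intro!: mzeta_cont_holomorphic tp tm)
    moreover have "(\<lambda>w. mzeta (w # rev (drop i s)) tm) holomorphic_on ball 0 (real R) - {1}" if "i < length s" for i
      by (rule holomorphic_on_subset[OF mzeta_Cons_holomorphic[OF tm]]) (use drop that in auto)
    ultimately show "V holomorphic_on ball 0 (real R) - {1}"
      unfolding V_def by (intro holomorphic_intros) auto
  next
    fix w :: complex assume w: "norm w < real R" "Re w \<ge> 2"
    thus "V w = zetaU_series tp tm (s @ [w])"
      unfolding V_def zetaU_series_snoc
      using mzeta_cont_eq_mzeta[OF tp s, where L = "Suc R" and w = w]
        mzeta_cont_eq_mzeta[OF tm, where s = "[]" and R = R and L = "Suc R" and w = w] by simp
  next
    fix a D assume a: "a < R" "Suc a \<le> D" "D \<le> R + 2"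
    let ?c = "shift_coeff tm a"
    let ?p = "\<lambda>y. \<Sum>d\<le>D. ?c d * (y ^ d / fact d)"
    have p: "bpoly a (y + 1) - bpoly a tm = ?p y" for y
      by (rule bpoly_shift_diff[OF a(2)])
    have delta: "(\<Sum>d\<le>D. (if d = 0 then k else 0) * g d) = k * g 0" for g :: "nat \<Rightarrow> complex" and k
      by (simp add: if_distrib[of "\<lambda>c. c * _"] cong: if_cong)
    have cont: "mzeta_cont (Suc R) s (- tp) (- of_nat a) - bpoly a tm * mzeta s (- tp) = mzeta_last s (- tp) ?p"
    proof -
      have "mzeta_cont (Suc R) s (- tp) (- of_nat a) = mzeta_last s (- tp) (\<lambda>y. bpoly a (y + 1))"
        using a by (subst mzeta_cont_neg_of_nat[OF tp]) (auto simp: mzeta_last_def)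
      \<comment> \<open>Adding \<open>bpoly a tm\<close> back at d = 0 gives the coefficients of
        \<open>bpoly a (y + 1)\<close> alone.\<close>
      also have "\<dots> = mzeta_last s (- tp) (\<lambda>y. \<Sum>d\<le>D. (?c d + (if d = 0 then bpoly a tm else 0)) * (y ^ d / fact d))"
        unfolding distrib_right sum.distrib p [symmetric] delta by simp
      also have "\<dots> = (\<Sum>d\<le>D. (?c d + (if d = 0 then bpoly a tm else 0)) * mzeta_last s (- tp) (\<lambda>y. y ^ d / fact d))"
        by (rule mzeta_last_linear[OF tp s a(3)])
      also have "\<dots> = (\<Sum>d\<le>D. ?c d * mzeta_last s (- tp) (\<lambda>y. y ^ d / fact d)) + bpoly a tm * mzeta_last s (- tp) (\<lambda>y. 1)"
        unfolding distrib_right sum.distrib delta by simp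
      also have "(\<Sum>d\<le>D. ?c d * mzeta_last s (- tp) (\<lambda>y. y ^ d / fact d)) = mzeta_last s (- tp) ?p"
        by (rule mzeta_last_linear[OF tp s a(3), symmetric])
      finally show ?thesis by (simp add: mzeta_last_def mzeta_eq)
    qed
    \<comment> \<open>Here \<open>last0 [] = 0\<close>, so the value is
      \<open>bpoly a (1 - tm)\<close> and the reflection applies.\<close>
    have "(-1) ^ a * mzeta_cont (Suc R) [] tm (- of_nat a) = - bpoly a tm"
      using a bpoly_reflect[of a tm] by (subst mzeta_cont_neg_of_nat[OF tm]) (auto simp: last0_def)
    moreover have "exp (pi * \<i> * (x + - of_nat a)) = exp (pi * \<i> * x) * (-1) ^ a" for x
      unfolding distrib_left exp_add exp_pi_i_neg_of_nat ..
    ultimately have "V (- of_nat a) = mzeta_last s (- tp) ?p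
        + (\<Sum>i<length s. exp (pi * \<i> * sum_list (drop i s)) * mzeta (take i s) (- tp)
             * ((-1) ^ a * mzeta (- of_nat a # rev (drop i s)) tm))"
      unfolding V_def exp_pi_i_neg_of_nat cont [symmetric] by (simp add: mult_ac)
    also have "(\<Sum>i<length s. exp (pi * \<i> * sum_list (drop i s)) * mzeta (take i s) (- tp)
             * ((-1) ^ a * mzeta (- of_nat a # rev (drop i s)) tm))
        = (\<Sum>i<length s. exp (pi * \<i> * sum_list (drop i s)) * mzeta (take i s) (- tp)
             * (\<Sum>d\<le>D. ?c d * mzeta_first (rev (drop i s)) tm (\<lambda>y. y ^ d / fact d)))"
    proof (rule sum.cong[OF refl])
      fix i assume "i \<in> {..<length s}"
      hence ne: "rev (drop i s) \<noteq> []" by simp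
      have "(-1) ^ a * mzeta (- of_nat a # rev (drop i s)) tm
          = (\<Sum>d\<le>D. ?c d * mzeta_first (rev (drop i s)) tm (\<lambda>y. y ^ d / fact d))"
        using mzeta_Cons_neg_of_nat[OF tm drop ne, where a = a] a mzeta_first_linear[OF tm drop a(3) ne, where c = ?c]
        unfolding p by simp
      thus "exp (pi * \<i> * sum_list (drop i s)) * mzeta (take i s) (- tp)
             * ((-1) ^ a * mzeta (- of_nat a # rev (drop i s)) tm)
          = exp (pi * \<i> * sum_list (drop i s)) * mzeta (take i s) (- tp)
             * (\<Sum>d\<le>D. ?c d * mzeta_first (rev (drop i s)) tm (\<lambda>y. y ^ d / fact d))" by simp
    qed
    also have "mzeta_last s (- tp) ?p = (\<Sum>d\<le>D. ?c d * mzeta_last s (- tp) (\<lambda>y. y ^ d / fact d))"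
      by (rule mzeta_last_linear[OF tp s a(3)])
    finally show "V (- of_nat a) = (\<Sum>d\<le>D. ?c d * zetaU_moment tp tm d s)"
      unfolding zetaU_moment_def distrib_left sum.distrib sum_distrib_left
      by (subst sum.swap) (simp add: mult_ac)
  qed
qed

section \<open>Values at non-positive integers\<close>

text \<open>The value of \<open>zetaU_moment tp tm c\<close> at the negatives of the \<^emph>\<open>reversed\<close> list of exponents.\<close>
fun zetaU_value :: "complex \<Rightarrow> complex \<Rightarrow> nat list \<Rightarrow> nat \<Rightarrow> complex" where
  "zetaU_value tp tm [] c = tp ^ c / fact c"
| "zetaU_value tp tm (k # ks) c =
    (\<Sum>d\<le>Suc (k + c). shift_coeff tm (k + c) d * zetaU_value tp tm ks d) / fact c"

text \<open>The weight y^c is absorbed by moving the last exponent from w to w - c. In the second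
  factors this costs (-1)^c, which is precisely the change of the exponential factor.\<close>

lemma zetaU_moment_snoc:
  assumes tp: "- tp \<notin> complex_of_real ` {1..}" and tm: "tm \<notin> complex_of_real ` {1..}"
  shows "zetaU_moment tp tm c (s @ [w]) = zetaU_series tp tm (s @ [w - of_nat c]) / fact c"
proof -
  have powr: "x powr (-w) * x ^ c = x powr (- (w - of_nat c))" if "x \<noteq> 0" for x
    using that by (simp add: powr_diff powr_minus divide_simps)
  have last: "mzeta_last (s @ [w]) (- tp) (\<lambda>y. y ^ c / fact c) = mzeta (s @ [w - of_nat c]) (- tp) / fact c"
  proof -
    have "zterm (s @ [w]) (- tp) ns * ((of_nat (last0 ns) - (- tp)) ^ c / fact c)
        = zterm s (- tp) (butlast ns) * (of_nat (last ns) - (- tp)) powr (- (w - of_nat c)) * (1 / fact c)"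
      if ns: "ns \<in> increasing_lists (Suc (length s))" for ns
    proof -
      note ns' = butlast_last_increasing[OF ns]
      have "length (butlast ns) = length s" using ns by (simp add: increasing_lists_def)
      hence "zterm (s @ [w]) (- tp) ns = zterm s (- tp) (butlast ns) * (of_nat (last ns) - (- tp)) powr (-w)"
        using zterm_snoc[of "butlast ns" s w "- tp" "last ns"] ns'(3) by simp
      moreover have "last0 ns = last ns" using ns' by (metis last0_def snoc_eq_iff_butlast)
      moreover have "of_nat (last ns) - (- tp) \<noteq> 0" using of_nat_minus_nonzero[OF tp, of "last ns"] ns'(2) by simp
      ultimately show ?thesis using powr[of "of_nat (last ns) - (- tp)"] by (metis (no_types, lifting) mult.assoc mult.right_neutral times_divide_eq_right)
    qed
    hence "mzeta_last (s @ [w]) (- tp) (\<lambda>y. y ^ c / fact c) = (\<Sum>\<^sub>\<infinity>ns\<in>increasing_lists (Suc (length s)).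
        zterm s (- tp) (butlast ns) * (of_nat (last ns) - (- tp)) powr (- (w - of_nat c)) * (1 / fact c))"
      unfolding mzeta_last_def by (intro infsum_cong_neutral) auto
    thus ?thesis unfolding mzeta_snoc infsum_cmult_left' by simp
  qed
  have first: "mzeta_first (w # u) tm (\<lambda>y. y ^ c / fact c) = (-1) ^ c * mzeta ((w - of_nat c) # u) tm / fact c" for u
  proof -
    have "zterm (w # u) tm ns * ((tm - of_nat (hd ns)) ^ c / fact c)
        = zterm ((w - of_nat c) # u) tm ns * ((-1) ^ c / fact c)"
      if ns: "ns \<in> increasing_lists (Suc (length u))" for ns
    proof -
      note ns' = tl_increasing(1-3)[OF ns]
      define x where "x = of_nat (hd ns) - tm"
      have "x \<noteq> 0" unfolding x_def by (rule of_nat_minus_nonzero[OF tm ns'(2)])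
      moreover have "(tm - of_nat (hd ns)) ^ c = (-1) ^ c * x ^ c"
        by (simp add: x_def flip: power_mult_distrib)
      moreover have "zterm (v # u) tm ns = x powr (- v) * zterm u tm (tl ns)" for v
        using ns'(3) zterm_Cons[of v u tm "hd ns" "tl ns"] by (simp add: x_def)
      ultimately show ?thesis using powr[of x] by (simp add: mult_ac)
    qed
    hence "mzeta_first (w # u) tm (\<lambda>y. y ^ c / fact c) = (\<Sum>\<^sub>\<infinity>ns\<in>increasing_lists (Suc (length u)).
        zterm ((w - of_nat c) # u) tm ns * ((-1) ^ c / fact c))"
      unfolding mzeta_first_def by (intro infsum_cong_neutral) auto
    thus ?thesis unfolding mzeta_eq infsum_cmult_left' by simp
  qed
  have exp_shift: "exp (pi * \<i> * (x + (w - of_nat c))) = exp (pi * \<i> * (x + w)) * (-1) ^ c" for x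
  proof -
    have "exp (pi * \<i> * (x + (w - of_nat c))) = exp (pi * \<i> * (x + w)) * exp (pi * \<i> * - of_nat c)"
      by (simp add: algebra_simps flip: exp_add)
    thus ?thesis unfolding exp_pi_i_neg_of_nat .
  qed
  have "{..<length (s @ [w])} = insert (length s) {..<length s}" by auto
  hence "zetaU_moment tp tm c (s @ [w]) = mzeta (s @ [w - of_nat c]) (- tp) / fact c
      + exp (pi * \<i> * w) * mzeta s (- tp) * ((-1) ^ c * mzeta [w - of_nat c] tm / fact c)
      + (\<Sum>i<length s. exp (pi * \<i> * (sum_list (drop i s) + w)) * mzeta (take i s) (- tp)
           * ((-1) ^ c * mzeta ((w - of_nat c) # rev (drop i s)) tm / fact c))"
    unfolding zetaU_moment_def last by (simp add: first)
  also have "\<dots> = zetaU_series tp tm (s @ [w - of_nat c]) / fact c"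
    unfolding zetaU_series_snoc exp_shift using exp_shift[of 0]
    by (simp add: add_divide_distrib sum_divide_distrib mult_ac)
  finally show ?thesis .
qed

lemma zetaU_moment_continuation_values:
  assumes tp: "- tp \<notin> complex_of_real ` {1..}" and tm: "tm \<notin> complex_of_real ` {1..}"
    and hol: "(\<lambda>w. H (s @ [w])) holomorphic_on UNIV"
    and eq: "\<And>w. Re w \<ge> real M \<Longrightarrow> H (s @ [w]) = (\<Sum>c\<le>N. \<alpha> c * zetaU_moment tp tm c (s @ [w]))"
    and s: "\<And>x. x \<in> set s \<Longrightarrow> Re x \<ge> real (k + 2 * N + M + 6) + 4"
  shows "H (s @ [- of_nat k]) =
    (\<Sum>c\<le>N. \<alpha> c / fact c * (\<Sum>d\<le>Suc (k + N). shift_coeff tm (k + c) d * zetaU_moment tp tm d s))"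
proof -
  \<comment> \<open>The ball of radius R - N must contain -k and a real point with real part above M
    + N + 2, and it must stay within radius R after subtracting any c \<le> N.\<close>
  define R where "R = k + 2 * N + M + 6"
  obtain V where V: "V holomorphic_on ball 0 (real R) - {1}"
    "\<And>w. norm w < real R \<Longrightarrow> Re w \<ge> 2 \<Longrightarrow> V w = zetaU_series tp tm (s @ [w])"
    "\<And>a D. a < R \<Longrightarrow> Suc a \<le> D \<Longrightarrow> D \<le> R + 2 \<Longrightarrow>
       V (- of_nat a) = (\<Sum>d\<le>D. shift_coeff tm a d * zetaU_moment tp tm d s)"
    using zetaU_series_continuation[OF tp tm, of s R] s unfolding R_def by blast
  define B where "B = ball (0::complex) (real (R - N))"
  \<comment> \<open>The points where some shifted argument w - c meets the possible pole at
    1.\<close>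
  define P where "P = (\<lambda>c. of_nat (Suc c)) ` {..N} \<union> {1 :: complex}"
  \<comment> \<open>On this set the hypothesis on \<open>H\<close> applies and every Re (w - c)
    exceeds 2.\<close>
  define S where "S = B \<inter> {w. Re w > real (M + N + 2)}"
  have shift: "norm (w - of_nat c) < real R" if "w \<in> B" "c \<le> N" for w :: complex and c
  proof -
    have "norm (w - of_nat c) \<le> norm w + real c"
      using norm_triangle_ineq4[of w "of_nat c"] by simp
    thus ?thesis using that by (simp add: B_def R_def)
  qed
  have "H (s @ [w]) = (\<Sum>c\<le>N. \<alpha> c / fact c * V (w - of_nat c))" if "w \<in> B - P" for w
  proof (rule analytic_continuation_open[of S "B - P" "\<lambda>w. H (s @ [w])" "\<lambda>w. \<Sum>c\<le>N. \<alpha> c / fact c * V (w - of_nat c)"])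
    show "open S" unfolding S_def B_def by (intro open_Int open_ball open_halfspace_Re_gt)
    have "of_real (real (M + N + 3)) \<in> S" by (simp add: S_def B_def R_def norm_of_real del: of_nat_add)
    thus "S \<noteq> {}" by blast
    show "open (B - P)" by (auto simp: B_def P_def intro!: open_Diff finite_imp_closed)
    show "connected (B - P)" unfolding B_def P_def by (rule connected_open_delete_finite) auto
    show "S \<subseteq> B - P" by (auto simp: S_def P_def)
    show "(\<lambda>w. H (s @ [w])) holomorphic_on B - P" using hol by (rule holomorphic_on_subset) auto
    show "(\<lambda>w. \<Sum>c\<le>N. \<alpha> c / fact c * V (w - of_nat c)) holomorphic_on B - P"
    proof (intro holomorphic_intros)
      fix c assume c: "c \<in> {..N}"
      have "(V \<circ> (\<lambda>w. w - of_nat c)) holomorphic_on B - P"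
      proof (rule holomorphic_on_compose_gen[OF _ V(1)])
        show "(\<lambda>w. w - of_nat c) ` (B - P) \<subseteq> ball 0 (real R) - {1}"
        proof
          fix v assume "v \<in> (\<lambda>w. w - of_nat c) ` (B - P)"
          then obtain w where w: "w \<in> B" "w \<notin> P" "v = w - of_nat c" by auto
          have "v \<noteq> 1"
          proof
            assume "v = 1"
            hence "w = of_nat (Suc c)" using w(3) by (simp add: algebra_simps)
            thus False using w(2) c by (auto simp: P_def)
          qed
          thus "v \<in> ball 0 (real R) - {1}" using shift[OF w(1), of c] c w(3) by simp
        qed
      qed (auto intro!: holomorphic_intros)
      thus "(\<lambda>w. V (w - of_nat c)) holomorphic_on B - P" by (simp add: o_def)
    qed
    show "H (s @ [w]) = (\<Sum>c\<le>N. \<alpha> c / fact c * V (w - of_nat c))" if "w \<in> S" for w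
    proof -
      have w: "w \<in> B" "Re w > real (M + N + 2)" using that by (auto simp: S_def)
      hence "V (w - of_nat c) = zetaU_series tp tm (s @ [w - of_nat c])" if "c \<le> N" for c
        using that by (intro V(2) shift) auto
      thus ?thesis using w(2) by (subst eq) (auto simp: zetaU_moment_snoc[OF tp tm] intro!: sum.cong)
    qed
  qed (use that in auto)
  moreover have "- of_nat k \<in> B - P"
  proof -
    have "(- of_nat k :: complex) \<noteq> of_nat (Suc c)" for c
    proof
      assume "(- of_nat k :: complex) = of_nat (Suc c)"
      from arg_cong[OF this, of Re] show False by simp
    qed
    from this this[of 0] show ?thesis by (auto simp: B_def P_def R_def)
  qed
  ultimately have "H (s @ [- of_nat k]) = (\<Sum>c\<le>N. \<alpha> c / fact c * V (- of_nat (k + c)))"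
    by simp
  also have "\<dots> = (\<Sum>c\<le>N. \<alpha> c / fact c * (\<Sum>d\<le>Suc (k + N). shift_coeff tm (k + c) d * zetaU_moment tp tm d s))"
    by (intro sum.cong refl arg_cong2[where f = "(*)"] V(3)) (auto simp: R_def)
  finally show ?thesis .
qed

lemma zetaU_value_Cons_extend:
  assumes "Suc (k + c) \<le> D"
  shows "zetaU_value tp tm (k # ks) c = (\<Sum>d\<le>D. shift_coeff tm (k + c) d * zetaU_value tp tm ks d) / fact c"
proof -
  have "(\<Sum>d\<le>D. shift_coeff tm (k + c) d * zetaU_value tp tm ks d)
      = (\<Sum>d\<le>Suc (k + c). shift_coeff tm (k + c) d * zetaU_value tp tm ks d)"
    using assms by (intro sum.mono_neutral_right) (auto simp: shift_coeff_def)
  thus ?thesis by simp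
qed

text \<open>Only the identity theorem in the last variable is used: with the other variables in the region
  of convergence, a combination of depth \<open>m + 1\<close> moments evaluated at \<open>s\<^sub>m\<^sub>+\<^sub>1 = -k\<close> is a combination
  of depth \<open>m\<close> moments.\<close>
lemma continuation_values:
  assumes tp: "- tp \<notin> complex_of_real ` {1..}" and tm: "tm \<notin> complex_of_real ` {1..}"
    and "\<And>s j. length s = length ks \<Longrightarrow> j < length ks \<Longrightarrow> (\<lambda>w. H (s[j := w])) holomorphic_on UNIV"
    and "\<And>s. length s = length ks \<Longrightarrow> (\<And>x. x \<in> set s \<Longrightarrow> Re x \<ge> real M) \<Longrightarrow>
           H s = (\<Sum>c\<le>N. \<alpha> c * zetaU_moment tp tm c s)"
  shows "H (map (\<lambda>k. - of_nat k) ks) = (\<Sum>c\<le>N. \<alpha> c * zetaU_value tp tm (rev ks) c)"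
  using assms(3,4)
proof (induction ks arbitrary: H M N \<alpha> rule: rev_induct)
  case Nil
  thus ?case by (simp add: zetaU_moment_def mzeta_last_def last0_def)
next
  case (snoc k ks)
  \<comment> \<open>The threshold k + 2N + M + 6, plus 4, required for one step; it also exceeds
    M.\<close>
  define M' where "M' = k + 2 * N + M + 10"
  define \<beta> where "\<beta> d = (\<Sum>c\<le>N. \<alpha> c / fact c * shift_coeff tm (k + c) d)" for d
  have swap: "(\<Sum>c\<le>N. \<alpha> c / fact c * (\<Sum>d\<le>D. shift_coeff tm (k + c) d * g d)) = (\<Sum>d\<le>D. \<beta> d * g d)"
    for g :: "nat \<Rightarrow> complex" and D
    unfolding \<beta>_def sum_distrib_left sum_distrib_right by (subst sum.swap) (simp add: mult_ac)
  have "H (map (\<lambda>k. - of_nat k) ks @ [- of_nat k]) = (\<Sum>d\<le>Suc (k + N). \<beta> d * zetaU_value tp tm (rev ks) d)"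
  \<comment> \<open>The last variable is now frozen at -k, leaving a function of one variable fewer
    that is again a combination of moments, with coefficients \<open>\<beta>\<close>.\<close>
  proof (rule snoc.IH[where H = "\<lambda>s. H (s @ [- of_nat k])" and M = M'])
    fix s :: "complex list" and j assume s: "length s = length ks" "j < length ks"
    have "(s @ [- of_nat k])[j := w] = s[j := w] @ [- of_nat k]" for w
      using s by (simp add: list_update_append)
    thus "(\<lambda>w. H (s[j := w] @ [- of_nat k])) holomorphic_on UNIV"
      using snoc.prems(1)[of "s @ [- of_nat k]" j] s by simp
  next
    fix s :: "complex list" assume s: "length s = length ks" "\<And>x. x \<in> set s \<Longrightarrow> Re x \<ge> real M'"
    show "H (s @ [- of_nat k]) = (\<Sum>d\<le>Suc (k + N). \<beta> d * zetaU_moment tp tm d s)"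
      unfolding swap [symmetric]
    proof (rule zetaU_moment_continuation_values[OF tp tm, where M = M])
      have "(s @ [0])[length s := w] = s @ [w]" for w :: complex by simp
      thus "(\<lambda>w. H (s @ [w])) holomorphic_on UNIV"
        using snoc.prems(1)[of "s @ [0]" "length s"] s(1) by simp
      show "H (s @ [w]) = (\<Sum>c\<le>N. \<alpha> c * zetaU_moment tp tm c (s @ [w]))" if "Re w \<ge> real M" for w
        using that s by (intro snoc.prems(2)) (auto simp: M'_def dest!: s(2))
      show "Re x \<ge> real (k + 2 * N + M + 6) + 4" if "x \<in> set s" for x
        using s(2)[OF that] by (simp add: M'_def)
    qed
  qed
  also have "\<dots> = (\<Sum>c\<le>N. \<alpha> c * zetaU_value tp tm (k # rev ks) c)"
    unfolding swap [symmetric]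
    by (intro sum.cong refl) (simp add: zetaU_value_Cons_extend[of k _ "Suc (k + N)"] del: zetaU_value.simps sum.atMost_Suc)
  finally show ?case by simp
qed

lemma zetaU_moment_0: "zetaU_moment tp tm 0 s = zetaU_series tp tm s"
proof -
  have "mzeta_last s t (\<lambda>y. y ^ 0 / fact 0) = mzeta s t" "mzeta_first s t (\<lambda>y. y ^ 0 / fact 0) = mzeta s t" for s t
    by (simp_all add: mzeta_last_def mzeta_first_def mzeta_eq)
  moreover have "{0..length s} = insert (length s) {..<length s}" by auto
  ultimately show ?thesis unfolding zetaU_moment_def zetaU_series_def by simp
qed

lemma is_zetaU_entire_value:
  assumes tp: "tp \<notin> complex_of_real ` {..-1}" and tm: "tm \<notin> complex_of_real ` {1..}"
    and F: "is_zetaU_entire tp tm r F" and ks: "length ks = r"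
  shows "F (map (\<lambda>k. - of_nat k) ks) = zetaU_value tp tm (rev ks) 0"
proof -
  have tp': "- tp \<notin> complex_of_real ` {1..}"
  proof
    assume "- tp \<in> complex_of_real ` {1..}"
    then obtain x where "x \<ge> 1" "- tp = of_real x" by auto
    hence "tp = of_real (- x)" by (metis minus_minus of_real_minus)
    thus False using tp \<open>x \<ge> 1\<close> by auto
  qed
  have "F (map (\<lambda>k. - of_nat k) ks) = (\<Sum>c\<le>0. (\<lambda>_. 1) c * zetaU_value tp tm (rev ks) c)"
  proof (rule continuation_values[OF tp' tm, where M = 2])
    fix s :: "complex list" assume "length s = length ks" "\<And>x. x \<in> set s \<Longrightarrow> Re x \<ge> real 2"
    hence "F s = zetaU_series tp tm s" using F ks unfolding is_zetaU_entire_def by force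
    thus "F s = (\<Sum>c\<le>0. (\<lambda>_. 1) c * zetaU_moment tp tm c s)" by (simp add: zetaU_moment_0)
  qed (use F ks in \<open>auto simp: is_zetaU_entire_def\<close>)
  thus ?thesis by simp
qed

section \<open>Polynomiality\<close>

text \<open>An inductive closure makes stability under sums and products easy;
  \<open>rat_poly2_normal_form\<close> recovers one coefficient array valid for all
  arguments.\<close>

inductive rat_poly2 :: "(complex \<Rightarrow> complex \<Rightarrow> complex) \<Rightarrow> bool" where
  monom: "rat_poly2 (\<lambda>x y. of_rat q * x ^ a * y ^ b)"
| add: "rat_poly2 f \<Longrightarrow> rat_poly2 g \<Longrightarrow> rat_poly2 (\<lambda>x y. f x y + g x y)"

lemma rat_poly2_const: "c \<in> \<rat> \<Longrightarrow> rat_poly2 (\<lambda>x y. c)"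
proof (erule Rats_cases)
  fix q assume "c = of_rat q"
  thus "rat_poly2 (\<lambda>x y. c)" using rat_poly2.monom[of q 0 0] by simp
qed

lemma rat_poly2_sum:
  "(\<And>i. i \<in> A \<Longrightarrow> rat_poly2 (f i)) \<Longrightarrow> rat_poly2 (\<lambda>x y. \<Sum>i\<in>A. f i x y)"
proof (induction A rule: infinite_finite_induct)
  case (insert i A)
  have "rat_poly2 (\<lambda>x y. f i x y + (\<Sum>i\<in>A. f i x y))"
    by (rule rat_poly2.add) (use insert in auto)
  thus ?case using insert.hyps by simp
qed (simp_all add: rat_poly2_const)

lemma rat_poly2_mult:
  assumes "rat_poly2 f" "rat_poly2 g"
  shows "rat_poly2 (\<lambda>x y. f x y * g x y)"
  using assms
proof (induction f rule: rat_poly2.induct)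
  case (monom q a b)
  from monom.prems show ?case
  proof (induction g rule: rat_poly2.induct)
    case (monom q' a' b')
    show ?case using rat_poly2.monom[of "q * q'" "a + a'" "b + b'"]
      by (simp add: of_rat_mult power_add mult_ac)
  next
    case (add g h)
    show ?case unfolding distrib_left by (rule rat_poly2.add[OF add.IH])
  qed
next
  case (add f h)
  show ?case unfolding distrib_right by (rule rat_poly2.add[OF add.IH[OF add.prems]])
qed

lemma rat_poly2_normal_form:
  assumes "rat_poly2 f"
  shows "\<exists>(N :: nat) (c :: nat \<Rightarrow> nat \<Rightarrow> rat). \<forall>x y. f x y = (\<Sum>a\<le>N. \<Sum>b\<le>N. of_rat (c a b) * x ^ a * y ^ b)"
  using assms
proof induction
  case (monom q a b)
  have "of_rat q * x ^ a * y ^ b = (\<Sum>i\<le>max a b. \<Sum>j\<le>max a b. of_rat (if i = a \<and> j = b then q else 0) * x ^ i * y ^ j)"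
    for x y :: complex
  proof -
    have "(\<Sum>i\<le>max a b. \<Sum>j\<le>max a b. of_rat (if i = a \<and> j = b then q else 0) * x ^ i * y ^ j)
        = (\<Sum>i\<le>max a b. \<Sum>j\<le>max a b. if j = b then (if i = a then of_rat q * x ^ i * y ^ j else 0) else 0)"
      by (intro sum.cong refl) auto
    also have "\<dots> = (\<Sum>i\<le>max a b. if i = a then of_rat q * x ^ i * y ^ b else 0)"
      by (intro sum.cong refl) (subst sum.delta, auto)
    also have "\<dots> = of_rat q * x ^ a * y ^ b" by (subst sum.delta) auto
    finally show ?thesis ..
  qed
  thus ?case by (intro exI[of _ "max a b"] exI[of _ "\<lambda>i j. if i = a \<and> j = b then q else 0"]) simp
next
  case (add f g)
  from add.IH(1) obtain N c where f: "\<And>x y. f x y = (\<Sum>a\<le>N. \<Sum>b\<le>N. of_rat (c a b) * x ^ a * y ^ b)"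
    by blast
  from add.IH(2) obtain M d where g: "\<And>x y. g x y = (\<Sum>a\<le>M. \<Sum>b\<le>M. of_rat (d a b) * x ^ a * y ^ b)"
    by blast
  have pad: "(\<Sum>a\<le>n. \<Sum>b\<le>n. of_rat (e a b) * x ^ a * y ^ b)
      = (\<Sum>a\<le>N + M. \<Sum>b\<le>N + M. of_rat (if a \<le> n \<and> b \<le> n then e a b else 0) * x ^ a * y ^ b)"
    if "n \<le> N + M" for n and e :: "nat \<Rightarrow> nat \<Rightarrow> rat" and x y :: complex
  proof -
    have "(\<Sum>a\<le>N + M. \<Sum>b\<le>N + M. of_rat (if a \<le> n \<and> b \<le> n then e a b else 0) * x ^ a * y ^ b)
        = (\<Sum>a\<le>n. \<Sum>b\<le>N + M. of_rat (if a \<le> n \<and> b \<le> n then e a b else 0) * x ^ a * y ^ b)"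
      using that by (intro sum.mono_neutral_right) auto
    also have "\<dots> = (\<Sum>a\<le>n. \<Sum>b\<le>n. of_rat (if a \<le> n \<and> b \<le> n then e a b else 0) * x ^ a * y ^ b)"
      using that by (intro sum.cong refl sum.mono_neutral_right) auto
    finally show ?thesis by simp
  qed
  define e where "e a b = (if a \<le> N \<and> b \<le> N then c a b else 0) + (if a \<le> M \<and> b \<le> M then d a b else 0)" for a b
  have "f x y + g x y = (\<Sum>a\<le>N + M. \<Sum>b\<le>N + M. of_rat (e a b) * x ^ a * y ^ b)" for x y
    unfolding f g e_def of_rat_add distrib_right sum.distrib
    by (intro arg_cong2[where f = "(+)"] pad) auto
  thus ?case by blast
qed

lemma rat_poly2_shift_coeff: "rat_poly2 (\<lambda>tp tm. shift_coeff tm a d)"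
proof -
  have b: "rat_poly2 (\<lambda>tp tm. bpoly a tm)"
  proof -
    have "rat_poly2 (\<lambda>tp tm. (- fact a * (bern j / fact (Suc a - j))) * tm ^ (Suc a - j))" for j
    proof (rule rat_poly2_mult[OF rat_poly2_const])
      show "- fact a * (bern j / fact (Suc a - j)) \<in> \<rat>"
        by (intro Rats_mult Rats_divide bern_Rats fact_Rats) (simp add: fact_Rats)
      show "rat_poly2 (\<lambda>tp tm. tm ^ (Suc a - j))"
        using rat_poly2.monom[of 1 0 "Suc a - j"] by simp
    qed
    hence "rat_poly2 (\<lambda>tp tm. \<Sum>j\<le>Suc a. (- fact a * (bern j / fact (Suc a - j))) * tm ^ (Suc a - j))"
      by (rule rat_poly2_sum)
    thus ?thesis unfolding bpoly_def sum_distrib_left by (simp add: mult_ac del: sum.atMost_Suc fact_Suc)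
  qed
  have minus: "rat_poly2 (\<lambda>tp tm. - bpoly a tm)"
    using rat_poly2_mult[OF rat_poly2_const[of "-1"] b] by simp
  have c: "- fact a * (bern (Suc a - d) + (if d = a then 1 else 0)) \<in> \<rat>"
    by (intro Rats_mult Rats_add bern_Rats) (auto simp: fact_Rats)
  show ?thesis
  proof (cases "d \<le> Suc a")
    case True
    have eq: "shift_coeff u a d = - fact a * (bern (Suc a - d) + (if d = a then 1 else 0))
        + (if d = 0 then - bpoly a u else 0)" for u
      using True by (simp add: shift_coeff_def)
    have "rat_poly2 (\<lambda>tp tm. - fact a * (bern (Suc a - d) + (if d = a then 1 else 0))
        + (if d = 0 then - bpoly a tm else 0))"
      by (rule rat_poly2.add[OF rat_poly2_const[OF c]]) (cases "d = 0"; simp add: minus rat_poly2_const)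
    thus ?thesis by (simp only: eq)
  qed (simp add: shift_coeff_def rat_poly2_const)
qed

lemma rat_poly2_zetaU_value: "rat_poly2 (\<lambda>tp tm. zetaU_value tp tm ks c)"
proof (induction ks arbitrary: c)
  case Nil
  have "rat_poly2 (\<lambda>tp tm. 1 / fact c * (of_rat 1 * tp ^ c * tm ^ 0))"
    by (intro rat_poly2_mult rat_poly2_const rat_poly2.monom Rats_divide fact_Rats) auto
  thus ?case by simp
next
  case (Cons k ks)
  have "rat_poly2 (\<lambda>tp tm. 1 / fact c * (\<Sum>d\<le>Suc (k + c). shift_coeff tm (k + c) d * zetaU_value tp tm ks d))"
    by (intro rat_poly2_mult[OF rat_poly2_const] rat_poly2_sum rat_poly2_mult rat_poly2_shift_coeff Cons
          Rats_divide fact_Rats) auto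
  thus ?case by (simp del: sum.atMost_Suc)
qed

section \<open>Bounds and generating series of the step coefficients\<close>

lemma norm_bpoly_le: "norm (bpoly a u) \<le> fact a * exp (norm u)"
proof -
  have "norm (bpoly a u) = fact a * norm (\<Sum>j\<le>Suc a. bern j * u ^ (Suc a - j) / fact (Suc a - j))"
    by (simp add: bpoly_def norm_mult norm_fact del: sum.atMost_Suc)
  also have "norm (\<Sum>j\<le>Suc a. bern j * u ^ (Suc a - j) / fact (Suc a - j))
      \<le> (\<Sum>j\<le>Suc a. norm u ^ (Suc a - j) / fact (Suc a - j))"
  proof (rule sum_norm_le)
    fix j
    have "norm (bern j) * (norm u ^ (Suc a - j) / fact (Suc a - j)) \<le> 1 * (norm u ^ (Suc a - j) / fact (Suc a - j))"
      by (intro mult_right_mono norm_bern_le) auto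
    thus "norm (bern j * u ^ (Suc a - j) / fact (Suc a - j)) \<le> norm u ^ (Suc a - j) / fact (Suc a - j)"
      by (simp add: norm_mult norm_divide norm_power norm_fact del: fact_Suc)
  qed
  also have "\<dots> = (\<Sum>j\<le>Suc a. norm u ^ j / fact j)"
    by (rule sum.reindex_bij_witness[of _ "\<lambda>j. Suc a - j" "\<lambda>j. Suc a - j"]) auto
  also have "\<dots> \<le> exp (norm u)"
  proof -
    have "(\<lambda>j. norm u ^ j / fact j) sums exp (norm u)"
      using exp_converges[of "norm u"] by (simp add: divide_inverse mult.commute)
    from sum_le_suminf[OF sums_summable[OF this], of "{..Suc a}"] sums_unique[OF this]
    show ?thesis by (simp del: sum.atMost_Suc)
  qed
  finally show ?thesis by simp
qed

lemma norm_shift_coeff_le: "norm (shift_coeff u a d / fact a) \<le> 2 + exp (norm u)"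
proof (cases "d \<le> Suc a")
  case True
  have "norm (shift_coeff u a d / fact a) = norm ((bern (Suc a - d) + (if d = a then 1 else 0)) + (if d = 0 then bpoly a u / fact a else 0))"
  proof -
    have "shift_coeff u a d / fact a = - ((bern (Suc a - d) + (if d = a then 1 else 0)) + (if d = 0 then bpoly a u / fact a else 0))"
      using True by (simp add: shift_coeff_def field_simps)
    thus ?thesis by (simp only: norm_minus_cancel)
  qed
  also have "\<dots> \<le> (norm (bern (Suc a - d)) + 1) + exp (norm u)"
    by (intro order_trans[OF norm_triangle_ineq] add_mono)
       (use norm_bpoly_le[of a u] in \<open>auto simp: norm_divide norm_fact divide_le_eq mult_ac\<close>)
  also have "\<dots> \<le> 2 + exp (norm u)" using norm_bern_le[of "Suc a - d"] by simp
  finally show ?thesis .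
qed (simp add: shift_coeff_def)

lemma sums_shift_divide:
  fixes f :: "nat \<Rightarrow> complex"
  assumes "(\<lambda>n. f n * z ^ n) sums S" "z \<noteq> 0"
  shows "(\<lambda>n. f (Suc n) * z ^ n) sums ((S - f 0) / z)"
proof -
  have "(\<lambda>n. f (Suc n) * z ^ Suc n) sums (S - f 0)"
    using assms(1) sums_Suc_iff[of "\<lambda>n. f n * z ^ n" "S - f 0"] by simp
  hence "(\<lambda>n. f (Suc n) * z ^ Suc n / z) sums ((S - f 0) / z)" by (rule sums_divide)
  thus ?thesis using assms(2) by simp
qed

text \<open>Up to sign, the series of z e^(uz) / (e^z - 1) with its constant term removed and
  divided by z.\<close>

lemma bpoly_sums:
  assumes "norm z < 1" "exp z \<noteq> 1"
  shows "(\<lambda>a. bpoly a u / fact a * z ^ a) sums ((1 - z * exp (u * z) / (exp z - 1)) / z)"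
proof -
  have z: "z \<noteq> 0" using assms(2) by auto
  have rad: "ereal (norm z) < fps_conv_radius bern_fps"
    using fps_conv_radius_bern assms(1) by (metis ereal_less(3) less_le_trans)
  have "eval_fps bern_fps z = z / (exp z - 1)"
    using sums_unique2[OF sums_eval_fps[OF rad]] bern_sums[OF assms] by (simp add: bern_def)
  hence "eval_fps (bern_fps * fps_exp u) z = z * exp (u * z) / (exp z - 1)"
    by (subst eval_fps_mult) (use rad in auto)
  moreover have "ereal (norm z) < fps_conv_radius (bern_fps * fps_exp u)"
    by (rule less_le_trans[OF _ fps_conv_radius_mult]) (use rad in auto)
  ultimately have "(\<lambda>n. fps_nth (bern_fps * fps_exp u) n * z ^ n) sums (z * exp (u * z) / (exp z - 1))"
    using sums_eval_fps by metis
  from sums_minus[OF sums_shift_divide[OF this z]]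
  have "(\<lambda>n. - (fps_nth (bern_fps * fps_exp u) (Suc n) * z ^ n)) sums ((1 - z * exp (u * z) / (exp z - 1)) / z)"
    using bern_0 by (simp add: bern_def minus_divide_left)
  thus ?thesis by (simp add: bpoly_conv_fps)
qed

text \<open>The action of one step on exponentials, coefficientwise: the sum is the coefficient of
  x^d / d! in (e^(z(x+1)) - e^(zu)) / (1 - e^z). The factor \<open>0 ^ d\<close> confines the
  constant term to d = 0.\<close>

lemma shift_coeff_has_sum:
  assumes "norm z < 1" "exp z \<noteq> 1"
  shows "((\<lambda>a. shift_coeff u a d / fact a * z ^ a) has_sum (exp z * z ^ d - exp (z * u) * 0 ^ d) / (1 - exp z)) UNIV"
proof -
  have z: "z \<noteq> 0" using assms(2) by auto
  have "(\<lambda>a. shift_coeff u a d / fact a * z ^ a) sums ((exp z * z ^ d - exp (z * u) * 0 ^ d) / (1 - exp z))"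
  proof (cases d)
    case 0
    have "(\<lambda>a. - (bern (Suc a) * z ^ a) - (if a = 0 then 1 else 0) - bpoly a u / fact a * z ^ a) sums
        (- ((z / (exp z - 1) - bern 0) / z) - 1 - ((1 - z * exp (u * z) / (exp z - 1)) / z))"
      by (intro sums_diff sums_minus sums_shift_divide bern_sums bpoly_sums assms z)
         (use sums_single[of 0 "\<lambda>_. 1 :: complex"] in simp)
    also have "(\<lambda>a. - (bern (Suc a) * z ^ a) - (if a = 0 then 1 else 0) - bpoly a u / fact a * z ^ a)
        = (\<lambda>a. shift_coeff u a d / fact a * z ^ a)"
      using 0 by (auto simp: shift_coeff_def fun_eq_iff field_simps)
    also have "- ((z / (exp z - 1) - bern 0) / z) - 1 - ((1 - z * exp (u * z) / (exp z - 1)) / z)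
        = (exp z * z ^ d - exp (z * u) * 0 ^ d) / (1 - exp z)"
    proof -
      define e where "e = exp z"
      have "e - 1 \<noteq> 0" "1 - e \<noteq> 0" using assms(2) by (auto simp: e_def)
      thus ?thesis using z 0 unfolding e_def [symmetric] bern_0
        by (simp add: divide_simps mult.commute[of u z]) (simp add: algebra_simps)
    qed
    finally show ?thesis .
  next
    case (Suc d')
    \<comment> \<open>The coefficients vanish for a < d', so the series is indexed by n = a + 1 - d;
      the extra 1 at d = a becomes the term n = 1.\<close>
    have "(\<lambda>n. shift_coeff u (n + d') d / fact (n + d') * z ^ (n + d')) sums
        (- (z / (exp z - 1)) * z ^ d' - z ^ d)"
    proof -
      have "(\<lambda>n. - (bern n * z ^ n) * z ^ d' - (if n = 1 then z ^ d else 0)) sums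
          (- (z / (exp z - 1)) * z ^ d' - z ^ d)"
        by (intro sums_diff sums_minus sums_mult2 bern_sums assms)
           (use sums_single[of 1 "\<lambda>_. z ^ d"] in simp)
      also have "(\<lambda>n. - (bern n * z ^ n) * z ^ d' - (if n = 1 then z ^ d else 0))
          = (\<lambda>n. shift_coeff u (n + d') d / fact (n + d') * z ^ (n + d'))"
        using Suc by (auto simp: shift_coeff_def fun_eq_iff field_simps power_add)
      finally show ?thesis .
    qed
    hence "(\<lambda>a. shift_coeff u a d / fact a * z ^ a) sums
        (- (z / (exp z - 1)) * z ^ d' - z ^ d + (\<Sum>a<d'. shift_coeff u a d / fact a * z ^ a))"
      by (subst (asm) sums_iff_shift) 
    also have "(\<Sum>a<d'. shift_coeff u a d / fact a * z ^ a) = 0"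
      using Suc by (intro sum.neutral) (auto simp: shift_coeff_def)
    also have "- (z / (exp z - 1)) * z ^ d' - z ^ d + 0 = (exp z * z ^ d - exp (z * u) * 0 ^ d) / (1 - exp z)"
    proof -
      define e where "e = exp z"
      have "e - 1 \<noteq> 0" "1 - e \<noteq> 0" using assms(2) by (auto simp: e_def)
      thus ?thesis using Suc unfolding e_def [symmetric]
        by (simp add: divide_simps) (simp add: algebra_simps)
    qed
    finally show ?thesis .
  qed
  moreover have "summable (\<lambda>a. norm (shift_coeff u a d / fact a * z ^ a))"
  proof (rule summable_comparison_test')
    show "summable (\<lambda>a. (2 + exp (norm u)) * norm z ^ a)"
      using assms(1) by (intro summable_mult summable_geometric) auto
    show "norm (norm (shift_coeff u a d / fact a * z ^ a)) \<le> (2 + exp (norm u)) * norm z ^ a" if "a \<ge> 0" for a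
    proof -
      have "norm (shift_coeff u a d / fact a * z ^ a) \<le> (2 + exp (norm u)) * norm z ^ a"
        unfolding norm_mult norm_power by (intro mult_right_mono norm_shift_coeff_le) auto
      thus ?thesis by simp
    qed
  qed
  ultimately show ?thesis by (intro norm_summable_imp_has_sum)
qed

section \<open>The generating function\<close>

definition egf_weight :: "complex list \<Rightarrow> nat list \<Rightarrow> complex" where
  "egf_weight zs ks = (\<Prod>j<length zs. zs ! j ^ (ks ! j) / fact (ks ! j))"

lemma egf_weight_Nil [simp]: "egf_weight [] ks = 1"
  by (simp add: egf_weight_def)

lemma egf_weight_Cons: "egf_weight (z # zs) (k # ks) = z ^ k / fact k * egf_weight zs ks"
  by (simp add: egf_weight_def prod.lessThan_Suc_shift del: prod.lessThan_Suc)

lemma egf_weight_rev: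
  assumes "length ks = length zs"
  shows "egf_weight (rev zs) (rev ks) = egf_weight zs ks"
  unfolding egf_weight_def
  by (rule prod.reindex_bij_witness[of _ "\<lambda>j. length zs - Suc j" "\<lambda>j. length zs - Suc j"])
     (use assms in \<open>auto simp: rev_nth\<close>)

lemma summable_on_mult_Times:
  fixes f :: "'a \<Rightarrow> real" and g :: "'b \<Rightarrow> real"
  assumes "f summable_on A" "g summable_on B" "\<And>x. f x \<ge> 0" "\<And>y. g y \<ge> 0"
  shows "(\<lambda>(x, y). f x * g y) summable_on A \<times> B"
  by (rule summable_on_SigmaI[where g = "\<lambda>x. f x * infsum g B"])
     (use assms in \<open>auto intro!: has_sum_cmult_right has_sum_infsum summable_on_cmult_left\<close>)

lemma bij_betw_diagonals: "bij_betw (\<lambda>(a, k). (k, a - k)) (SIGMA a:UNIV. {..a}) (UNIV \<times> UNIV :: (nat \<times> nat) set)"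
  by (rule bij_betwI[of _ _ _ "\<lambda>(k, c). (k + c, k)"]) auto

lemma summable_on_binomial_diagonals:
  fixes p q :: real
  assumes "p \<ge> 0" "q \<ge> 0" "p + q < 1"
  shows "(\<lambda>(k, c). of_nat ((k + c) choose k) * p ^ k * q ^ c) summable_on UNIV \<times> UNIV"
proof -
  have "(\<lambda>(a, k). of_nat (a choose k) * p ^ k * q ^ (a - k)) summable_on (SIGMA a:UNIV. {..a})"
  proof (rule summable_on_SigmaI[where g = "\<lambda>a. (p + q) ^ a"])
    show "((\<lambda>k. case (a, k) of (a, k) \<Rightarrow> of_nat (a choose k) * p ^ k * q ^ (a - k)) has_sum (p + q) ^ a) {..a}" for a
      unfolding binomial_ring by (simp add: has_sum_finite)
    show "(\<lambda>a. (p + q) ^ a) summable_on UNIV"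
      by (rule summable_nonneg_imp_summable_on) (use assms in \<open>auto intro: summable_geometric\<close>)
  qed (use assms in auto)
  also have "?this \<longleftrightarrow> (\<lambda>(a, k). (\<lambda>(k, c). of_nat ((k + c) choose k) * p ^ k * q ^ c) (k, a - k)) summable_on (SIGMA a:UNIV. {..a})"
    by (rule summable_on_cong) auto
  also have "\<dots> \<longleftrightarrow> ?thesis"
    using summable_on_reindex_bij_betw[OF bij_betw_diagonals, of "\<lambda>(k, c). of_nat ((k + c) choose k) * p ^ k * q ^ c"]
    by (simp add: case_prod_unfold)
  finally show ?thesis .
qed

text \<open>The binomial theorem on each diagonal k + c = a, which replaces the two variables by
  their sum. Boundedness of \<open>h\<close> and |p| + |q| < 1 give absolute convergence for the
  rearrangement.\<close>

lemma has_sum_binomial_diagonals: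
  fixes p q :: complex and h :: "nat \<Rightarrow> complex"
  assumes h: "\<And>a. norm (h a) \<le> K" and pq: "norm p + norm q < 1"
    and S: "((\<lambda>a. h a * (p + q) ^ a) has_sum S) UNIV"
  shows "((\<lambda>(k, c). of_nat ((k + c) choose k) * p ^ k * q ^ c * h (k + c)) has_sum S) (UNIV \<times> UNIV)"
proof -
  let ?f = "\<lambda>(k, c). of_nat ((k + c) choose k) * p ^ k * q ^ c * h (k + c)"
  have "?f summable_on UNIV \<times> UNIV"
  proof (rule abs_summable_summable, rule Infinite_Sum.abs_summable_on_comparison_test')
    show "(\<lambda>x. K * (case x of (k, c) \<Rightarrow> of_nat ((k + c) choose k) * norm p ^ k * norm q ^ c)) summable_on UNIV \<times> UNIV"
      by (intro summable_on_cmult_right summable_on_binomial_diagonals) (use pq in auto)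
    show "norm (?f x) \<le> K * (case x of (k, c) \<Rightarrow> of_nat ((k + c) choose k) * norm p ^ k * norm q ^ c)" for x
    proof (cases x)
      case (Pair k c)
      have "of_nat ((k + c) choose k) * norm p ^ k * norm q ^ c * norm (h (k + c))
          \<le> of_nat ((k + c) choose k) * norm p ^ k * norm q ^ c * K"
        by (intro mult_left_mono h) auto
      thus ?thesis using Pair by (simp add: norm_mult norm_power mult_ac)
    qed
  qed
  hence "(\<lambda>x. ?f (case x of (a, k) \<Rightarrow> (k, a - k))) summable_on (SIGMA a:UNIV. {..a})"
    by (subst summable_on_reindex_bij_betw[OF bij_betw_diagonals])
  also have "?this \<longleftrightarrow> (\<lambda>(a, k). of_nat (a choose k) * p ^ k * q ^ (a - k) * h a) summable_on (SIGMA a:UNIV. {..a})"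
    by (rule summable_on_cong) auto
  finally have sum: "(\<lambda>(a, k). of_nat (a choose k) * p ^ k * q ^ (a - k) * h a) summable_on (SIGMA a:UNIV. {..a})" .
  have "((\<lambda>(a, k). of_nat (a choose k) * p ^ k * q ^ (a - k) * h a) has_sum S) (SIGMA a:UNIV. {..a})"
  proof (rule has_sum_SigmaI[OF _ S sum])
    show "((\<lambda>k. case (a, k) of (a, k) \<Rightarrow> of_nat (a choose k) * p ^ k * q ^ (a - k) * h a) has_sum h a * (p + q) ^ a) {..a}" for a
      unfolding binomial_ring sum_distrib_left by (simp add: has_sum_finite mult_ac)
  qed
  also have "?this \<longleftrightarrow> ((\<lambda>x. ?f (case x of (a, k) \<Rightarrow> (k, a - k))) has_sum S) (SIGMA a:UNIV. {..a})"
    by (rule has_sum_cong) auto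
  also have "\<dots> \<longleftrightarrow> (?f has_sum S) (UNIV \<times> UNIV)"
    by (rule has_sum_reindex_bij_betw[OF bij_betw_diagonals])
  finally show ?thesis .
qed

text \<open>The variable \<open>\<mu>\<close> marks the degree of the weight;
  \<open>zetaU_value\<close> already contains 1 / c!, so for the empty list the sum is e^(tp
  \<open>\<mu>\<close>).\<close>

definition gen_term :: "complex \<Rightarrow> complex \<Rightarrow> complex list \<Rightarrow> complex \<Rightarrow> nat list \<times> nat \<Rightarrow> complex" where
  "gen_term tp tm zs \<mu> = (\<lambda>(ks, c). zetaU_value tp tm ks c * egf_weight zs ks * \<mu> ^ c)"

definition gen_index :: "nat \<Rightarrow> (nat list \<times> nat) set" where
  "gen_index m = {ks. length ks = m} \<times> UNIV"

text \<open>The summand of \<open>gen_term\<close> at \<open>(k # ks, c)\<close>, with the recursion of \<open>zetaU_value\<close> unfolded.\<close>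
definition gen_term_split :: "complex \<Rightarrow> complex \<Rightarrow> complex list \<Rightarrow> complex \<Rightarrow> complex \<Rightarrow> (nat list \<times> nat) \<times> nat \<times> nat \<Rightarrow> complex" where
  "gen_term_split tp tm zs z \<mu> = (\<lambda>((ks, d), (k, c)). gen_term tp tm zs 1 (ks, d)
     * (of_nat ((k + c) choose k) * z ^ k * \<mu> ^ c * (shift_coeff tm (k + c) d / fact (k + c))))"

text \<open>The coefficient vanishes unless d \<le> k + c + 1, and then 1 \<le>
  \<open>\<nu> ^ d / \<nu> ^ Suc (k + c)\<close>. This gives decay in d to the sum over (ks, d),
  while the sum over (k, c) still converges because |z| + |\<open>\<mu>\<close>| <
  \<open>\<nu>\<close>.\<close>

lemma gen_term_split_summable:
  assumes IH: "gen_term tp tm zs (of_real \<nu>) summable_on gen_index (length zs)"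
    and \<nu>: "\<nu> > 0" "\<nu> \<le> 1" "norm z + norm \<mu> < \<nu>"
  shows "gen_term_split tp tm zs z \<mu> summable_on gen_index (length zs) \<times> UNIV \<times> UNIV"
proof (rule abs_summable_summable, rule Infinite_Sum.abs_summable_on_comparison_test')
  define K where "K = 2 + exp (norm tm)"
  have K: "K > 0" unfolding K_def by (simp add: add_pos_pos)
  have IH': "(\<lambda>x. norm (gen_term tp tm zs (of_real \<nu>) x)) summable_on gen_index (length zs)"
    using IH summable_on_iff_abs_summable_on_complex by blast
  have "(\<lambda>(k, c). of_nat ((k + c) choose k) * (norm z / \<nu>) ^ k * (norm \<mu> / \<nu>) ^ c) summable_on UNIV \<times> UNIV"
    by (rule summable_on_binomial_diagonals) (use \<nu> in \<open>auto simp flip: add_divide_distrib\<close>)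
  hence "(\<lambda>x. K / \<nu> * (case x of (k, c) \<Rightarrow> of_nat ((k + c) choose k) * (norm z / \<nu>) ^ k * (norm \<mu> / \<nu>) ^ c)) summable_on UNIV \<times> UNIV"
    by (rule summable_on_cmult_right)
  from summable_on_mult_Times[OF IH' this]
  show "(\<lambda>(x, y). norm (gen_term tp tm zs (of_real \<nu>) x) *
      (K / \<nu> * (case y of (k, c) \<Rightarrow> of_nat ((k + c) choose k) * (norm z / \<nu>) ^ k * (norm \<mu> / \<nu>) ^ c)))
      summable_on gen_index (length zs) \<times> UNIV \<times> UNIV"
    using K \<nu> by (auto split: prod.splits)
  fix x assume "x \<in> gen_index (length zs) \<times> (UNIV \<times> UNIV :: (nat \<times> nat) set)"
  obtain ks d k c where x: "x = ((ks, d), (k, c))" by (metis prod.collapse)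
  let ?a = "k + c"
  have coeff: "norm (shift_coeff tm ?a d / fact ?a) \<le> K * \<nu> ^ d / (\<nu> * \<nu> ^ ?a)"
  proof (cases "d \<le> Suc ?a")
    case True
    have "norm (shift_coeff tm ?a d / fact ?a) \<le> K" unfolding K_def by (rule norm_shift_coeff_le)
    also have "\<dots> = K * 1" by simp
    also have "\<dots> \<le> K * (\<nu> ^ d / \<nu> ^ Suc ?a)"
      using K \<nu> True power_decreasing[OF True, of \<nu>] by (intro mult_left_mono) auto
    finally show ?thesis by simp
  qed (use K \<nu> in \<open>simp add: shift_coeff_def\<close>)
  have "norm (gen_term_split tp tm zs z \<mu> x) = norm (gen_term tp tm zs 1 (ks, d))
      * (of_nat (?a choose k) * norm z ^ k * norm \<mu> ^ c * norm (shift_coeff tm ?a d / fact ?a))"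
    by (simp add: x gen_term_split_def norm_mult norm_power norm_divide)
  also have "\<dots> \<le> norm (gen_term tp tm zs 1 (ks, d))
      * (of_nat (?a choose k) * norm z ^ k * norm \<mu> ^ c * (K * \<nu> ^ d / (\<nu> * \<nu> ^ ?a)))"
    by (intro mult_left_mono coeff) auto
  also have "\<dots> = norm (gen_term tp tm zs (of_real \<nu>) (ks, d)) *
      (K / \<nu> * (of_nat (?a choose k) * (norm z / \<nu>) ^ k * (norm \<mu> / \<nu>) ^ c))"
    using \<nu> by (simp add: gen_term_def norm_mult norm_power power_add power_divide field_simps)
  finally show "norm (gen_term_split tp tm zs z \<mu> x) \<le> (\<lambda>(x, y). norm (gen_term tp tm zs (of_real \<nu>) x) *
      (K / \<nu> * (case y of (k, c) \<Rightarrow> of_nat ((k + c) choose k) * (norm z / \<nu>) ^ k * (norm \<mu> / \<nu>) ^ c))) x"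
    by (simp add: x)
qed

text \<open>Summing over d first undoes the splitting: the binomial coefficient over (k + c)! is 1 /
  (k! c!), and the recursion of \<open>zetaU_value\<close> reappears.\<close>

lemma gen_term_split_has_sum_imp:
  assumes "(gen_term_split tp tm zs z \<mu> has_sum S) (gen_index (length zs) \<times> UNIV \<times> UNIV)"
  shows "(gen_term tp tm (z # zs) \<mu> has_sum S) (gen_index (length (z # zs)))"
proof -
  let ?g = "\<lambda>((kks, c), d). gen_term_split tp tm zs z \<mu> ((tl kks, d), (hd kks, c))"
  have bij: "bij_betw (\<lambda>((kks, c), d). ((tl kks, d), (hd kks, c)))
      (gen_index (Suc (length zs)) \<times> UNIV) (gen_index (length zs) \<times> UNIV \<times> UNIV)"
    by (rule bij_betwI[of _ _ _ "\<lambda>((ks, d), (k, c)). ((k # ks, c), d)"])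
       (auto simp: gen_index_def length_Suc_conv)
  have "(?g has_sum S) (gen_index (Suc (length zs)) \<times> UNIV)"
    using has_sum_reindex_bij_betw[OF bij, of "gen_term_split tp tm zs z \<mu>" S] assms
    by (simp add: case_prod_unfold)
  hence "(gen_term tp tm (z # zs) \<mu> has_sum S) (gen_index (Suc (length zs)))"
  proof (rule has_sum_SigmaD)
    fix x assume "x \<in> gen_index (Suc (length zs))"
    then obtain k ks c where x: "x = (k # ks, c)" by (auto simp: gen_index_def length_Suc_conv)
    have val: "gen_term tp tm (z # zs) \<mu> x = (\<Sum>d\<le>Suc (k + c). ?g (x, d))"
    proof -
      have binom: "of_nat ((k + c) choose k) / fact (k + c) = (1 / (fact k * fact c) :: complex)"
        by (simp add: binomial_fact)
      have "?g (x, d) = (of_nat ((k + c) choose k) / fact (k + c)) * (z ^ k * \<mu> ^ c * egf_weight zs ks *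
          (shift_coeff tm (k + c) d * zetaU_value tp tm ks d))" for d
        by (simp add: x gen_term_split_def gen_term_def)
      thus ?thesis unfolding binom
        by (simp add: x gen_term_def egf_weight_Cons sum_distrib_left sum_distrib_right sum_divide_distrib mult_ac
                 del: sum.atMost_Suc)
    qed
    have "((\<lambda>d. ?g (x, d)) has_sum (\<Sum>d\<le>Suc (k + c). ?g (x, d))) {..Suc (k + c)}"
      by (rule has_sum_finite) auto
    also have "?this \<longleftrightarrow> ((\<lambda>d. ?g (x, d)) has_sum (\<Sum>d\<le>Suc (k + c). ?g (x, d))) UNIV"
      by (rule has_sum_cong_neutral) (auto simp: x gen_term_split_def shift_coeff_def)
    finally show "((\<lambda>d. ?g (x, d)) has_sum gen_term tp tm (z # zs) \<mu> x) UNIV"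
      unfolding val .
  qed
  thus ?thesis by simp
qed

lemma gen_term_summable:
  assumes "(\<Sum>z\<leftarrow>zs. norm z) + norm \<mu> < 1"
  shows "gen_term tp tm zs \<mu> summable_on gen_index (length zs)"
  using assms
proof (induction zs arbitrary: \<mu>)
  case Nil
  have "(\<lambda>c. (tp * \<mu>) ^ c / fact c) summable_on UNIV"
    by (rule norm_summable_imp_summable_on)
       (use summable_norm_exp[of "tp * \<mu>"] in \<open>simp add: scaleR_conv_of_real divide_inverse mult.commute norm_mult\<close>)
  also have "?this \<longleftrightarrow> gen_term tp tm [] \<mu> summable_on gen_index 0"
    by (rule summable_on_reindex_bij_witness[of _ snd "\<lambda>c. ([], c)"])
       (auto simp: gen_index_def gen_term_def power_mult_distrib)
  finally show ?case by simp
next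
  case (Cons z zs)
  have zs: "(\<Sum>z\<leftarrow>zs. norm z) \<ge> 0" by (rule sum_list_nonneg) auto
  have sum1: "norm z + norm \<mu> + (\<Sum>z\<leftarrow>zs. norm z) < 1" using Cons.prems by simp
  have pos: "norm z + norm \<mu> \<ge> 0" by simp
  from sum1 have "norm z + norm \<mu> < 1 - (\<Sum>z\<leftarrow>zs. norm z)" by simp
  \<comment> \<open>This leaves room on both sides: for the sum over (k, c) below
    \<open>\<nu>\<close>, and for the induction hypothesis with \<open>\<nu>\<close> in place of
    \<open>\<mu>\<close>.\<close>
  from dense[OF this] obtain \<nu> where between: "norm z + norm \<mu> < \<nu>" "\<nu> < 1 - (\<Sum>z\<leftarrow>zs. norm z)" by blast
  hence \<nu>: "\<nu> > 0" "\<nu> \<le> 1" "norm z + norm \<mu> < \<nu>" "(\<Sum>z\<leftarrow>zs. norm z) + \<nu> < 1"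
    using zs le_less_trans[OF pos between(1)] by simp_all
  have "gen_term tp tm zs (of_real \<nu>) summable_on gen_index (length zs)"
    using \<nu> by (intro Cons.IH) simp
  from gen_term_split_summable[OF this \<nu>(1-3)]
  have "(gen_term_split tp tm zs z \<mu> has_sum infsum (gen_term_split tp tm zs z \<mu>) (gen_index (length zs) \<times> UNIV \<times> UNIV))
      (gen_index (length zs) \<times> UNIV \<times> UNIV)" by (rule has_sum_infsum)
  from gen_term_split_has_sum_imp[OF this] show ?case by (rule has_sum_imp_summable)
qed

text \<open>Summing the split series over (k, c) first instead gives the exponential step at z +
  \<open>\<mu>\<close>. Its two terms turn the remaining sum into \<open>gen_term\<close> at z +
  \<open>\<mu>\<close> and, through \<open>0 ^ d\<close>, at 0.\<close>

lemma gen_term_Cons_has_sum: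
  assumes small: "(\<Sum>z\<leftarrow>z # zs. norm z) + norm \<mu> < 1" and ne: "exp (z + \<mu>) \<noteq> 1"
    and A: "(gen_term tp tm zs (z + \<mu>) has_sum A) (gen_index (length zs))"
    and B: "(gen_term tp tm zs 0 has_sum B) (gen_index (length zs))"
  shows "(gen_term tp tm (z # zs) \<mu> has_sum
    (exp (z + \<mu>) * A - exp ((z + \<mu>) * tm) * B) / (1 - exp (z + \<mu>))) (gen_index (length (z # zs)))"
proof -
  let ?l = "z + \<mu>"
  let ?D = "1 - exp ?l"
  have zs: "(\<Sum>z\<leftarrow>zs. norm z) \<ge> 0" by (rule sum_list_nonneg) auto
  have sum1: "norm z + norm \<mu> + (\<Sum>z\<leftarrow>zs. norm z) < 1" using small by simp
  have pos: "norm z + norm \<mu> \<ge> 0" by simp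
  from sum1 have "norm z + norm \<mu> < 1 - (\<Sum>z\<leftarrow>zs. norm z)" by simp
  from dense[OF this] obtain \<nu> where between: "norm z + norm \<mu> < \<nu>" "\<nu> < 1 - (\<Sum>z\<leftarrow>zs. norm z)" by blast
  hence \<nu>: "\<nu> > 0" "\<nu> \<le> 1" "norm z + norm \<mu> < \<nu>" "(\<Sum>z\<leftarrow>zs. norm z) + \<nu> < 1"
    using zs le_less_trans[OF pos between(1)] by simp_all
  have l: "norm z + norm \<mu> < 1" "norm ?l < 1" using \<nu> norm_triangle_ineq[of z \<mu>] by auto
  have "gen_term tp tm zs (of_real \<nu>) summable_on gen_index (length zs)"
    using \<nu> by (intro gen_term_summable) simp
  from gen_term_split_summable[OF this \<nu>(1-3)]
  have sum: "(gen_term_split tp tm zs z \<mu> has_sum infsum (gen_term_split tp tm zs z \<mu>) (gen_index (length zs) \<times> UNIV \<times> UNIV))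
      (gen_index (length zs) \<times> UNIV \<times> UNIV)" (is "(_ has_sum ?S) _") by (rule has_sum_infsum)
  have "((\<lambda>(ks, d). gen_term tp tm zs 1 (ks, d) * ((exp ?l * ?l ^ d - exp (?l * tm) * 0 ^ d) / ?D)) has_sum ?S)
      (gen_index (length zs))"
  proof (rule has_sum_SigmaD[OF sum])
    fix x :: "nat list \<times> nat"
    obtain ks d where x: "x = (ks, d)" by fastforce
    have "((\<lambda>(k, c). of_nat ((k + c) choose k) * z ^ k * \<mu> ^ c * (shift_coeff tm (k + c) d / fact (k + c)))
        has_sum (exp ?l * ?l ^ d - exp (?l * tm) * 0 ^ d) / ?D) (UNIV \<times> UNIV)"
      by (rule has_sum_binomial_diagonals[OF norm_shift_coeff_le l(1) shift_coeff_has_sum[OF l(2) ne]])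
    from has_sum_cmult_right[OF this, of "gen_term tp tm zs 1 x"]
    show "((\<lambda>y. gen_term_split tp tm zs z \<mu> (x, y)) has_sum
        (case x of (ks, d) \<Rightarrow> gen_term tp tm zs 1 (ks, d) * ((exp ?l * ?l ^ d - exp (?l * tm) * 0 ^ d) / ?D))) (UNIV \<times> UNIV)"
      by (simp add: x gen_term_split_def case_prod_unfold)
  qed
  moreover have "((\<lambda>(ks, d). gen_term tp tm zs 1 (ks, d) * ((exp ?l * ?l ^ d - exp (?l * tm) * 0 ^ d) / ?D)) has_sum
      (exp ?l / ?D * A + - exp (?l * tm) / ?D * B)) (gen_index (length zs))"
    by (rule has_sum_cong[THEN iffD1, OF _ has_sum_add[OF has_sum_cmult_right[OF A] has_sum_cmult_right[OF B]]])
       (auto simp: gen_term_def diff_divide_distrib algebra_simps)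
  ultimately have "?S = exp ?l / ?D * A + - exp (?l * tm) / ?D * B" by (rule has_sum_unique)
  also have "\<dots> = (exp ?l * A - exp (?l * tm) * B) / ?D" by (simp add: diff_divide_distrib)
  finally show ?thesis using gen_term_split_has_sum_imp[OF sum] by simp
qed

section \<open>The closed form and its recursion\<close>

lemma zsum_append_left:
  assumes "b \<le> length z"
  shows "zsum (z @ ys) a b = zsum z a b"
  unfolding zsum_def using assms by (intro sum.cong) (auto simp: nth_append)

lemma zsum_snoc:
  assumes "a \<le> length z"
  shows "zsum (z @ v # ys) a (Suc (length z)) = zsum z a (length z) + v"
  using assms zsum_append_left[of "length z" z "v # ys" a] by (simp add: zsum_def)

lemma zsum_self [simp]: "zsum z b b = 0"
  by (simp add: zsum_def)

lemma zsum_snoc_last: "zsum (z @ [v, w]) (Suc (length z)) (Suc (Suc (length z))) = w"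
  by (simp add: zsum_def nth_append)

lemma zsum_snoc2:
  assumes "a \<le> length z"
  shows "zsum (z @ [v, w]) a (Suc (Suc (length z))) = zsum z a (length z) + v + w"
  using assms zsum_snoc[of a z v "[w]"] by (simp add: zsum_def nth_append)

abbreviation left_factor :: "complex \<Rightarrow> complex" where
  "left_factor s \<equiv> exp s / (1 - exp s)"

text \<open>Isolates the last variable: for a cut before it, v enters only through one final factor,
  while for the cut after it v enters every left factor.\<close>

lemma G_rhs_snoc:
  "G_rhs tp tm (z @ [v]) =
    (\<Sum>i\<le>length z. (-1) ^ (length z - i) * exp (tp * zsum z 0 i) * (\<Prod>l<i. left_factor (zsum z l i))
        * (\<Prod>l=i..<length z. 1 / (1 - exp (zsum z i (Suc l))))
        * (- exp (tm * (zsum z i (length z) + v)) / (1 - exp (zsum z i (length z) + v))))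
    + exp (tp * (zsum z 0 (length z) + v)) * (\<Prod>l\<le>length z. left_factor (zsum z l (length z) + v))"
proof -
  let ?n = "length z"
  have "(-1) ^ (Suc ?n - i) * exp (tp * zsum (z @ [v]) 0 i + tm * zsum (z @ [v]) i (Suc ?n))
        * (\<Prod>l<i. left_factor (zsum (z @ [v]) l i))
        * (\<Prod>l=i..<Suc ?n. 1 / (1 - exp (zsum (z @ [v]) i (Suc l))))
      = (-1) ^ (?n - i) * exp (tp * zsum z 0 i) * (\<Prod>l<i. left_factor (zsum z l i))
        * (\<Prod>l=i..<?n. 1 / (1 - exp (zsum z i (Suc l))))
        * (- exp (tm * (zsum z i ?n + v)) / (1 - exp (zsum z i ?n + v)))" if "i \<le> ?n" for i
    using that by (simp add: zsum_append_left zsum_snoc Suc_diff_le exp_add mult_ac)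
  moreover have "(\<Prod>l<Suc ?n. left_factor (zsum (z @ [v]) l (Suc ?n)))
      = (\<Prod>l\<le>?n. left_factor (zsum z l ?n + v))"
    by (simp only: lessThan_Suc_atMost) (auto intro!: prod.cong simp: zsum_snoc)
  moreover have "{0..Suc ?n} = insert (Suc ?n) {..?n}" by auto
  ultimately show ?thesis
    unfolding G_rhs_def Let_def
    by (simp add: zsum_snoc del: prod.lessThan_Suc)
qed

text \<open>The recursion of \<open>gen_term_Cons_has_sum\<close> for the closed form. Cuts i \<le>
  \<open>length z\<close> match by partial fractions; the last two cuts supply the all-left terms P
  and Q of the two shorter closed forms.\<close>

lemma G_rhs_merge:
  assumes w: "exp w \<noteq> 1"
    and v: "\<And>i. i \<le> length z \<Longrightarrow> exp (zsum z i (length z) + v) \<noteq> 1"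
    and vw: "\<And>i. i \<le> length z \<Longrightarrow> exp (zsum z i (length z) + v + w) \<noteq> 1"
  shows "G_rhs tp tm (z @ [v, w]) =
    (exp w * G_rhs tp tm (z @ [v + w]) - exp (w * tm) * G_rhs tp tm (z @ [v])) / (1 - exp w)"
proof -
  let ?n = "length z"
  let ?s = "\<lambda>i. zsum z i ?n"
  define c where "c i = (-1) ^ (?n - i) * exp (tp * zsum z 0 i) * (\<Prod>l<i. left_factor (zsum z l i))
        * (\<Prod>l=i..<?n. 1 / (1 - exp (zsum z i (Suc l))))" for i
  define P where "P = exp (tp * (?s 0 + v)) * (\<Prod>l\<le>?n. left_factor (?s l + v))"
  define Q where "Q = exp (tp * (?s 0 + (v + w))) * (\<Prod>l\<le>?n. left_factor (?s l + (v + w)))"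
  let ?L = "\<lambda>i. (-1) ^ (Suc ?n - i) * exp (tp * zsum (z @ [v]) 0 i) * (\<Prod>l<i. left_factor (zsum (z @ [v]) l i))
        * (\<Prod>l=i..<Suc ?n. 1 / (1 - exp (zsum (z @ [v]) i (Suc l))))
        * (- exp (tm * (zsum (z @ [v]) i (Suc ?n) + w)) / (1 - exp (zsum (z @ [v]) i (Suc ?n) + w)))"
  let ?R = "\<lambda>i. (exp w * (c i * (- exp (tm * (?s i + (v + w))) / (1 - exp (?s i + (v + w)))))
          - exp (w * tm) * (c i * (- exp (tm * (?s i + v)) / (1 - exp (?s i + v))))) / (1 - exp w)"
  have *: "?L i
      = ?R i"
    if i: "i \<le> ?n" for i
  proof -
    define y where "y = exp (?s i + v)"
    define q where "q = exp w"
    define e where "e = exp (tm * (?s i + v + w))"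
    have y: "1 - y \<noteq> 0" "1 - y * q \<noteq> 0" "1 - q \<noteq> 0"
      using v[OF i] vw[OF i] w unfolding y_def q_def by (simp_all add: exp_add mult_ac)
    have "?L i
        = c i * e * (1 / (1 - y) * (1 / (1 - y * q)))"
      using i by (simp add: zsum_append_left zsum_snoc Suc_diff_le c_def e_def y_def q_def exp_add mult_ac)
    \<comment> \<open>The numerator of the difference is (1 - yq) - q(1 - y) = 1 - q.\<close>
    also have "1 / (1 - y) * (1 / (1 - y * q)) = (1 / (1 - y) - q / (1 - y * q)) / (1 - q)"
      using y by (simp add: divide_simps) (simp add: algebra_simps)
    also have "c i * e * ((1 / (1 - y) - q / (1 - y * q)) / (1 - q))
        = (q * (c i * (- e / (1 - y * q))) - c i * (- e / (1 - y))) / (1 - q)"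
      by (simp add: algebra_simps diff_divide_distrib)
    finally show ?thesis
      by (simp add: e_def y_def q_def exp_add algebra_simps)
  qed
  have "G_rhs tp tm (z @ [v, w]) = (\<Sum>i\<le>?n. ?R i)
      + P * (- exp (tm * w) / (1 - exp w)) + Q * left_factor w"
  proof -
    have last_prod: "(\<Prod>l\<le>Suc ?n. left_factor (zsum (z @ [v]) l (Suc ?n) + w))
        = (\<Prod>l\<le>?n. left_factor (?s l + (v + w))) * left_factor w"
      by simp (auto intro!: prod.cong simp: zsum_snoc add.assoc)
    have "z @ [v, w] = (z @ [v]) @ [w]" by simp
    hence "G_rhs tp tm (z @ [v, w]) = G_rhs tp tm ((z @ [v]) @ [w])" by simp
    also have "\<dots> = (\<Sum>i\<le>?n. ?R i)
      + P * (- exp (tm * w) / (1 - exp w)) + Q * left_factor w"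
    proof -
      have "sum ?L {..?n} = sum ?R {..?n}" by (intro sum.cong refl *) auto
      thus ?thesis
        unfolding G_rhs_snoc length_append_singleton sum.atMost_Suc last_prod
        by (intro arg_cong2[where f = "(+)"])
           (simp_all add: lessThan_Suc_atMost P_def Q_def zsum_snoc add.assoc del: prod.lessThan_Suc)
    qed
    finally show ?thesis .
  qed
  also have "\<dots> = (exp w * ((\<Sum>i\<le>?n. c i * (- exp (tm * (?s i + (v + w))) / (1 - exp (?s i + (v + w))))) + Q)
      - exp (w * tm) * ((\<Sum>i\<le>?n. c i * (- exp (tm * (?s i + v)) / (1 - exp (?s i + v)))) + P)) / (1 - exp w)"
  proof -
    have collect: "(e * A - f * B) / D + P' * (- f / D) + Q' * (e / D) = (e * (A + Q') - f * (B + P')) / D"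
      for e f A B D P' Q' :: complex
      by (simp add: ring_distribs add_divide_distrib diff_divide_distrib mult_ac)
    show ?thesis
      unfolding sum_divide_distrib [symmetric] sum_subtractf sum_distrib_left [symmetric] mult.commute[of tm w]
      by (rule collect)
  qed
  also have "(\<Sum>i\<le>?n. c i * (- exp (tm * (?s i + (v + w))) / (1 - exp (?s i + (v + w))))) + Q = G_rhs tp tm (z @ [v + w])"
    unfolding G_rhs_snoc c_def Q_def ..
  also have "(\<Sum>i\<le>?n. c i * (- exp (tm * (?s i + v)) / (1 - exp (?s i + v)))) + P = G_rhs tp tm (z @ [v])"
    unfolding G_rhs_snoc c_def P_def ..
  finally show ?thesis .
qed

text \<open>The condition covers all blocks of consecutive variables and is therefore inherited when
  the last entry is dropped or merged with its predecessor, as the recursion demands.\<close>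

definition nonsingular :: "complex list \<Rightarrow> bool" where
  "nonsingular z \<longleftrightarrow> (\<forall>a b. a < b \<and> b \<le> length z \<longrightarrow> exp (zsum z a b) \<noteq> 1)"

lemma nonsingular_snoc2:
  assumes "nonsingular (z @ [v, w])"
  shows "exp w \<noteq> 1" "\<And>i. i \<le> length z \<Longrightarrow> exp (zsum z i (length z) + v) \<noteq> 1"
    "\<And>i. i \<le> length z \<Longrightarrow> exp (zsum z i (length z) + v + w) \<noteq> 1"
    "nonsingular (z @ [v])" "nonsingular (z @ [v + w])"
proof -
  let ?n = "length z"
  have *: "exp (zsum (z @ [v, w]) a b) \<noteq> 1" if "a < b" "b \<le> Suc (Suc ?n)" for a b
    using assms that by (simp add: nonsingular_def)
  show w: "exp w \<noteq> 1" using *[of "Suc ?n" "Suc (Suc ?n)"] by (simp add: zsum_snoc_last)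
  show v: "exp (zsum z i ?n + v) \<noteq> 1" if "i \<le> ?n" for i
    using *[of i "Suc ?n"] that by (simp add: zsum_snoc)
  show vw: "exp (zsum z i ?n + v + w) \<noteq> 1" if "i \<le> ?n" for i
    using *[of i "Suc (Suc ?n)"] that by (simp add: zsum_snoc2)
  have z: "exp (zsum z a b) \<noteq> 1" if "a < b" "b \<le> ?n" for a b
    using *[of a b] that by (simp add: zsum_append_left)
  have "exp (zsum (z @ [y]) a b) \<noteq> 1"
    if "\<And>i. i \<le> ?n \<Longrightarrow> exp (zsum z i ?n + y) \<noteq> 1" "a < b" "b \<le> Suc ?n" for y a b
    using that z by (cases "b = Suc ?n") (auto simp: zsum_append_left zsum_snoc)
  thus "nonsingular (z @ [v])" "nonsingular (z @ [v + w])"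
    using v vw by (auto simp: nonsingular_def add.assoc)
qed

text \<open>The marker \<open>\<mu>\<close> merely shifts the last variable. Keeping it general
  closes the induction, which needs the shorter list both with marker v + \<open>\<mu>\<close> and
  with marker 0.\<close>

lemma gen_term_has_sum_G_rhs:
  assumes "(\<Sum>z\<leftarrow>z @ [v]. norm z) + norm \<mu> < 1" "nonsingular (z @ [v + \<mu>])"
  shows "(gen_term tp tm (rev (z @ [v])) \<mu> has_sum G_rhs tp tm (z @ [v + \<mu>])) (gen_index (length (z @ [v])))"
  using assms
proof (induction z arbitrary: v \<mu> rule: rev_induct)
  case Nil
  have Nil_sum: "(gen_term tp tm [] l has_sum exp (tp * l)) (gen_index 0)" for l
  proof -
    have "((\<lambda>c. (tp * l) ^ c / fact c) has_sum exp (tp * l)) UNIV"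
      by (rule norm_summable_imp_has_sum)
         (use summable_norm_exp[of "tp * l"] exp_converges[of "tp * l"] in
            \<open>simp_all add: scaleR_conv_of_real divide_inverse mult.commute norm_mult\<close>)
    also have "?this \<longleftrightarrow> (gen_term tp tm [] l has_sum exp (tp * l)) (gen_index 0)"
      by (rule has_sum_reindex_bij_witness[of _ snd "\<lambda>c. ([], c)"])
         (auto simp: gen_index_def gen_term_def power_mult_distrib)
    finally show ?thesis .
  qed
  have ne: "exp (v + \<mu>) \<noteq> 1"
  proof -
    have "exp (zsum [v + \<mu>] 0 1) \<noteq> 1" using Nil.prems(2) by (simp add: nonsingular_def)
    thus ?thesis by (simp add: zsum_def)
  qed
  have "G_rhs tp tm [v + \<mu>] = (exp (v + \<mu>) * exp (tp * (v + \<mu>)) - exp ((v + \<mu>) * tm) * 1) / (1 - exp (v + \<mu>))"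
    using G_rhs_snoc[of tp tm "[]" "v + \<mu>"] by (simp add: zsum_def diff_divide_distrib mult_ac)
  moreover have "(gen_term tp tm [] (v + \<mu>) has_sum exp (tp * (v + \<mu>))) (gen_index (length ([] :: complex list)))"
    "(gen_term tp tm [] 0 has_sum 1) (gen_index (length ([] :: complex list)))"
    using Nil_sum[of "v + \<mu>"] Nil_sum[of 0] by simp_all
  ultimately show ?case
    using gen_term_Cons_has_sum[OF _ ne, of "[]" tp tm "exp (tp * (v + \<mu>))" 1] Nil.prems(1) by simp
next
  case (snoc y z)
  have ns: "nonsingular (z @ [y, v + \<mu>])" using snoc.prems(2) by simp
  note ns' = nonsingular_snoc2[OF ns]
  have "(\<Sum>z\<leftarrow>z @ [y]. norm z) + norm (v + \<mu>) \<le> (\<Sum>z\<leftarrow>z @ [y]. norm z) + (norm v + norm \<mu>)"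
    by (intro add_left_mono norm_triangle_ineq)
  also have "\<dots> < 1" using snoc.prems(1) by (simp add: add_ac)
  finally have small: "(\<Sum>z\<leftarrow>z @ [y]. norm z) + norm (v + \<mu>) < 1" .
  have small': "(\<Sum>z\<leftarrow>z @ [y]. norm z) + norm (0 :: complex) < 1"
    by (rule le_less_trans[OF _ small]) simp
  have A: "(gen_term tp tm (rev (z @ [y])) (v + \<mu>) has_sum G_rhs tp tm (z @ [y + (v + \<mu>)])) (gen_index (length (rev (z @ [y]))))"
    using snoc.IH[OF small] ns'(5) by simp
  have B: "(gen_term tp tm (rev (z @ [y])) 0 has_sum G_rhs tp tm (z @ [y])) (gen_index (length (rev (z @ [y]))))"
    using snoc.IH[OF small'] ns'(4) by simp
  have "(\<Sum>z\<leftarrow>v # rev (z @ [y]). norm z) + norm \<mu> < 1"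
    using snoc.prems(1) by (simp add: sum_list_rev rev_map [symmetric] algebra_simps)
  from gen_term_Cons_has_sum[OF this ns'(1) A B] G_rhs_merge[OF ns'(1-3), of tp tm]
  show ?case by simp
qed

lemma zetaU_value_generating_function:
  assumes "z \<noteq> []" "(\<Sum>x\<leftarrow>z. norm x) < 1" "nonsingular z"
  shows "((\<lambda>ks. zetaU_value tp tm (rev ks) 0 * egf_weight z ks) has_sum G_rhs tp tm z) {ks. length ks = length z}"
proof -
  obtain z' v where z: "z = z' @ [v]" using assms(1) by (cases z rule: rev_cases) auto
  have "(gen_term tp tm (rev z) 0 has_sum G_rhs tp tm z) (gen_index (length z))"
    using gen_term_has_sum_G_rhs[of z' v 0 tp tm] assms(2,3) unfolding z by simp
  \<comment> \<open>At marker 0 only c = 0 survives, with \<open>0 ^ 0 = 1\<close>.\<close>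
  also have "?this \<longleftrightarrow> (gen_term tp tm (rev z) 0 has_sum G_rhs tp tm z) ({ks. length ks = length z} \<times> {0})"
    by (rule has_sum_cong_neutral) (auto simp: gen_index_def gen_term_def)
  also have "\<dots> \<longleftrightarrow> ?thesis"
    by (rule has_sum_reindex_bij_witness[of _ "\<lambda>ks. (rev ks, 0)" "\<lambda>(ks, c). rev ks"])
       (auto simp: gen_term_def egf_weight_rev[of _ z, symmetric])
  finally show ?thesis .
qed

theorem theorem5p1:
  fixes r :: nat
  assumes "r \<ge> 1"
  shows
    "(\<forall>ks :: nat list. length ks = r \<longrightarrow>
        (\<exists>(N :: nat) (c :: nat \<Rightarrow> nat \<Rightarrow> rat).
           \<forall>tp tm F. tp \<notin> complex_of_real ` {..-1} \<longrightarrow> tm \<notin> complex_of_real ` {1..} \<longrightarrow>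
             is_zetaU_entire tp tm r F \<longrightarrow>
             F (map (\<lambda>k. - of_nat k) ks) =
               (\<Sum>a\<le>N. \<Sum>b\<le>N. of_rat (c a b) * tp ^ a * tm ^ b)))
     \<and>
     (\<forall>tp tm F. tp \<notin> complex_of_real ` {..-1} \<longrightarrow> tm \<notin> complex_of_real ` {1..} \<longrightarrow>
        is_zetaU_entire tp tm r F \<longrightarrow>
        (\<exists>\<delta>>0. \<forall>z :: complex list. length z = r \<longrightarrow> (\<forall>j<r. norm (z ! j) < \<delta>) \<longrightarrow>
            (\<forall>a b. a < b \<and> b \<le> r \<longrightarrow> exp (zsum z a b) \<noteq> 1) \<longrightarrow>
            ((\<lambda>ks. F (map (\<lambda>k. - of_nat k) ks) * (\<Prod>j<r. z ! j ^ (ks ! j) / fact (ks ! j)))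
               has_sum G_rhs tp tm z) {ks. length ks = r}))"
proof (intro conjI allI impI)
  fix ks :: "nat list" assume ks: "length ks = r"
  obtain N c where "\<And>tp tm. zetaU_value tp tm (rev ks) 0 = (\<Sum>a\<le>N. \<Sum>b\<le>N. of_rat (c a b) * tp ^ a * tm ^ b)"
    using rat_poly2_normal_form[OF rat_poly2_zetaU_value[of "rev ks" 0]] by blast
  thus "\<exists>(N :: nat) (c :: nat \<Rightarrow> nat \<Rightarrow> rat).
           \<forall>tp tm F. tp \<notin> complex_of_real ` {..-1} \<longrightarrow> tm \<notin> complex_of_real ` {1..} \<longrightarrow>
             is_zetaU_entire tp tm r F \<longrightarrow>
             F (map (\<lambda>k. - of_nat k) ks) =
               (\<Sum>a\<le>N. \<Sum>b\<le>N. of_rat (c a b) * tp ^ a * tm ^ b)"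
    using is_zetaU_entire_value[OF _ _ _ ks] by (intro exI[of _ N] exI[of _ c] allI impI) metis
next
  fix tp tm F
  assume t: "tp \<notin> complex_of_real ` {..-1}" "tm \<notin> complex_of_real ` {1..}" and F: "is_zetaU_entire tp tm r F"
  show "\<exists>\<delta>>0. \<forall>z :: complex list. length z = r \<longrightarrow> (\<forall>j<r. norm (z ! j) < \<delta>) \<longrightarrow>
            (\<forall>a b. a < b \<and> b \<le> r \<longrightarrow> exp (zsum z a b) \<noteq> 1) \<longrightarrow>
            ((\<lambda>ks. F (map (\<lambda>k. - of_nat k) ks) * (\<Prod>j<r. z ! j ^ (ks ! j) / fact (ks ! j)))
               has_sum G_rhs tp tm z) {ks. length ks = r}"
  \<comment> \<open>This radius forces the sum of the r norms below 1.\<close>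
  proof (intro exI[of _ "1 / real r"] conjI allI impI)
    show "1 / real r > 0" using assms by simp
  next
    fix z :: "complex list"
    assume z: "length z = r" "\<forall>j<r. norm (z ! j) < 1 / real r"
      and ns: "\<forall>a b. a < b \<and> b \<le> r \<longrightarrow> exp (zsum z a b) \<noteq> 1"
    have "(\<Sum>x\<leftarrow>z. norm x) = (\<Sum>j<r. norm (z ! j))"
      using z(1) by (simp add: sum_list_sum_nth atLeast0LessThan)
    also have "\<dots> < (\<Sum>j<r. 1 / real r)"
      using z(2) assms by (intro sum_strict_mono) (auto simp: lessThan_empty_iff)
    also have "\<dots> = 1" using assms by simp
    finally have "((\<lambda>ks. zetaU_value tp tm (rev ks) 0 * egf_weight z ks) has_sum G_rhs tp tm z) {ks. length ks = length z}"
      using z(1) ns assms by (intro zetaU_value_generating_function) (auto simp: nonsingular_def)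
    also have "?this \<longleftrightarrow> ((\<lambda>ks. F (map (\<lambda>k. - of_nat k) ks) * (\<Prod>j<r. z ! j ^ (ks ! j) / fact (ks ! j)))
               has_sum G_rhs tp tm z) {ks. length ks = r}"
      unfolding z(1) by (rule has_sum_cong) (simp add: is_zetaU_entire_value[OF t F] egf_weight_def z(1))
    finally show "((\<lambda>ks. F (map (\<lambda>k. - of_nat k) ks) * (\<Prod>j<r. z ! j ^ (ks ! j) / fact (ks ! j)))
               has_sum G_rhs tp tm z) {ks. length ks = r}" .
  qed
qed

end
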